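(* Let $d\ge 3$ and let $p$ be a prime. If $d\not\equiv 0 \bmod p$, then $$L_*S_{(d-1,1)}(\mathbb{Z};2)\otimes\mathbb{F}_p=0.$$ If $d\not\equiv 0\bmod p$ and $d\not\equiv 2\bmod p$, then $$L_*S_{(d-1,1)}(\mathbb{Z};3)\otimes\mathbb{F}_p=0.$$
   Context: The Schur functor $S_{(d-1,1)}$ (over the ground ring $\mathbb{Z}$) is the kernel of the multiplication $S^{d-1}\otimes S^1\to S^d$ of symmetric powers. For a functor $F$ from finitely generated free abelian groups to abelian groups, the Dold–Puppe derived functor $L_qF(V;n)$ is the $q$-th homology of the (unnormalized) chain complex of the simplicial abelian group $F(K(n)\otimes V)$, where $K(n)$ is the simplicial free abelian group associated by the Dold–Kan correspondence to the chain complex $\mathbb{Z}$ concentrated in homological degree $n$. $L_*F(V;n)$ denotes the graded abelian group of all the $L_qF(V;n)$. *)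

theory Defs
  imports
    "HOL-Algebra.Free_Abelian_Groups"
    "HOL-Algebra.Elementary_Groups"
    "HOL-Number_Theory.Cong"
    "HOL-Library.Multiset"
begin

text \<open>Abelian groups are multiplicatively written monoid records, following
  \<^const>\<open>free_Abelian_group\<close>, \<^const>\<open>integer_group\<close> and \<^const>\<open>integer_mod_group\<close>.\<close>

section \<open>Abelian groups given by generators and relations\<close>

definition presented_group :: "'a set \<Rightarrow> ('a \<Rightarrow>\<^sub>0 int) set \<Rightarrow> ('a \<Rightarrow>\<^sub>0 int) set monoid" where
  "presented_group S R = free_Abelian_group S Mod generate (free_Abelian_group S) R"

definition presented_gen :: "'a set \<Rightarrow> ('a \<Rightarrow>\<^sub>0 int) set \<Rightarrow> 'a \<Rightarrow> ('a \<Rightarrow>\<^sub>0 int) set" where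
  "presented_gen S R s =
     generate (free_Abelian_group S) R #>\<^bsub>free_Abelian_group S\<^esub> frag_of s"

definition free_ext :: "('b, 'm) monoid_scheme \<Rightarrow> ('a \<Rightarrow> 'b) \<Rightarrow> ('a \<Rightarrow>\<^sub>0 int) \<Rightarrow> 'b" where
  "free_ext H \<phi> c = finprod H (\<lambda>s. \<phi> s [^]\<^bsub>H\<^esub> Poly_Mapping.lookup c s) (Poly_Mapping.keys c)"

text \<open>The homomorphism from a presented group to \<open>H\<close> with prescribed values \<open>\<phi>\<close> on the generators.
  Elements of a presented group are cosets; whenever \<open>\<phi>\<close> respects the relations, \<open>free_ext H \<phi>\<close> is
  constant on every coset (see \<open>presented_lift_gen\<close> and \<open>presented_lift_hom\<close> below).\<close>

definition presented_lift :: "('b, 'm) monoid_scheme \<Rightarrow> ('a \<Rightarrow> 'b) \<Rightarrow> ('a \<Rightarrow>\<^sub>0 int) set \<Rightarrow> 'b" where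
  "presented_lift H \<phi> C = the_elem (free_ext H \<phi> ` C)"

lemma free_ext_hom:
  assumes "comm_group H" "\<phi> \<in> S \<rightarrow> carrier H"
  shows "free_ext H \<phi> \<in> hom (free_Abelian_group S) H"
proof -
  interpret H: comm_group H by fact
  have sup: "free_ext H \<phi> c = finprod H (\<lambda>s. \<phi> s [^]\<^bsub>H\<^esub> Poly_Mapping.lookup c s) A"
    if "finite A" "Poly_Mapping.keys c \<subseteq> A" "A \<subseteq> S" for c A
    unfolding free_ext_def using that assms(2)
    by (intro H.finprod_mono_neutral_cong_left) (auto simp: in_keys_iff Pi_iff)
  show ?thesis
  proof (rule homI)
    fix x assume "x \<in> carrier (free_Abelian_group S)"
    then show "free_ext H \<phi> x \<in> carrier H"
      unfolding free_ext_def using assms(2) by (intro H.finprod_closed) auto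
  next
    fix x y assume "x \<in> carrier (free_Abelian_group S)" "y \<in> carrier (free_Abelian_group S)"
    then have S: "Poly_Mapping.keys x \<subseteq> S" "Poly_Mapping.keys y \<subseteq> S" by auto
    let ?A = "Poly_Mapping.keys x \<union> Poly_Mapping.keys y"
    have "free_ext H \<phi> (x + y) = finprod H (\<lambda>s. \<phi> s [^]\<^bsub>H\<^esub> Poly_Mapping.lookup (x + y) s) ?A"
      using S Poly_Mapping.keys_add[of x y] by (intro sup) auto
    also have "\<dots> = finprod H (\<lambda>s. \<phi> s [^]\<^bsub>H\<^esub> Poly_Mapping.lookup x s
                        \<otimes>\<^bsub>H\<^esub> \<phi> s [^]\<^bsub>H\<^esub> Poly_Mapping.lookup y s) ?A"
      using S assms(2) by (intro H.finprod_cong) (auto simp: lookup_add H.int_pow_mult Pi_iff subset_iff simp_implies_def)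
    also have "\<dots> = finprod H (\<lambda>s. \<phi> s [^]\<^bsub>H\<^esub> Poly_Mapping.lookup x s) ?A
                     \<otimes>\<^bsub>H\<^esub> finprod H (\<lambda>s. \<phi> s [^]\<^bsub>H\<^esub> Poly_Mapping.lookup y s) ?A"
      using S assms(2) by (intro H.finprod_multf) auto
    also have "\<dots> = free_ext H \<phi> x \<otimes>\<^bsub>H\<^esub> free_ext H \<phi> y"
      using S by (simp add: sup[of ?A])
    finally show "free_ext H \<phi> (x \<otimes>\<^bsub>free_Abelian_group S\<^esub> y) = free_ext H \<phi> x \<otimes>\<^bsub>H\<^esub> free_ext H \<phi> y"
      by simp
  qed
qed

lemma free_ext_frag_of:
  assumes "comm_group H" "\<phi> s \<in> carrier H"
  shows "free_ext H \<phi> (frag_of s) = \<phi> s"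
proof -
  interpret H: comm_group H by fact
  show ?thesis using assms(2) by (simp add: free_ext_def)
qed

context
  fixes H :: "('b, 'm) monoid_scheme" and \<phi> :: "'a \<Rightarrow> 'b" and S :: "'a set" and R :: "('a \<Rightarrow>\<^sub>0 int) set"
  assumes H: "comm_group H" and \<phi>: "\<phi> \<in> S \<rightarrow> carrier H"
    and R: "R \<subseteq> carrier (free_Abelian_group S)" "\<And>r. r \<in> R \<Longrightarrow> free_ext H \<phi> r = \<one>\<^bsub>H\<^esub>"
begin

lemma presented_lift_coset:
  assumes c: "c \<in> carrier (free_Abelian_group S)"
  shows "presented_lift H \<phi> (generate (free_Abelian_group S) R #>\<^bsub>free_Abelian_group S\<^esub> c) =
           free_ext H \<phi> c"
proof -
  interpret H: comm_group H by (rule H)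
  interpret F: comm_group "free_Abelian_group S" by (rule abelian_free_Abelian_group)
  interpret h: group_hom "free_Abelian_group S" H "free_ext H \<phi>"
    using free_ext_hom[OF H \<phi>] by unfold_locales
  have "generate (free_Abelian_group S) R \<subseteq> kernel (free_Abelian_group S) H (free_ext H \<phi>)"
    using R by (intro F.generate_subgroup_incl h.subgroup_kernel) (auto simp: kernel_def simp del: carrier_free_Abelian_group_iff)
  then have gen: "r \<in> carrier (free_Abelian_group S) \<and> free_ext H \<phi> r = \<one>\<^bsub>H\<^esub>"
    if "r \<in> generate (free_Abelian_group S) R" for r
    using that by (auto simp: kernel_def)
  have val: "free_ext H \<phi> (r \<otimes>\<^bsub>free_Abelian_group S\<^esub> c) = free_ext H \<phi> c"
    if "r \<in> generate (free_Abelian_group S) R" for r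
    using gen[OF that] c h.hom_mult[of r c] h.hom_closed[OF c] by (metis H.l_one)
  have "free_ext H \<phi> ` (generate (free_Abelian_group S) R #>\<^bsub>free_Abelian_group S\<^esub> c) = {free_ext H \<phi> c}"
    using val generate.one[of "free_Abelian_group S" R] unfolding r_coset_def by fastforce
  then show ?thesis by (simp add: presented_lift_def)
qed

lemma presented_lift_gen:
  assumes "s \<in> S"
  shows "presented_lift H \<phi> (presented_gen S R s) = \<phi> s"
proof -
  have "\<phi> s \<in> carrier H" using assms \<phi> by auto
  then show ?thesis
    using assms by (simp add: presented_gen_def presented_lift_coset free_ext_frag_of[OF H])
qed

lemma presented_lift_hom: "presented_lift H \<phi> \<in> hom (presented_group S R) H"
proof -
  interpret H: comm_group H by (rule H)
  interpret F: comm_group "free_Abelian_group S" by (rule abelian_free_Abelian_group)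
  interpret h: group_hom "free_Abelian_group S" H "free_ext H \<phi>"
    using free_ext_hom[OF H \<phi>] by unfold_locales
  interpret N: normal "generate (free_Abelian_group S) R" "free_Abelian_group S"
    using R(1) by (intro F.subgroup_imp_normal F.generate_is_subgroup)
  show ?thesis
    unfolding presented_group_def hom_def carrier_FactGroup
    using N.rcos_sum h.hom_mult h.hom_closed by (auto simp: presented_lift_coset simp del: mult_free_Abelian_group carrier_free_Abelian_group_iff)
qed

end


section \<open>Tensor products\<close>

definition tensor_rels :: "('a, 'm) monoid_scheme \<Rightarrow> ('b, 'n) monoid_scheme \<Rightarrow> ('a \<times> 'b \<Rightarrow>\<^sub>0 int) set" where
  "tensor_rels G H =
     {frag_of (x \<otimes>\<^bsub>G\<^esub> x', y) - frag_of (x, y) - frag_of (x', y) | x x' y.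
        x \<in> carrier G \<and> x' \<in> carrier G \<and> y \<in> carrier H} \<union>
     {frag_of (x, y \<otimes>\<^bsub>H\<^esub> y') - frag_of (x, y) - frag_of (x, y') | x y y'.
        x \<in> carrier G \<and> y \<in> carrier H \<and> y' \<in> carrier H}"

definition tensor_group ::
    "('a, 'm) monoid_scheme \<Rightarrow> ('b, 'n) monoid_scheme \<Rightarrow> ('a \<times> 'b \<Rightarrow>\<^sub>0 int) set monoid" where
  "tensor_group G H = presented_group (carrier G \<times> carrier H) (tensor_rels G H)"

definition tensor_elem ::
    "('a, 'm) monoid_scheme \<Rightarrow> ('b, 'n) monoid_scheme \<Rightarrow> 'a \<Rightarrow> 'b \<Rightarrow> ('a \<times> 'b \<Rightarrow>\<^sub>0 int) set" where
  "tensor_elem G H x y = presented_gen (carrier G \<times> carrier H) (tensor_rels G H) (x, y)"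

text \<open>The homomorphism \<open>f \<otimes> g\<close>; the groups \<open>G'\<close>, \<open>H'\<close> are the targets of \<open>f\<close>, \<open>g\<close>.\<close>

definition tensor_map ::
    "('c, 'm) monoid_scheme \<Rightarrow> ('d, 'n) monoid_scheme \<Rightarrow> ('a \<Rightarrow> 'c) \<Rightarrow> ('b \<Rightarrow> 'd)
      \<Rightarrow> ('a \<times> 'b \<Rightarrow>\<^sub>0 int) set \<Rightarrow> ('c \<times> 'd \<Rightarrow>\<^sub>0 int) set" where
  "tensor_map G' H' f g =
     presented_lift (tensor_group G' H') (\<lambda>(x, y). tensor_elem G' H' (f x) (g y))"


section \<open>Symmetric powers\<close>

text \<open>The \<open>d\<close>-th symmetric power of \<open>G\<close>, that is, the \<open>d\<close>-th tensor power modulo permutation of the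
  factors, is generated by the commutative products \<open>x\<^sub>1 \<cdots> x\<^sub>d\<close> of elements of \<open>G\<close>, recorded as
  multisets of size \<open>d\<close>, with additivity in each factor as the only relations.\<close>

definition sym_gens :: "nat \<Rightarrow> ('a, 'm) monoid_scheme \<Rightarrow> 'a multiset set" where
  "sym_gens d G = {M. size M = d \<and> set_mset M \<subseteq> carrier G}"

definition sym_rels :: "nat \<Rightarrow> ('a, 'm) monoid_scheme \<Rightarrow> ('a multiset \<Rightarrow>\<^sub>0 int) set" where
  "sym_rels d G =
     {frag_of (add_mset (x \<otimes>\<^bsub>G\<^esub> y) M) - frag_of (add_mset x M) - frag_of (add_mset y M) | x y M.
        x \<in> carrier G \<and> y \<in> carrier G \<and> set_mset M \<subseteq> carrier G \<and> Suc (size M) = d}"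

definition sym_power :: "nat \<Rightarrow> ('a, 'm) monoid_scheme \<Rightarrow> ('a multiset \<Rightarrow>\<^sub>0 int) set monoid" where
  "sym_power d G = presented_group (sym_gens d G) (sym_rels d G)"

definition sym_elem :: "nat \<Rightarrow> ('a, 'm) monoid_scheme \<Rightarrow> 'a multiset \<Rightarrow> ('a multiset \<Rightarrow>\<^sub>0 int) set" where
  "sym_elem d G M = presented_gen (sym_gens d G) (sym_rels d G) M"

definition sym_power_map ::
    "nat \<Rightarrow> ('b, 'm) monoid_scheme \<Rightarrow> ('a \<Rightarrow> 'b)
      \<Rightarrow> ('a multiset \<Rightarrow>\<^sub>0 int) set \<Rightarrow> ('b multiset \<Rightarrow>\<^sub>0 int) set" where
  "sym_power_map d H f = presented_lift (sym_power d H) (\<lambda>M. sym_elem d H (image_mset f M))"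

text \<open>The product \<open>S\<^sup>a \<times> S\<^sup>b \<rightarrow> S\<^sup>a\<^sup>+\<^sup>b\<close>, the biadditive extension of
  \<open>(x\<^sub>1\<cdots>x\<^sub>a, y\<^sub>1\<cdots>y\<^sub>b) \<mapsto> x\<^sub>1\<cdots>x\<^sub>a y\<^sub>1\<cdots>y\<^sub>b\<close>.\<close>

definition sym_prod ::
    "nat \<Rightarrow> nat \<Rightarrow> ('a, 'm) monoid_scheme \<Rightarrow> ('a multiset \<Rightarrow>\<^sub>0 int) set \<Rightarrow> ('a multiset \<Rightarrow>\<^sub>0 int) set
      \<Rightarrow> ('a multiset \<Rightarrow>\<^sub>0 int) set" where
  "sym_prod a b G X Y =
     presented_lift (sym_power (a + b) G)
       (\<lambda>M. presented_lift (sym_power (a + b) G) (\<lambda>N. sym_elem (a + b) G (M + N)) Y) X"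

definition sym_mult ::
    "nat \<Rightarrow> nat \<Rightarrow> ('a, 'm) monoid_scheme
      \<Rightarrow> (('a multiset \<Rightarrow>\<^sub>0 int) set \<times> ('a multiset \<Rightarrow>\<^sub>0 int) set \<Rightarrow>\<^sub>0 int) set
      \<Rightarrow> ('a multiset \<Rightarrow>\<^sub>0 int) set" where
  "sym_mult a b G = presented_lift (sym_power (a + b) G) (\<lambda>(X, Y). sym_prod a b G X Y)"


section \<open>Functors on abelian groups and the Schur functor of shape (d-1,1)\<close>

text \<open>\<open>on_hom F G H f\<close> is the value of \<open>F\<close> on a homomorphism \<open>f\<close> from \<open>G\<close> to \<open>H\<close>.\<close>

record ('a, 'b) ab_functor =
  on_obj :: "'a monoid \<Rightarrow> 'b monoid"
  on_hom :: "'a monoid \<Rightarrow> 'a monoid \<Rightarrow> ('a \<Rightarrow> 'a) \<Rightarrow> 'b \<Rightarrow> 'b"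

definition schur_hook ::
    "nat \<Rightarrow> ('a, (('a multiset \<Rightarrow>\<^sub>0 int) set \<times> ('a multiset \<Rightarrow>\<^sub>0 int) set \<Rightarrow>\<^sub>0 int) set) ab_functor" where
  "schur_hook d =
     \<lparr>on_obj = (\<lambda>G.
        let T = tensor_group (sym_power (d - 1) G) (sym_power 1 G)
        in T\<lparr>carrier := kernel T (sym_power (d - 1 + 1) G) (sym_mult (d - 1) 1 G)\<rparr>),
      on_hom = (\<lambda>G H f.
        tensor_map (sym_power (d - 1) H) (sym_power 1 H)
          (sym_power_map (d - 1) H f) (sym_power_map 1 H f))\<rparr>"


section \<open>Simplicial abelian groups and their homology\<close>

text \<open>\<open>sop X m m' \<theta>\<close> is the homomorphism from \<open>sob X m\<close> to \<open>sob X m'\<close> induced by a weakly monotone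
  \<open>\<theta>\<close> from \<open>{..m'}\<close> to \<open>{..m}\<close>.\<close>

record 'a simplicial_group =
  sob :: "nat \<Rightarrow> 'a monoid"
  sop :: "nat \<Rightarrow> nat \<Rightarrow> (nat \<Rightarrow> nat) \<Rightarrow> 'a \<Rightarrow> 'a"

definition coface :: "nat \<Rightarrow> nat \<Rightarrow> nat" where
  "coface i j = (if j < i then j else Suc j)"

definition boundary :: "'a simplicial_group \<Rightarrow> nat \<Rightarrow> 'a \<Rightarrow> 'a" where
  "boundary X m x =
     finprod (sob X (m - 1))
       (\<lambda>i. sop X m (m - 1) (coface i) x [^]\<^bsub>sob X (m - 1)\<^esub> ((- 1) ^ i :: int)) {..m}"

definition cycles :: "'a simplicial_group \<Rightarrow> nat \<Rightarrow> 'a set" where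
  "cycles X q =
     (if q = 0 then carrier (sob X 0) else kernel (sob X q) (sob X (q - 1)) (boundary X q))"

definition homology :: "'a simplicial_group \<Rightarrow> nat \<Rightarrow> 'a set monoid" where
  "homology X q =
     (sob X q)\<lparr>carrier := cycles X q\<rparr> Mod (boundary X (Suc q) ` carrier (sob X (Suc q)))"


section \<open>The Dold--Kan construction\<close>

text \<open>\<open>cdiff C k\<close> is the differential from degree \<open>k\<close> to degree \<open>k - 1\<close>.\<close>

record 'a chain_cx =
  cob :: "nat \<Rightarrow> 'a monoid"
  cdiff :: "nat \<Rightarrow> 'a \<Rightarrow> 'a"

text \<open>The simplicial abelian group of a chain complex \<open>C\<close> has as \<open>m\<close>-simplices the direct sum of
  \<open>C\<^sub>k\<close> over all monotone surjections \<open>\<sigma>\<close> from \<open>{..m}\<close> onto \<open>{..k}\<close>. An operator \<open>\<theta>\<close> takes the summand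
  \<open>\<sigma>\<close> to the summand \<open>\<tau>\<close> of the epi-mono factorisation \<open>\<sigma> \<circ> \<theta> = \<delta> \<circ> \<tau>\<close>, by the map that is the identity
  for \<open>\<delta>\<close> the identity, the differential for \<open>\<delta>\<close> the \<open>0\<close>-th coface, and zero otherwise.\<close>

definition dk_index :: "nat \<Rightarrow> (nat \<times> (nat \<Rightarrow> nat)) set" where
  "dk_index m =
     {(k, \<sigma>). \<sigma> \<in> extensional {..m} \<and> mono_on {..m} \<sigma> \<and> \<sigma> ` {..m} = {..k}}"

definition dk_target ::
    "nat \<Rightarrow> (nat \<Rightarrow> nat) \<Rightarrow> nat \<times> (nat \<Rightarrow> nat) \<Rightarrow> nat \<times> (nat \<Rightarrow> nat) \<Rightarrow> (nat \<Rightarrow> nat) \<Rightarrow> bool" where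
  "dk_target m' \<theta> s t \<delta> \<longleftrightarrow>
     strict_mono_on {..fst t} \<delta> \<and> \<delta> ` {..fst t} \<subseteq> {..fst s} \<and>
     (\<forall>j\<le>m'. \<delta> (snd t j) = snd s (\<theta> j))"

definition dk_coeff ::
    "'a chain_cx \<Rightarrow> nat \<Rightarrow> (nat \<Rightarrow> nat) \<Rightarrow> nat \<times> (nat \<Rightarrow> nat) \<Rightarrow> nat \<times> (nat \<Rightarrow> nat) \<Rightarrow> 'a \<Rightarrow> 'a" where
  "dk_coeff C m' \<theta> s t x =
     (if \<exists>\<delta>. dk_target m' \<theta> s t \<delta> \<and> fst s = fst t then x
      else if \<exists>\<delta>. dk_target m' \<theta> s t \<delta> \<and> fst s = Suc (fst t) \<and> (\<forall>j\<le>fst t. \<delta> j = coface 0 j)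
        then cdiff C (fst s) x
      else \<one>\<^bsub>cob C (fst t)\<^esub>)"

definition dold_kan :: "'a chain_cx \<Rightarrow> (nat \<times> (nat \<Rightarrow> nat) \<Rightarrow> 'a) simplicial_group" where
  "dold_kan C =
     \<lparr>sob = (\<lambda>m. sum_group (dk_index m) (\<lambda>s. cob C (fst s))),
      sop = (\<lambda>m m' \<theta> f. \<lambda>t\<in>dk_index m'.
               finprod (cob C (fst t)) (\<lambda>s. dk_coeff C m' \<theta> s t (f s)) (dk_index m))\<rparr>"

definition int_concentrated :: "nat \<Rightarrow> int chain_cx" where
  "int_concentrated n =
     \<lparr>cob = (\<lambda>k. if k = n then integer_group else singleton_group 0), cdiff = (\<lambda>k x. 0)\<rparr>"

definition K :: "nat \<Rightarrow> (nat \<times> (nat \<Rightarrow> nat) \<Rightarrow> int) simplicial_group" where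
  "K n = dold_kan (int_concentrated n)"


section \<open>Dold--Puppe derived functors\<close>

definition simp_tensor ::
    "'a simplicial_group \<Rightarrow> 'v monoid \<Rightarrow> ('a \<times> 'v \<Rightarrow>\<^sub>0 int) set simplicial_group" where
  "simp_tensor X V =
     \<lparr>sob = (\<lambda>m. tensor_group (sob X m) V),
      sop = (\<lambda>m m' \<theta>. tensor_map (sob X m') V (sop X m m' \<theta>) (\<lambda>v. v))\<rparr>"

definition simp_apply :: "('a, 'b) ab_functor \<Rightarrow> 'a simplicial_group \<Rightarrow> 'b simplicial_group" where
  "simp_apply F X =
     \<lparr>sob = (\<lambda>m. on_obj F (sob X m)),
      sop = (\<lambda>m m' \<theta>. on_hom F (sob X m) (sob X m') (sop X m m' \<theta>))\<rparr>"

text \<open>\<open>derived_functor q F V n\<close> is \<open>L\<^sub>qF(V;n)\<close>.\<close>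

definition derived_functor ::
    "nat \<Rightarrow> (((nat \<times> (nat \<Rightarrow> nat) \<Rightarrow> int) \<times> 'v \<Rightarrow>\<^sub>0 int) set, 'b) ab_functor
      \<Rightarrow> 'v monoid \<Rightarrow> nat \<Rightarrow> 'b set monoid" where
  "derived_functor q F V n = homology (simp_apply F (simp_tensor (K n) V)) q"

end

theory Submission
  imports Defs "HOL-Library.Product_Plus"
begin

text \<open>Let \<open>X = K(n) \<otimes> \<int>\<close>, \<open>T = S\<^bsup>d-1\<^esup>(X) \<otimes> X\<close>, and let \<open>m : T \<rightarrow> S\<^sup>d(X)\<close> be the multiplication with kernel
  \<open>F\<close>. Polarisation \<open>D : S\<^sup>d(X) \<rightarrow> T\<close> satisfies \<open>m D = d\<close>, so \<open>d - D m\<close> maps \<open>T\<close> into \<open>F\<close> and is \<open>d\<close> on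
  \<open>F\<close>. On the other hand \<open>D m - 1\<close> is built from the interchange of two factors \<open>X\<close>, which is homotopic
  to \<open>(-1)\<^sup>n\<close> on \<open>K(n) \<otimes> K(n)\<close>; hence \<open>D m - 1\<close> is homotopic to \<open>(-1)\<^sup>n (d - 1)\<close> on \<open>T\<close>. As
  \<open>D m = 0\<close> on \<open>F\<close>, the homology of \<open>F\<close> is killed by \<open>d (d - 1 + (-1)\<^sup>n)\<close>, which is \<open>d\<^sup>2\<close> for \<open>n = 2\<close> and
  \<open>d (d - 2)\<close> for \<open>n = 3\<close>.

  For the interchange, an up-set \<open>U\<close> of the vertices of a simplex is read as a generator of \<open>K(1)\<close>. For
  functions \<open>f, g\<close> modulo constants, \<open>f(x) g(y) + g(x) f(y) \<equiv> - (f(x) - f(y)) (g(x) - g(y))\<close> modulo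
  functions of one variable; multiplying the right-hand side by the indicator of an up-set \<open>\<chi>\<close> in the
  variable \<open>x\<close> contracts it to \<open>0\<close>. This gives the homotopy \<open>swap_htpy\<close> between the interchange on
  \<open>K(1) \<otimes> K(1)\<close> and \<open>-1\<close>. Since \<open>K(n)\<close> is a retract of the \<open>n\<close>-th tensor power of \<open>K(1)\<close>, the case of
  \<open>K(n)\<close> follows by writing the exchange of two blocks of length \<open>n\<close> as \<open>n\<^sup>2\<close> adjacent transpositions.\<close>

section \<open>Groups given by generators and relations\<close>

text \<open>Since S^(d-1) tensor S^1 is not additive, a chain homotopy on K(n) tensor K(n) does not
  by itself induce one on T. A homotopy is therefore kept as a family of maps H(\<chi>), one for
  each up-set \<chi> of the vertices {..m}, natural when simplex and up-set are pulled back
  together. The up-sets are the m-simplices of the interval, the empty and the full one being its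
  two ends. Such a family passes to T as a biderivation, naturality only asks for compatibility with
  intersections and preimages, and the prism operator turns the family on T into chains. The maps
  H(\<chi>) take values in T, not visibly in F. Composing with the natural map d - D m from T to F
  brings the bounding chains into F; this is the origin of the extra factor d, harmless because p
  does not divide d. All computations take place in a polynomial ring with variables x for the
  factor S^(d-1) and y for the factor S^1, where T appears in bidegree (d-1, 1).\<close>

lemma group_homI:
  assumes "group G" "group H" "f \<in> hom G H"
  shows "group_hom G H f"
  using assms by (simp add: group_hom_def group_hom_axioms_def)

lemma hom_eq_on_generate:
  assumes G: "group G" and H: "group H" and f: "f \<in> hom G H" and g: "g \<in> hom G H"
    and S: "S \<subseteq> carrier G" "\<And>s. s \<in> S \<Longrightarrow> f s = g s" and x: "x \<in> generate G S"
  shows "f x = g x"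
proof -
  interpret f: group_hom G H f using assms by (intro group_homI)
  interpret g: group_hom G H g using assms by (intro group_homI)
  have *: "y \<in> carrier G" if "y \<in> generate G S" for y
    using that S f.G.generate_incl by auto
  show ?thesis
    using x
  proof (induction x rule: generate.induct)
    case (inv h)
    then show ?case using S by (metis f.hom_inv g.hom_inv subsetD)
  next
    case (eng a b)
    then show ?case using * by simp
  qed (use S in auto)
qed

context
  fixes S :: "'a set" and R :: "('a \<Rightarrow>\<^sub>0 int) set"
  assumes R: "R \<subseteq> carrier (free_Abelian_group S)"
begin

lemma normal_presented_rels:
  "generate (free_Abelian_group S) R \<lhd> free_Abelian_group S"
proof -
  interpret F: comm_group "free_Abelian_group S" by (rule abelian_free_Abelian_group)
  show ?thesis using R by (intro F.subgroup_imp_normal F.generate_is_subgroup)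
qed

lemma comm_group_presented_group: "comm_group (presented_group S R)"
proof -
  interpret F: comm_group "free_Abelian_group S" by (rule abelian_free_Abelian_group)
  show ?thesis
    unfolding presented_group_def
    using normal_presented_rels by (intro F.abelian_FactGroup normal_imp_subgroup)
qed

lemma presented_coset_hom:
  "(\<lambda>c. generate (free_Abelian_group S) R #>\<^bsub>free_Abelian_group S\<^esub> c)
     \<in> hom (free_Abelian_group S) (presented_group S R)"
  unfolding presented_group_def by (rule normal.r_coset_hom_Mod[OF normal_presented_rels])

lemma presented_gen_closed: "s \<in> S \<Longrightarrow> presented_gen S R s \<in> carrier (presented_group S R)"
  using hom_in_carrier[OF presented_coset_hom] by (simp add: presented_gen_def)

lemma presented_hom_eqI:
  assumes H: "group H" and f: "f \<in> hom (presented_group S R) H" and g: "g \<in> hom (presented_group S R) H"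
    and eq: "\<And>s. s \<in> S \<Longrightarrow> f (presented_gen S R s) = g (presented_gen S R s)"
    and x: "x \<in> carrier (presented_group S R)"
  shows "f x = g x"
proof -
  let ?F = "free_Abelian_group S"
  let ?q = "\<lambda>c. generate ?F R #>\<^bsub>?F\<^esub> c"
  interpret F: comm_group ?F by (rule abelian_free_Abelian_group)
  interpret P: comm_group "presented_group S R" by (rule comm_group_presented_group)
  interpret f: group_hom ?F H "f \<circ> ?q"
    using hom_compose[OF presented_coset_hom f] H by (intro group_homI) auto
  interpret g: group_hom ?F H "g \<circ> ?q"
    using hom_compose[OF presented_coset_hom g] H by (intro group_homI) auto
  obtain c where c: "c \<in> carrier ?F" "x = ?q c"
    using x unfolding presented_group_def carrier_FactGroup by auto
  have "(f \<circ> ?q) c = (g \<circ> ?q) c"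
    using c(1) unfolding carrier_free_Abelian_group_iff
  proof (rule free_Abelian_group_induct)
    show "(f \<circ> ?q) 0 = (g \<circ> ?q) 0" using f.hom_one g.hom_one by simp
  next
    fix u v assume 2: "Poly_Mapping.keys u \<subseteq> S" "Poly_Mapping.keys v \<subseteq> S"
      "(f \<circ> ?q) u = (g \<circ> ?q) u" "(f \<circ> ?q) v = (g \<circ> ?q) v"
    then have k: "u \<in> carrier ?F" "v \<in> carrier ?F" by auto
    have "u - v = u \<otimes>\<^bsub>?F\<^esub> inv\<^bsub>?F\<^esub> v" using 2 by simp
    then show "(f \<circ> ?q) (u - v) = (g \<circ> ?q) (u - v)"
      using 2 k f.hom_mult[of u "inv\<^bsub>?F\<^esub> v"] g.hom_mult[of u "inv\<^bsub>?F\<^esub> v"] f.hom_inv[of v] g.hom_inv[of v]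
      by (metis F.inv_closed)
  next
    fix a assume "a \<in> S"
    then show "(f \<circ> ?q) (frag_of a) = (g \<circ> ?q) (frag_of a)" using eq[of a] by (simp add: presented_gen_def)
  qed
  then show ?thesis using c by simp
qed

lemma presented_rel_additive:
  assumes r: "frag_of a - frag_of b - frag_of c \<in> R"
    and "a \<in> S" "b \<in> S" "c \<in> S"
  shows "presented_gen S R a = presented_gen S R b \<otimes>\<^bsub>presented_group S R\<^esub> presented_gen S R c"
proof -
  let ?F = "free_Abelian_group S"
  let ?q = "\<lambda>c. generate ?F R #>\<^bsub>?F\<^esub> c"
  interpret F: comm_group ?F by (rule abelian_free_Abelian_group)
  interpret P: comm_group "presented_group S R" by (rule comm_group_presented_group)
  interpret N: normal "generate ?F R" ?F by (rule normal_presented_rels)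
  interpret q: group_hom ?F "presented_group S R" ?q
    using presented_coset_hom by (intro group_homI) auto
  let ?r = "frag_of a - frag_of b - frag_of c"
  have "?r \<in> generate ?F R" using r by (rule generate.incl)
  then have "?q ?r = generate ?F R"
    by (rule N.rcos_const[rotated]) auto
  then have 1: "?q ?r = \<one>\<^bsub>presented_group S R\<^esub>" by (simp add: presented_group_def FactGroup_def)
  have car: "?r \<in> carrier ?F" "frag_of b \<in> carrier ?F" "frag_of c \<in> carrier ?F"
    using subsetD[OF R r] assms by auto
  have "frag_of a = ?r \<otimes>\<^bsub>?F\<^esub> (frag_of b \<otimes>\<^bsub>?F\<^esub> frag_of c)" by simp
  then have "?q (frag_of a) = ?q ?r \<otimes>\<^bsub>presented_group S R\<^esub> (?q (frag_of b) \<otimes>\<^bsub>presented_group S R\<^esub> ?q (frag_of c))"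
    using car by (metis q.hom_mult F.m_closed)
  then show ?thesis using 1 car q.hom_closed unfolding presented_gen_def
    by (metis P.l_one P.m_closed)
qed

end

lemma generate_presented_gen:
  assumes R: "R \<subseteq> carrier (free_Abelian_group S)"
  shows "generate (presented_group S R) (presented_gen S R ` S) = carrier (presented_group S R)"
proof
  let ?F = "free_Abelian_group S" and ?P = "presented_group S R"
  let ?q = "\<lambda>c. generate ?F R #>\<^bsub>?F\<^esub> c"
  let ?B = "generate ?P (presented_gen S R ` S)"
  interpret P: comm_group ?P by (rule comm_group_presented_group[OF R])
  interpret q: group_hom ?F ?P ?q using presented_coset_hom[OF R] by (intro group_homI) auto
  have sub: "presented_gen S R ` S \<subseteq> carrier ?P" using presented_gen_closed[OF R] by auto
  show "?B \<subseteq> carrier ?P" using sub by (rule P.generate_incl)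
  interpret B: subgroup ?B ?P using sub by (rule P.generate_is_subgroup)
  have "?q c \<in> ?B" if "Poly_Mapping.keys c \<subseteq> S" for c
    using that
  proof (rule free_Abelian_group_induct)
    show "?q 0 \<in> ?B" using q.hom_one by simp
  next
    fix u v assume uv: "Poly_Mapping.keys u \<subseteq> S" "Poly_Mapping.keys v \<subseteq> S" "?q u \<in> ?B" "?q v \<in> ?B"
    then have "?q (u - v) = ?q u \<otimes>\<^bsub>?P\<^esub> inv\<^bsub>?P\<^esub> ?q v"
      using q.hom_mult[of u "inv\<^bsub>?F\<^esub> v"] q.hom_inv[of v] by simp
    then show "?q (u - v) \<in> ?B" using uv B.m_inv_closed by simp
  next
    fix a assume "a \<in> S"
    then show "?q (frag_of a) \<in> ?B" by (auto simp: presented_gen_def[symmetric] intro: generate.incl)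
  qed
  then show "carrier ?P \<subseteq> ?B" by (auto simp: presented_group_def carrier_FactGroup)
qed

text \<open>The relations of tensor products and of symmetric powers all have the shape a - b - c,
  so one computation serves both universal properties.\<close>

lemma free_ext_additive_rel:
  assumes H: "comm_group H" and "\<phi> \<in> S \<rightarrow> carrier H" "a \<in> S" "b \<in> S" "c \<in> S"
    and "\<phi> a = \<phi> b \<otimes>\<^bsub>H\<^esub> \<phi> c"
  shows "free_ext H \<phi> (frag_of a - frag_of b - frag_of c) = \<one>\<^bsub>H\<^esub>"
proof -
  interpret H: comm_group H by fact
  let ?F = "free_Abelian_group S"
  interpret F: comm_group ?F by (rule abelian_free_Abelian_group)
  interpret f: group_hom ?F H "free_ext H \<phi>"
    using free_ext_hom[OF H] assms by (intro group_homI) auto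
  let ?r = "frag_of a - frag_of b - frag_of c"
  have car: "frag_of a \<in> carrier ?F" "frag_of b \<in> carrier ?F" "frag_of c \<in> carrier ?F" using assms by auto
  moreover have "?r = frag_of a \<otimes>\<^bsub>?F\<^esub> inv\<^bsub>?F\<^esub> (frag_of b \<otimes>\<^bsub>?F\<^esub> frag_of c)"
    using assms keys_add[of "frag_of b" "frag_of c"] by (subst inv_free_Abelian_group) auto
  ultimately have "free_ext H \<phi> ?r = free_ext H \<phi> (frag_of a) \<otimes>\<^bsub>H\<^esub> inv\<^bsub>H\<^esub> (free_ext H \<phi> (frag_of b) \<otimes>\<^bsub>H\<^esub> free_ext H \<phi> (frag_of c))"
    by (metis f.hom_mult f.hom_inv F.m_closed F.inv_closed)
  also have "\<dots> = \<one>\<^bsub>H\<^esub>"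
    using assms by (simp add: free_ext_frag_of[OF H] Pi_iff)
  finally show ?thesis .
qed


section \<open>Tensor products and symmetric powers\<close>

lemma tensor_rels_carrier:
  assumes "group G" "group H"
  shows "tensor_rels G H \<subseteq> carrier (free_Abelian_group (carrier G \<times> carrier H))"
proof -
  interpret G: group G by fact
  interpret H: group H by fact
  have *: "Poly_Mapping.keys (frag_of a - frag_of b - frag_of c) \<subseteq> {a, b, c}" for a b c :: "'a \<times> 'c"
    using keys_diff[of "frag_of a - frag_of b" "frag_of c"] keys_diff[of "frag_of a" "frag_of b"] by auto
  show ?thesis
    unfolding tensor_rels_def by (auto dest!: subsetD[OF *])
qed

context
  fixes G :: "('a, 'm) monoid_scheme" and H :: "('b, 'n) monoid_scheme"
  assumes G: "group G" and H: "group H"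
begin

lemma comm_group_tensor_group: "comm_group (tensor_group G H)"
  unfolding tensor_group_def by (rule comm_group_presented_group[OF tensor_rels_carrier[OF G H]])

lemma tensor_elem_closed:
  "x \<in> carrier G \<Longrightarrow> y \<in> carrier H \<Longrightarrow> tensor_elem G H x y \<in> carrier (tensor_group G H)"
  unfolding tensor_group_def tensor_elem_def
  by (rule presented_gen_closed[OF tensor_rels_carrier[OF G H]]) auto

lemma tensor_elem_mult_left:
  assumes "x \<in> carrier G" "x' \<in> carrier G" "y \<in> carrier H"
  shows "tensor_elem G H (x \<otimes>\<^bsub>G\<^esub> x') y = tensor_elem G H x y \<otimes>\<^bsub>tensor_group G H\<^esub> tensor_elem G H x' y"
proof -
  interpret G: group G by (rule G)
  show ?thesis
    unfolding tensor_group_def tensor_elem_def using assms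
    by (intro presented_rel_additive[OF tensor_rels_carrier[OF G H]]) (auto simp: tensor_rels_def)
qed

lemma tensor_elem_mult_right:
  assumes "x \<in> carrier G" "y \<in> carrier H" "y' \<in> carrier H"
  shows "tensor_elem G H x (y \<otimes>\<^bsub>H\<^esub> y') = tensor_elem G H x y \<otimes>\<^bsub>tensor_group G H\<^esub> tensor_elem G H x y'"
proof -
  interpret H: group H by (rule H)
  show ?thesis
    unfolding tensor_group_def tensor_elem_def using assms
    by (intro presented_rel_additive[OF tensor_rels_carrier[OF G H]]) (auto simp: tensor_rels_def)
qed

lemma tensor_elem_left_hom:
  "y \<in> carrier H \<Longrightarrow> (\<lambda>x. tensor_elem G H x y) \<in> hom G (tensor_group G H)"
  by (intro homI tensor_elem_closed tensor_elem_mult_left)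

lemma tensor_elem_right_hom:
  "x \<in> carrier G \<Longrightarrow> tensor_elem G H x \<in> hom H (tensor_group G H)"
  by (intro homI tensor_elem_closed tensor_elem_mult_right)

lemma tensor_hom_eqI:
  assumes "group L" "f \<in> hom (tensor_group G H) L" "g \<in> hom (tensor_group G H) L"
    and "\<And>x y. x \<in> carrier G \<Longrightarrow> y \<in> carrier H \<Longrightarrow> f (tensor_elem G H x y) = g (tensor_elem G H x y)"
    and "t \<in> carrier (tensor_group G H)"
  shows "f t = g t"
  using assms(4)
  by (intro presented_hom_eqI[OF tensor_rels_carrier[OF G H] assms(1) assms(2,3)[unfolded tensor_group_def] _ assms(5)[unfolded tensor_group_def]])
    (auto simp: tensor_elem_def)

context
  fixes L :: "('c, 'k) monoid_scheme" and \<phi> :: "'a \<Rightarrow> 'b \<Rightarrow> 'c"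
  assumes L: "comm_group L"
    and left: "\<And>y. y \<in> carrier H \<Longrightarrow> (\<lambda>x. \<phi> x y) \<in> hom G L"
    and right: "\<And>x. x \<in> carrier G \<Longrightarrow> \<phi> x \<in> hom H L"
begin

text \<open>A map that is a homomorphism in each variable kills both families in
  \<open>tensor_rels\<close>, which is what \<open>presented_lift\<close> needs. The two lemmas that
  follow are the universal property of the tensor product.\<close>

lemma tensor_lift_facts:
  "(\<lambda>(x, y). \<phi> x y) \<in> carrier G \<times> carrier H \<rightarrow> carrier L"
  "\<And>r. r \<in> tensor_rels G H \<Longrightarrow> free_ext L (\<lambda>(x, y). \<phi> x y) r = \<one>\<^bsub>L\<^esub>"
proof -
  interpret G: group G by (rule G)
  interpret H: group H by (rule H)
  show *: "(\<lambda>(x, y). \<phi> x y) \<in> carrier G \<times> carrier H \<rightarrow> carrier L"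
    using hom_in_carrier[OF right] by auto
  show "free_ext L (\<lambda>(x, y). \<phi> x y) r = \<one>\<^bsub>L\<^esub>" if "r \<in> tensor_rels G H" for r
    using that unfolding tensor_rels_def
  proof (elim UnE CollectE exE conjE)
    fix x x' y
    assume "r = frag_of (x \<otimes>\<^bsub>G\<^esub> x', y) - frag_of (x, y) - frag_of (x', y)"
      "x \<in> carrier G" "x' \<in> carrier G" "y \<in> carrier H"
    then show ?thesis
      using hom_mult[OF left, of y x x'] by (simp add: free_ext_additive_rel[OF L *])
  next
    fix x y y'
    assume "r = frag_of (x, y \<otimes>\<^bsub>H\<^esub> y') - frag_of (x, y) - frag_of (x, y')"
      "x \<in> carrier G" "y \<in> carrier H" "y' \<in> carrier H"
    then show ?thesis
      using hom_mult[OF right, of x y y'] by (simp add: free_ext_additive_rel[OF L *])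
  qed
qed

lemma tensor_lift_hom: "presented_lift L (\<lambda>(x, y). \<phi> x y) \<in> hom (tensor_group G H) L"
  unfolding tensor_group_def
  by (rule presented_lift_hom[OF L tensor_lift_facts(1) tensor_rels_carrier[OF G H] tensor_lift_facts(2)])

lemma tensor_lift_elem:
  assumes "x \<in> carrier G" "y \<in> carrier H"
  shows "presented_lift L (\<lambda>(x, y). \<phi> x y) (tensor_elem G H x y) = \<phi> x y"
  unfolding tensor_elem_def
  using presented_lift_gen[OF L tensor_lift_facts(1) tensor_rels_carrier[OF G H] tensor_lift_facts(2), of "(x, y)"] assms
  by simp

end

end

context
  fixes G :: "('a, 'm) monoid_scheme" and H :: "('b, 'n) monoid_scheme"
    and G' :: "('c, 'k) monoid_scheme" and H' :: "('d, 'l) monoid_scheme" and f g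
  assumes G: "group G" and H: "group H" and G': "group G'" and H': "group H'"
    and f: "f \<in> hom G G'" and g: "g \<in> hom H H'"
begin

lemma tensor_map_bihom:
  "y \<in> carrier H \<Longrightarrow> (\<lambda>x. tensor_elem G' H' (f x) (g y)) \<in> hom G (tensor_group G' H')"
  "x \<in> carrier G \<Longrightarrow> (\<lambda>y. tensor_elem G' H' (f x) (g y)) \<in> hom H (tensor_group G' H')"
  using hom_compose[OF f tensor_elem_left_hom[OF G' H']] hom_compose[OF g tensor_elem_right_hom[OF G' H']]
    hom_in_carrier[OF f] hom_in_carrier[OF g] by (auto simp: o_def)

lemma tensor_map_hom: "tensor_map G' H' f g \<in> hom (tensor_group G H) (tensor_group G' H')"
  unfolding tensor_map_def
  by (rule tensor_lift_hom[OF G H comm_group_tensor_group[OF G' H'] tensor_map_bihom])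

lemma tensor_map_elem:
  "x \<in> carrier G \<Longrightarrow> y \<in> carrier H \<Longrightarrow>
    tensor_map G' H' f g (tensor_elem G H x y) = tensor_elem G' H' (f x) (g y)"
  unfolding tensor_map_def
  by (rule tensor_lift_elem[OF G H comm_group_tensor_group[OF G' H'] tensor_map_bihom])

end

section \<open>Symmetric powers: generators, universal property, functoriality\<close>

lemma sym_rels_carrier:
  assumes "group G"
  shows "sym_rels d G \<subseteq> carrier (free_Abelian_group (sym_gens d G))"
proof -
  interpret G: group G by fact
  have *: "Poly_Mapping.keys (frag_of a - frag_of b - frag_of c) \<subseteq> {a, b, c}" for a b c :: "'a multiset"
    using keys_diff[of "frag_of a - frag_of b" "frag_of c"] keys_diff[of "frag_of a" "frag_of b"] by auto
  show ?thesis
    unfolding sym_rels_def sym_gens_def by (auto dest!: subsetD[OF *] simp: subset_iff)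
qed

context
  fixes G :: "('a, 'm) monoid_scheme" and d :: nat
  assumes G: "group G"
begin

lemma comm_group_sym_power: "comm_group (sym_power d G)"
  unfolding sym_power_def by (rule comm_group_presented_group[OF sym_rels_carrier[OF G]])

lemma group_sym_power: "group (sym_power d G)"
  using comm_group_sym_power by (rule comm_group.axioms(2))

lemma sym_elem_closed:
  "size M = d \<Longrightarrow> set_mset M \<subseteq> carrier G \<Longrightarrow> sym_elem d G M \<in> carrier (sym_power d G)"
  unfolding sym_power_def sym_elem_def
  by (rule presented_gen_closed[OF sym_rels_carrier[OF G]]) (auto simp: sym_gens_def)

lemma sym_elem_mult:
  assumes "x \<in> carrier G" "y \<in> carrier G" "set_mset M \<subseteq> carrier G" "Suc (size M) = d"
  shows "sym_elem d G (add_mset (x \<otimes>\<^bsub>G\<^esub> y) M) =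
    sym_elem d G (add_mset x M) \<otimes>\<^bsub>sym_power d G\<^esub> sym_elem d G (add_mset y M)"
proof -
  interpret G: group G by (rule G)
  show ?thesis
    unfolding sym_power_def sym_elem_def using assms
    by (intro presented_rel_additive[OF sym_rels_carrier[OF G]]) (auto simp: sym_rels_def sym_gens_def)
qed

lemma sym_elem_hom:
  assumes "set_mset M \<subseteq> carrier G" "Suc (size M) = d"
  shows "(\<lambda>x. sym_elem d G (add_mset x M)) \<in> hom G (sym_power d G)"
  using assms by (intro homI sym_elem_closed sym_elem_mult) auto

lemma sym_hom_eqI:
  assumes "group L" "f \<in> hom (sym_power d G) L" "g \<in> hom (sym_power d G) L"
    and "\<And>M. size M = d \<Longrightarrow> set_mset M \<subseteq> carrier G \<Longrightarrow> f (sym_elem d G M) = g (sym_elem d G M)"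
    and "t \<in> carrier (sym_power d G)"
  shows "f t = g t"
  using assms(4)
  by (intro presented_hom_eqI[OF sym_rels_carrier[OF G] assms(1) assms(2,3)[unfolded sym_power_def] _ assms(5)[unfolded sym_power_def]])
    (auto simp: sym_elem_def sym_gens_def)

text \<open>Additivity in each factor allows the entries of a product to be traded for elements of a
  generating set one at a time.\<close>

lemma sym_hom_eq_on_basis:
  assumes L: "group L" and f: "f \<in> hom (sym_power d G) L" and g: "g \<in> hom (sym_power d G) L"
    and B: "B \<subseteq> carrier G" "generate G B = carrier G"
    and eq: "\<And>M. size M = d \<Longrightarrow> set_mset M \<subseteq> B \<Longrightarrow> f (sym_elem d G M) = g (sym_elem d G M)"
    and t: "t \<in> carrier (sym_power d G)"
  shows "f t = g t"
proof (rule sym_hom_eqI[OF L f g _ t])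
  \<comment> \<open>N collects the entries already known to lie in B, M the remaining ones; each
    step of the induction moves one entry across.\<close>
  have "f (sym_elem d G (M + N)) = g (sym_elem d G (M + N))"
    if "size (M + N) = d" "set_mset M \<subseteq> carrier G" "set_mset N \<subseteq> B" for M N
    using that
  proof (induction M arbitrary: N)
    case empty
    then show ?case using eq by simp
  next
    case (add x M)
    have MN: "set_mset (M + N) \<subseteq> carrier G" "Suc (size (M + N)) = d" using add.prems B by auto
    show ?case
    proof (rule hom_eq_on_generate[OF G L, where S = B and x = x, simplified])
      have "(\<lambda>x. sym_elem d G (add_mset x (M + N))) \<in> hom G (sym_power d G)"
        by (rule sym_elem_hom[OF MN])
      from hom_compose[OF this f] hom_compose[OF this g]
      show "(\<lambda>x. f (sym_elem d G (add_mset x M + N))) \<in> hom G L"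
        "(\<lambda>x. g (sym_elem d G (add_mset x M + N))) \<in> hom G L"
        by (simp_all add: o_def)
      show "B \<subseteq> carrier G" by fact
      show "f (sym_elem d G (add_mset s M + N)) = g (sym_elem d G (add_mset s M + N))" if "s \<in> B" for s
        using add.IH[of "add_mset s N"] add.prems that by simp
      show "x \<in> generate G B" using add.prems B by auto
    qed
  qed
  from this[of _ "{#}"] show "f (sym_elem d G M) = g (sym_elem d G M)"
    if "size M = d" "set_mset M \<subseteq> carrier G" for M using that by simp
qed

context
  fixes L :: "('c, 'k) monoid_scheme" and \<phi> :: "'a multiset \<Rightarrow> 'c"
  assumes L: "comm_group L"
    and add: "\<And>M. set_mset M \<subseteq> carrier G \<Longrightarrow> Suc (size M) = d \<Longrightarrow> (\<lambda>x. \<phi> (add_mset x M)) \<in> hom G L"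
    and closed: "\<And>M. set_mset M \<subseteq> carrier G \<Longrightarrow> size M = d \<Longrightarrow> \<phi> M \<in> carrier L"
begin

lemma sym_lift_facts:
  "\<phi> \<in> sym_gens d G \<rightarrow> carrier L"
  "\<And>r. r \<in> sym_rels d G \<Longrightarrow> free_ext L \<phi> r = \<one>\<^bsub>L\<^esub>"
proof -
  interpret G: group G by (rule G)
  show *: "\<phi> \<in> sym_gens d G \<rightarrow> carrier L"
    using closed by (auto simp: sym_gens_def)
  show "free_ext L \<phi> r = \<one>\<^bsub>L\<^esub>" if "r \<in> sym_rels d G" for r
    using that unfolding sym_rels_def
  proof (elim CollectE exE conjE)
    fix x y M
    assume "r = frag_of (add_mset (x \<otimes>\<^bsub>G\<^esub> y) M) - frag_of (add_mset x M) - frag_of (add_mset y M)"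
      "x \<in> carrier G" "y \<in> carrier G" "set_mset M \<subseteq> carrier G" "Suc (size M) = d"
    then show ?thesis
      using hom_mult[OF add, of M x y] by (simp add: free_ext_additive_rel[OF L *] sym_gens_def)
  qed
qed

lemma sym_lift_hom: "presented_lift L \<phi> \<in> hom (sym_power d G) L"
  unfolding sym_power_def
  by (rule presented_lift_hom[OF L sym_lift_facts(1) sym_rels_carrier[OF G] sym_lift_facts(2)])

lemma sym_lift_elem:
  assumes "set_mset M \<subseteq> carrier G" "size M = d"
  shows "presented_lift L \<phi> (sym_elem d G M) = \<phi> M"
  unfolding sym_elem_def
  using presented_lift_gen[OF L sym_lift_facts(1) sym_rels_carrier[OF G] sym_lift_facts(2), of M] assms
  by (simp add: sym_gens_def)

end

end

context
  fixes G :: "('a, 'm) monoid_scheme" and G' :: "('b, 'n) monoid_scheme" and f and d :: nat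
  assumes G: "group G" and G': "group G'" and f: "f \<in> hom G G'"
begin

lemma sym_power_map_facts:
  "set_mset M \<subseteq> carrier G \<Longrightarrow> Suc (size M) = d \<Longrightarrow>
    (\<lambda>x. sym_elem d G' (image_mset f (add_mset x M))) \<in> hom G (sym_power d G')"
  "set_mset M \<subseteq> carrier G \<Longrightarrow> size M = d \<Longrightarrow> sym_elem d G' (image_mset f M) \<in> carrier (sym_power d G')"
  using hom_compose[OF f sym_elem_hom[OF G', of "image_mset f M" d]] hom_in_carrier[OF f]
  by (auto simp: o_def image_subset_iff subset_iff intro!: sym_elem_closed[OF G'])

lemma sym_power_map_hom: "sym_power_map d G' f \<in> hom (sym_power d G) (sym_power d G')"
  unfolding sym_power_map_def
  by (rule sym_lift_hom[OF G comm_group_sym_power[OF G'] sym_power_map_facts])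

lemma sym_power_map_elem:
  "set_mset M \<subseteq> carrier G \<Longrightarrow> size M = d \<Longrightarrow>
    sym_power_map d G' f (sym_elem d G M) = sym_elem d G' (image_mset f M)"
  unfolding sym_power_map_def
  by (rule sym_lift_elem[OF G comm_group_sym_power[OF G'] sym_power_map_facts])

end

section \<open>The multiplication of symmetric powers\<close>

context
  fixes G :: "('a, 'm) monoid_scheme" and a b :: nat
  assumes G: "group G"
begin

lemma sym_prod_inner_facts:
  assumes "set_mset M \<subseteq> carrier G" "size M = a"
  shows "set_mset N \<subseteq> carrier G \<Longrightarrow> Suc (size N) = b \<Longrightarrow>
      (\<lambda>x. sym_elem (a + b) G (M + add_mset x N)) \<in> hom G (sym_power (a + b) G)"
    and "set_mset N \<subseteq> carrier G \<Longrightarrow> size N = b \<Longrightarrow>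
      sym_elem (a + b) G (M + N) \<in> carrier (sym_power (a + b) G)"
  using assms sym_elem_hom[OF G, of "M + N" "a + b"] by (auto intro!: sym_elem_closed[OF G])

lemma sym_prod_inner_hom:
  assumes "set_mset M \<subseteq> carrier G" "size M = a"
  shows "presented_lift (sym_power (a + b) G) (\<lambda>N. sym_elem (a + b) G (M + N))
    \<in> hom (sym_power b G) (sym_power (a + b) G)"
  by (rule sym_lift_hom[OF G comm_group_sym_power[OF G] sym_prod_inner_facts[OF assms]])

lemma sym_prod_inner_elem:
  assumes "set_mset M \<subseteq> carrier G" "size M = a" "set_mset N \<subseteq> carrier G" "size N = b"
  shows "presented_lift (sym_power (a + b) G) (\<lambda>N. sym_elem (a + b) G (M + N)) (sym_elem b G N)
    = sym_elem (a + b) G (M + N)"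
  by (rule sym_lift_elem[OF G comm_group_sym_power[OF G] sym_prod_inner_facts[OF assms(1,2)] assms(3,4)])

lemma sym_prod_outer_facts:
  assumes Y: "Y \<in> carrier (sym_power b G)"
  defines "\<psi> \<equiv> \<lambda>M. presented_lift (sym_power (a + b) G) (\<lambda>N. sym_elem (a + b) G (M + N)) Y"
  shows "set_mset M \<subseteq> carrier G \<Longrightarrow> Suc (size M) = a \<Longrightarrow> (\<lambda>x. \<psi> (add_mset x M)) \<in> hom G (sym_power (a + b) G)"
    and "set_mset M \<subseteq> carrier G \<Longrightarrow> size M = a \<Longrightarrow> \<psi> M \<in> carrier (sym_power (a + b) G)"
proof -
  let ?S = "sym_power (a + b) G"
  let ?l = "\<lambda>M. presented_lift ?S (\<lambda>N. sym_elem (a + b) G (M + N))"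
  interpret G: group G by (rule G)
  interpret S: comm_group ?S by (rule comm_group_sym_power[OF G])
  show closed: "\<psi> M \<in> carrier ?S" if "set_mset M \<subseteq> carrier G" "size M = a" for M
    unfolding \<psi>_def by (rule hom_in_carrier[OF sym_prod_inner_hom[OF that] Y])
  show "(\<lambda>x. \<psi> (add_mset x M)) \<in> hom G ?S" if M: "set_mset M \<subseteq> carrier G" "Suc (size M) = a"
  proof (rule homI)
    fix x assume "x \<in> carrier G" then show "\<psi> (add_mset x M) \<in> carrier ?S"
      using M by (intro closed) auto
  next
    fix x y assume xy: "x \<in> carrier G" "y \<in> carrier G"
    have h: "?l (add_mset z M) \<in> hom (sym_power b G) ?S" if "z \<in> carrier G" for z
      using M that by (intro sym_prod_inner_hom) auto
    \<comment> \<open>Additivity in x is an identity between homomorphisms in Y, so it is enough to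
      test it on products Y, where it is a defining relation.\<close>
    have "?l (add_mset (x \<otimes>\<^bsub>G\<^esub> y) M) Y = (\<lambda>Y. ?l (add_mset x M) Y \<otimes>\<^bsub>?S\<^esub> ?l (add_mset y M) Y) Y"
    proof (rule sym_hom_eqI[OF G S.is_group _ _ _ Y])
      show "?l (add_mset (x \<otimes>\<^bsub>G\<^esub> y) M) \<in> hom (sym_power b G) ?S" using xy by (intro h) auto
      show "(\<lambda>Y. ?l (add_mset x M) Y \<otimes>\<^bsub>?S\<^esub> ?l (add_mset y M) Y) \<in> hom (sym_power b G) ?S"
        using xy by (intro comm_group.hom_group_mult[OF comm_group_sym_power[OF G]] h)
      fix N assume N: "size N = b" "set_mset N \<subseteq> carrier G"
      have e: "?l (add_mset z M) (sym_elem b G N) = sym_elem (a + b) G (add_mset z (M + N))" if "z \<in> carrier G" for z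
        using sym_prod_inner_elem[of "add_mset z M" N] M N that by simp
      show "?l (add_mset (x \<otimes>\<^bsub>G\<^esub> y) M) (sym_elem b G N)
          = ?l (add_mset x M) (sym_elem b G N) \<otimes>\<^bsub>?S\<^esub> ?l (add_mset y M) (sym_elem b G N)"
        unfolding e[OF xy(1)] e[OF xy(2)] e[OF G.m_closed[OF xy]]
        using xy M N by (intro sym_elem_mult[OF G]) auto
    qed
    then show "\<psi> (add_mset (x \<otimes>\<^bsub>G\<^esub> y) M) = \<psi> (add_mset x M) \<otimes>\<^bsub>?S\<^esub> \<psi> (add_mset y M)"
      by (simp add: \<psi>_def)
  qed
qed

lemma sym_prod_left_hom:
  "Y \<in> carrier (sym_power b G) \<Longrightarrow> (\<lambda>X. sym_prod a b G X Y) \<in> hom (sym_power a G) (sym_power (a + b) G)"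
  unfolding sym_prod_def by (rule sym_lift_hom[OF G comm_group_sym_power[OF G] sym_prod_outer_facts])

lemma sym_prod_elem_left:
  assumes "set_mset M \<subseteq> carrier G" "size M = a" "Y \<in> carrier (sym_power b G)"
  shows "sym_prod a b G (sym_elem a G M) Y = presented_lift (sym_power (a + b) G) (\<lambda>N. sym_elem (a + b) G (M + N)) Y"
  unfolding sym_prod_def
  by (rule sym_lift_elem[OF G comm_group_sym_power[OF G] sym_prod_outer_facts[OF assms(3)] assms(1,2)])

text \<open>\<open>sym_prod\<close> lifts in X on the outside and in Y on the inside. Additivity in
  Y is tested on products X, where the outer lift disappears and the inner one is a
  homomorphism.\<close>

lemma sym_prod_right_hom:
  assumes X: "X \<in> carrier (sym_power a G)"
  shows "sym_prod a b G X \<in> hom (sym_power b G) (sym_power (a + b) G)"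
proof (rule homI)
  let ?S = "sym_power (a + b) G"
  interpret S: comm_group ?S by (rule comm_group_sym_power[OF G])
  interpret B: comm_group "sym_power b G" by (rule comm_group_sym_power[OF G])
  show cl: "sym_prod a b G X Y \<in> carrier ?S" if "Y \<in> carrier (sym_power b G)" for Y
    using hom_in_carrier[OF sym_prod_left_hom[OF that] X] .
  fix Y Y' assume Y: "Y \<in> carrier (sym_power b G)" "Y' \<in> carrier (sym_power b G)"
  let ?p = "\<lambda>X. sym_prod a b G X Y" and ?p' = "\<lambda>X. sym_prod a b G X Y'"
  have "(\<lambda>X. sym_prod a b G X (Y \<otimes>\<^bsub>sym_power b G\<^esub> Y')) X = (\<lambda>X. ?p X \<otimes>\<^bsub>?S\<^esub> ?p' X) X"
  proof (rule sym_hom_eqI[OF G S.is_group _ _ _ X])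
    show "(\<lambda>X. sym_prod a b G X (Y \<otimes>\<^bsub>sym_power b G\<^esub> Y')) \<in> hom (sym_power a G) ?S"
      using Y by (intro sym_prod_left_hom) auto
    show "(\<lambda>X. ?p X \<otimes>\<^bsub>?S\<^esub> ?p' X) \<in> hom (sym_power a G) ?S"
      using Y by (intro comm_group.hom_group_mult[OF comm_group_sym_power[OF G]] sym_prod_left_hom)
    fix M assume M: "size M = a" "set_mset M \<subseteq> carrier G"
    show "sym_prod a b G (sym_elem a G M) (Y \<otimes>\<^bsub>sym_power b G\<^esub> Y')
        = sym_prod a b G (sym_elem a G M) Y \<otimes>\<^bsub>?S\<^esub> sym_prod a b G (sym_elem a G M) Y'"
      unfolding sym_prod_elem_left[OF M(2,1) Y(1)] sym_prod_elem_left[OF M(2,1) Y(2)]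
        sym_prod_elem_left[OF M(2,1) B.m_closed[OF Y]]
      by (rule hom_mult[OF sym_prod_inner_hom[OF M(2,1)] Y])
  qed
  then show "sym_prod a b G X (Y \<otimes>\<^bsub>sym_power b G\<^esub> Y') = sym_prod a b G X Y \<otimes>\<^bsub>?S\<^esub> sym_prod a b G X Y'"
    by simp
qed

lemma sym_mult_hom:
  "sym_mult a b G \<in> hom (tensor_group (sym_power a G) (sym_power b G)) (sym_power (a + b) G)"
  unfolding sym_mult_def
  by (rule tensor_lift_hom[OF group_sym_power[OF G] group_sym_power[OF G] comm_group_sym_power[OF G] sym_prod_left_hom sym_prod_right_hom])

lemma sym_mult_elem:
  assumes "set_mset M \<subseteq> carrier G" "size M = a" "set_mset N \<subseteq> carrier G" "size N = b"
  shows "sym_mult a b G (tensor_elem (sym_power a G) (sym_power b G) (sym_elem a G M) (sym_elem b G N))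
    = sym_elem (a + b) G (M + N)"
proof -
  have "sym_elem a G M \<in> carrier (sym_power a G)" and Y: "sym_elem b G N \<in> carrier (sym_power b G)"
    using assms by (auto intro: sym_elem_closed[OF G])
  then have "sym_mult a b G (tensor_elem (sym_power a G) (sym_power b G) (sym_elem a G M) (sym_elem b G N))
    = sym_prod a b G (sym_elem a G M) (sym_elem b G N)"
    unfolding sym_mult_def
    by - (rule tensor_lift_elem[OF group_sym_power[OF G] group_sym_power[OF G] comm_group_sym_power[OF G]
          sym_prod_left_hom sym_prod_right_hom])
  also have "\<dots> = sym_elem (a + b) G (M + N)"
    unfolding sym_prod_elem_left[OF assms(1,2) Y] by (rule sym_prod_inner_elem[OF assms])
  finally show ?thesis .
qed

end

section \<open>Bigraded polynomials in the monotone surjections\<close>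

text \<open>Both sides are additive in u and in v, which leaves the case of two basis elements. This
  makes substitutions of variables ring homomorphisms.\<close>

lemma frag_extend_mult:
  fixes f :: "'a::comm_monoid_add \<Rightarrow> ('b::comm_monoid_add \<Rightarrow>\<^sub>0 int)"
  assumes f: "\<And>a b. f (a + b) = f a * f b"
  shows "frag_extend f (u * v) = frag_extend f u * frag_extend f v"
proof -
  have 1: "frag_extend f (frag_of a * v) = f a * frag_extend f v" for a
    using subset_UNIV[of "Poly_Mapping.keys v"]
    by (induction v rule: frag_induction)
      (auto simp: Poly_Mapping.mult_single f right_diff_distrib frag_extend_diff)
  show ?thesis
    using subset_UNIV[of "Poly_Mapping.keys u"]
    by (induction u rule: frag_induction) (auto simp: 1 left_diff_distrib frag_extend_diff)
qed

lemma frag_cmul_eq_times: "frag_cmul k (x :: 'a::comm_monoid_add \<Rightarrow>\<^sub>0 int) = of_int k * x"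
proof -
  have nat: "frag_cmul (int i) x = of_nat i * x" for i
    by (induction i) (auto simp: frag_cmul_distrib algebra_simps)
  show ?thesis
  proof (cases "k \<ge> 0")
    case True
    then show ?thesis using nat[of "nat k"] by (metis int_nat_eq of_int_of_nat_eq)
  next
    case False
    then show ?thesis using nat[of "nat (-k)"] minus_frag_cmul[of "-k" x]
      by (metis add.inverse_inverse minus_mult_left of_int_minus of_int_of_nat_eq int_nat_eq linorder_le_cases neg_0_le_iff_le)
  qed
qed

text \<open>Pairs of multisets under addition are the monomials, so with the convolution product
  this is the polynomial ring over the integers in variables x and y indexed by functions; the first
  multiset records the x, the second the y.\<close>

type_synonym bipoly = "((nat \<Rightarrow> nat) multiset \<times> (nat \<Rightarrow> nat) multiset) \<Rightarrow>\<^sub>0 int"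

lemma frag_of_empty_pair: "frag_of ({#}, {#}) = 1"
  by (simp only: single_one flip: zero_prod_def)

lemma frag_of_pair_mult: "frag_of (M, N) * frag_of (M', N') = frag_of (M + M', N + N')"
  for M M' :: "'a multiset" and N N' :: "'b multiset"
  by (simp add: Poly_Mapping.mult_single)

definition poly_eval ::
    "('i \<Rightarrow> ('b::comm_monoid_add \<Rightarrow>\<^sub>0 int)) \<Rightarrow> ('i \<Rightarrow> ('b \<Rightarrow>\<^sub>0 int))
      \<Rightarrow> ('i multiset \<times> 'i multiset \<Rightarrow>\<^sub>0 int) \<Rightarrow> ('b \<Rightarrow>\<^sub>0 int)" where
  "poly_eval X Y = frag_extend (\<lambda>(M, N). (\<Prod>i\<in>#M. X i) * (\<Prod>i\<in>#N. Y i))"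

lemma poly_eval_frag_of [simp]:
  "poly_eval X Y (frag_of (M, N)) = (\<Prod>i\<in>#M. X i) * (\<Prod>i\<in>#N. Y i)"
  by (simp add: poly_eval_def)

lemma poly_eval_0 [simp]: "poly_eval X Y 0 = 0"
  by (simp add: poly_eval_def)

lemma poly_eval_1 [simp]: "poly_eval X Y 1 = 1"
  unfolding frag_of_empty_pair[symmetric] poly_eval_frag_of by simp

lemma poly_eval_diff: "poly_eval X Y (u - v) = poly_eval X Y u - poly_eval X Y v"
  and poly_eval_add: "poly_eval X Y (u + v) = poly_eval X Y u + poly_eval X Y v"
  and poly_eval_minus: "poly_eval X Y (- u) = - poly_eval X Y u"
  by (simp_all add: poly_eval_def frag_extend_diff frag_extend_add frag_extend_minus)

lemma poly_eval_mult: "poly_eval X Y (u * v) = poly_eval X Y u * poly_eval X Y v"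
  unfolding poly_eval_def by (rule frag_extend_mult) (auto simp: mult_ac)

lemma poly_eval_sum: "poly_eval X Y (sum f A) = (\<Sum>a\<in>A. poly_eval X Y (f a))"
  by (induction A rule: infinite_finite_induct) (auto simp: poly_eval_add)

lemma poly_eval_sum_mset: "poly_eval X Y (\<Sum>a\<in>#M. f a) = (\<Sum>a\<in>#M. poly_eval X Y (f a))"
  by (induction M) (auto simp: poly_eval_add)

lemma poly_eval_prod_mset: "poly_eval X Y (\<Prod>a\<in>#M. f a) = (\<Prod>a\<in>#M. poly_eval X Y (f a))"
  by (induction M) (auto simp: poly_eval_mult)

lemma poly_eval_of_int: "poly_eval X Y (of_int k * u) = of_int k * poly_eval X Y u"
  by (simp add: poly_eval_def frag_extend_cmul flip: frag_cmul_eq_times)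

lemma poly_eval_power_minus_one: "poly_eval X Y ((-1) ^ i * u) = (-1) ^ i * poly_eval X Y u"
  by (cases "even i") (auto simp: poly_eval_minus)

lemma poly_eval_poly_eval:
  "poly_eval X' Y' (poly_eval X Y z) = poly_eval (\<lambda>i. poly_eval X' Y' (X i)) (\<lambda>i. poly_eval X' Y' (Y i)) z"
  using subset_UNIV[of "Poly_Mapping.keys z"]
  by (induction z rule: frag_induction) (auto simp: poly_eval_mult poly_eval_prod_mset poly_eval_diff)

section \<open>Monotone maps and the simplicial operators on polynomials\<close>

definition mono_maps :: "nat \<Rightarrow> nat \<Rightarrow> (nat \<Rightarrow> nat) set" where
  "mono_maps n m = {\<sigma> \<in> extensional {..m}. mono_on {..m} \<sigma> \<and> \<sigma> ` {..m} \<subseteq> {..n}}"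

text \<open>These index a basis of the m-simplices of \<open>K n\<close>. Pullback does not preserve
  surjectivity, whence the larger set \<open>mono_maps\<close>.\<close>

definition surj_maps :: "nat \<Rightarrow> nat \<Rightarrow> (nat \<Rightarrow> nat) set" where
  "surj_maps n m = {\<sigma> \<in> extensional {..m}. mono_on {..m} \<sigma> \<and> \<sigma> ` {..m} = {..n}}"

definition simp_op :: "nat \<Rightarrow> nat \<Rightarrow> (nat \<Rightarrow> nat) \<Rightarrow> bool" where
  "simp_op m m' \<theta> \<longleftrightarrow> mono_on {..m'} \<theta> \<and> \<theta> ` {..m'} \<subseteq> {..m}"

definition pull :: "nat \<Rightarrow> (nat \<Rightarrow> nat) \<Rightarrow> (nat \<Rightarrow> nat) \<Rightarrow> nat \<Rightarrow> nat" where
  "pull m' \<theta> \<sigma> = restrict (\<sigma> \<circ> \<theta>) {..m'}"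

text \<open>Monotone maps that are not onto index degenerate generators, so their variables are \<open>0\<close>.\<close>

definition xvar :: "nat \<Rightarrow> nat \<Rightarrow> (nat \<Rightarrow> nat) \<Rightarrow> bipoly" where
  "xvar n m \<sigma> = (if \<sigma> \<in> surj_maps n m then frag_of ({#\<sigma>#}, {#}) else 0)"

definition yvar :: "nat \<Rightarrow> nat \<Rightarrow> (nat \<Rightarrow> nat) \<Rightarrow> bipoly" where
  "yvar n m \<sigma> = (if \<sigma> \<in> surj_maps n m then frag_of ({#}, {#\<sigma>#}) else 0)"

definition monom_xy :: "nat \<Rightarrow> nat \<Rightarrow> (nat \<Rightarrow> nat) multiset \<Rightarrow> (nat \<Rightarrow> nat) multiset \<Rightarrow> bipoly" where
  "monom_xy n m M N = (\<Prod>\<sigma>\<in>#M. xvar n m \<sigma>) * (\<Prod>\<tau>\<in>#N. yvar n m \<tau>)"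

text \<open>\<open>bipoly\<close> has variables for arbitrary functions. Those outside the basis are
  sent to 0, so that \<open>act_comp\<close> holds for every polynomial; in return, the identity
  operator fixes only polynomials in the basis variables (\<open>act_id\<close>).\<close>

definition act :: "nat \<Rightarrow> nat \<Rightarrow> nat \<Rightarrow> (nat \<Rightarrow> nat) \<Rightarrow> bipoly \<Rightarrow> bipoly" where
  "act n m m' \<theta> = poly_eval
     (\<lambda>\<sigma>. if \<sigma> \<in> surj_maps n m then xvar n m' (pull m' \<theta> \<sigma>) else 0)
     (\<lambda>\<sigma>. if \<sigma> \<in> surj_maps n m then yvar n m' (pull m' \<theta> \<sigma>) else 0)"

lemma surj_maps_subset: "surj_maps n m \<subseteq> mono_maps n m"
  by (auto simp: surj_maps_def mono_maps_def)

lemma pull_mono_maps: "simp_op m m' \<theta> \<Longrightarrow> \<sigma> \<in> mono_maps n m \<Longrightarrow> pull m' \<theta> \<sigma> \<in> mono_maps n m'"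
  unfolding simp_op_def mono_maps_def pull_def monotone_on_def image_subset_iff by simp

text \<open>The image of the pullback lies in the image of \<sigma>. Read contrapositively: a
  variable that is 0 for lack of surjectivity stays 0 under every operator.\<close>

lemma pull_surj_imp_surj:
  assumes "simp_op m m' \<theta>" "\<sigma> \<in> mono_maps n m" "pull m' \<theta> \<sigma> \<in> surj_maps n m'"
  shows "\<sigma> \<in> surj_maps n m"
proof -
  have "{..n} = (\<sigma> \<circ> \<theta>) ` {..m'}"
    using assms(3) by (auto simp: surj_maps_def pull_def)
  also have "\<dots> \<subseteq> \<sigma> ` {..m}" using assms(1) by (auto simp: simp_op_def)
  finally show ?thesis using assms(2) by (auto simp: surj_maps_def mono_maps_def)
qed

lemma pull_pull: "simp_op m' m'' \<theta>' \<Longrightarrow> pull m'' \<theta>' (pull m' \<theta> \<sigma>) = pull m'' (\<theta> \<circ> \<theta>') \<sigma>"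
  by (auto simp: pull_def simp_op_def fun_eq_iff restrict_def)

lemma pull_cong: "(\<And>j. j \<le> m' \<Longrightarrow> \<theta> j = \<theta>' j) \<Longrightarrow> pull m' \<theta> \<sigma> = pull m' \<theta>' \<sigma>"
  by (auto simp: pull_def fun_eq_iff restrict_def)

lemma act_xvar:
  assumes "simp_op m m' \<theta>" "\<sigma> \<in> mono_maps n m"
  shows "act n m m' \<theta> (xvar n m \<sigma>) = xvar n m' (pull m' \<theta> \<sigma>)"
  using pull_surj_imp_surj[OF assms] by (auto simp: act_def xvar_def)

lemma act_yvar:
  assumes "simp_op m m' \<theta>" "\<sigma> \<in> mono_maps n m"
  shows "act n m m' \<theta> (yvar n m \<sigma>) = yvar n m' (pull m' \<theta> \<sigma>)"
  using pull_surj_imp_surj[OF assms] by (auto simp: act_def yvar_def)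

lemma act_monom:
  assumes "simp_op m m' \<theta>" "set_mset M \<subseteq> mono_maps n m" "set_mset N \<subseteq> mono_maps n m"
  shows "act n m m' \<theta> (monom_xy n m M N) = monom_xy n m' (image_mset (pull m' \<theta>) M) (image_mset (pull m' \<theta>) N)"
proof -
  have "(\<Prod>\<sigma>\<in>#M. act n m m' \<theta> (xvar n m \<sigma>)) = (\<Prod>\<sigma>\<in>#M. xvar n m' (pull m' \<theta> \<sigma>))"
    "(\<Prod>\<sigma>\<in>#N. act n m m' \<theta> (yvar n m \<sigma>)) = (\<Prod>\<sigma>\<in>#N. yvar n m' (pull m' \<theta> \<sigma>))"
    using assms by (auto intro!: arg_cong[of _ _ prod_mset] image_mset_cong act_xvar act_yvar)
  then show ?thesis
    unfolding monom_xy_def act_def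
    by (simp add: poly_eval_mult poly_eval_prod_mset image_mset.compositionality o_def)
qed

lemma monom_surj:
  assumes "set_mset M \<subseteq> surj_maps n m" "set_mset N \<subseteq> surj_maps n m"
  shows "monom_xy n m M N = frag_of (M, N)"
proof -
  have "(\<Prod>\<sigma>\<in>#M. xvar n m \<sigma>) = frag_of (M, {#})"
    using assms(1)
    by (induction M) (auto simp: xvar_def frag_of_pair_mult frag_of_empty_pair)
  moreover have "(\<Prod>\<sigma>\<in>#N. yvar n m \<sigma>) = frag_of ({#}, N)"
    using assms(2)
    by (induction N) (auto simp: yvar_def frag_of_pair_mult frag_of_empty_pair)
  ultimately show ?thesis by (simp add: monom_xy_def frag_of_pair_mult)
qed

lemma monom_not_surj:
  assumes "\<not> (set_mset M \<subseteq> surj_maps n m \<and> set_mset N \<subseteq> surj_maps n m)"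
  shows "monom_xy n m M N = 0"
proof -
  from assms obtain \<sigma> where "\<sigma> \<notin> surj_maps n m" "\<sigma> \<in># M \<or> \<sigma> \<in># N" by auto
  then show ?thesis unfolding monom_xy_def xvar_def yvar_def
    by (auto dest!: multi_member_split)
qed

lemma act_comp:
  assumes "simp_op m m' \<theta>" "simp_op m' m'' \<theta>'"
  shows "act n m' m'' \<theta>' (act n m m' \<theta> z) = act n m m'' (\<theta> \<circ> \<theta>') z"
proof -
  have "act n m' m'' \<theta>' (if \<sigma> \<in> surj_maps n m then xvar n m' (pull m' \<theta> \<sigma>) else 0)
      = (if \<sigma> \<in> surj_maps n m then xvar n m'' (pull m'' (\<theta> \<circ> \<theta>') \<sigma>) else 0)"
    "act n m' m'' \<theta>' (if \<sigma> \<in> surj_maps n m then yvar n m' (pull m' \<theta> \<sigma>) else 0)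
      = (if \<sigma> \<in> surj_maps n m then yvar n m'' (pull m'' (\<theta> \<circ> \<theta>') \<sigma>) else 0)" for \<sigma>
    using act_xvar[OF assms(2) pull_mono_maps[OF assms(1)]] act_yvar[OF assms(2) pull_mono_maps[OF assms(1)]]
      subsetD[OF surj_maps_subset] pull_pull[OF assms(2)]
    by (auto simp: act_def)
  then show ?thesis
    unfolding act_def poly_eval_poly_eval by simp
qed

lemma act_cong: "(\<And>j. j \<le> m' \<Longrightarrow> \<theta> j = \<theta>' j) \<Longrightarrow> act n m m' \<theta> = act n m m' \<theta>'"
  using pull_cong[of m' \<theta> \<theta>'] unfolding act_def by presburger

lemma act_id: 
  assumes "set_mset M \<subseteq> surj_maps n m" "set_mset N \<subseteq> surj_maps n m"
  shows "act n m m (\<lambda>j. j) (frag_of (M, N)) = frag_of (M, N)"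
proof -
  have *: "pull m (\<lambda>j. j) \<sigma> = \<sigma>" if "\<sigma> \<in> surj_maps n m" for \<sigma>
    using that by (auto simp: pull_def surj_maps_def extensional_def fun_eq_iff restrict_def)
  then have "image_mset (pull m (\<lambda>j. j)) M = M" "image_mset (pull m (\<lambda>j. j)) N = N"
    using assms by (auto intro!: multiset.map_ident_strong)
  then show ?thesis
    using act_monom[of m m "\<lambda>j. j" M n N] assms surj_maps_subset[of n m]
    by (auto simp: monom_surj[OF assms] simp_op_def monotone_on_def)
qed

section \<open>The homotopy between the interchange and a sign\<close>

definition upset :: "nat \<Rightarrow> nat set \<Rightarrow> bool" where
  "upset m U \<longleftrightarrow> U \<subseteq> {..m} \<and> (\<forall>x\<in>U. \<forall>y\<le>m. x \<le> y \<longrightarrow> y \<in> U)"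

definition trivial_upset :: "nat \<Rightarrow> nat set \<Rightarrow> bool" where
  "trivial_upset m U \<longleftrightarrow> U = {} \<or> U = {..m}"

definition preim :: "nat \<Rightarrow> (nat \<Rightarrow> nat) \<Rightarrow> nat set \<Rightarrow> nat set" where
  "preim m' \<theta> U = {x \<in> {..m'}. \<theta> x \<in> U}"

text \<open>The retraction of \<open>K(1)\<^bsup>\<otimes>n\<^esup>\<close> onto \<open>K(n)\<close> given by the cup product: on indicator functions it is
  \<open>(f\<^sub>1, \<dots>, f\<^sub>n) \<mapsto> f\<^sub>1 + f\<^sub>1 f\<^sub>2 + \<dots> + f\<^sub>1 \<cdots> f\<^sub>n\<close>, which is onto \<open>{..n}\<close> only for strictly decreasing up-sets.\<close>

definition stair :: "nat \<Rightarrow> nat set list \<Rightarrow> nat \<Rightarrow> nat" where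
  "stair m v = restrict (\<lambda>x. length (takeWhile (\<lambda>U. x \<in> U) v)) {..m}"

text \<open>The list stands for a generator of the 2n-th tensor power of K(1); the retraction is
  applied to each half, giving an element of K(n) tensor K(n).\<close>

definition xytens :: "nat \<Rightarrow> nat \<Rightarrow> nat set list \<Rightarrow> bipoly" where
  "xytens n m v = xvar n m (stair m (take n v)) * yvar n m (stair m (drop n v))"

definition swap_at :: "nat \<Rightarrow> 'a list \<Rightarrow> 'a list" where
  "swap_at k v = v[k := v ! Suc k, Suc k := v ! k]"

text \<open>Let f and g be the indicators of entries k and k + 1. Expanding -\<chi>(x) (f(x) - f(y))
  (g(x) - g(y)) gives four terms; the one with f(x) g(x) is constant in y and hence 0, and the other
  three are the three summands here.\<close>

definition swap_htpy :: "nat \<Rightarrow> nat \<Rightarrow> nat set \<Rightarrow> nat \<Rightarrow> nat set list \<Rightarrow> bipoly" where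
  "swap_htpy n m \<chi> k v =
     xytens n m (v[k := v ! k \<inter> \<chi>]) + xytens n m (v[k := v ! Suc k \<inter> \<chi>, Suc k := v ! k])
       - xytens n m (v[k := \<chi>, Suc k := v ! k \<inter> v ! Suc k])"

text \<open>Each letter contributes a homotopy from 0 to 1 + swap. With alternating signs the
  intermediate lists cancel, leaving the identity minus (-1)^length times the whole
  permutation.\<close>

primrec word_htpy :: "nat \<Rightarrow> nat \<Rightarrow> nat set \<Rightarrow> nat list \<Rightarrow> nat set list \<Rightarrow> bipoly" where
  "word_htpy n m \<chi> [] v = 0"
| "word_htpy n m \<chi> (k # ks) v = swap_htpy n m \<chi> k v - word_htpy n m \<chi> ks (swap_at k v)"

lemma upset_Int: "upset m U \<Longrightarrow> upset m V \<Longrightarrow> upset m (U \<inter> V)"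
  by (auto simp: upset_def)

lemma upset_preim:
  assumes "simp_op m m' \<theta>" "upset m U"
  shows "upset m' (preim m' \<theta> U)"
  using assms unfolding upset_def preim_def simp_op_def monotone_on_def image_subset_iff by auto

lemma preim_Int: "preim m' \<theta> (U \<inter> V) = preim m' \<theta> U \<inter> preim m' \<theta> V"
  by (auto simp: preim_def)

lemma stair_mono_maps:
  assumes "\<forall>U\<in>set v. upset m U"
  shows "stair m v \<in> mono_maps (length v) m"
proof -
  have "length (takeWhile (\<lambda>U. x \<in> U) v) \<le> length (takeWhile (\<lambda>U. y \<in> U) v)" if "x \<le> y" "y \<le> m" for x y
    using assms that by (induction v) (auto simp: upset_def)
  then show ?thesis
    by (auto simp: mono_maps_def stair_def monotone_on_def length_takeWhile_le)
qed

lemma pull_stair: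
  assumes "simp_op m m' \<theta>"
  shows "pull m' \<theta> (stair m v) = stair m' (map (preim m' \<theta>) v)"
proof
  fix x
  have "length (takeWhile (\<lambda>U. \<theta> x \<in> U) v) = length (takeWhile (\<lambda>U. x \<in> U) (map (preim m' \<theta>) v))" if "x \<le> m'"
    using that by (simp add: takeWhile_map o_def preim_def)
  then show "pull m' \<theta> (stair m v) x = stair m' (map (preim m' \<theta>) v) x"
    using assms by (auto simp: pull_def stair_def simp_op_def)
qed

text \<open>An empty entry keeps the count below \<open>length v\<close>; a full entry at i never
  stops the count, so the value i is skipped.\<close>

lemma stair_trivial_not_surj:
  assumes "i < length v" "trivial_upset m (v ! i)"
  shows "stair m v \<notin> surj_maps (length v) m"
proof
  assume "stair m v \<in> surj_maps (length v) m"
  then have im: "stair m v ` {..m} = {..length v}" by (simp add: surj_maps_def)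
  from assms(2) consider "v ! i = {}" | "v ! i = {..m}" by (auto simp: trivial_upset_def)
  then show False
  proof cases
    case 1
    have "length v \<in> stair m v ` {..m}" unfolding im by simp
    then obtain x where "x \<le> m" "length (takeWhile (\<lambda>U. x \<in> U) v) = length v" by (auto simp: stair_def)
    then have "takeWhile (\<lambda>U. x \<in> U) v = v"
      by (metis takeWhile_eq_take take_all order_refl)
    then show False using assms(1) 1 by (metis empty_iff nth_mem takeWhile_eq_all_conv)
  next
    case 2
    have "i \<in> stair m v ` {..m}" unfolding im using assms by simp
    then obtain x where "x \<le> m" "length (takeWhile (\<lambda>U. x \<in> U) v) = i" by (auto simp: stair_def)
    then show False using nth_length_takeWhile[of "\<lambda>U. x \<in> U" v] assms(1) 2 by auto
  qed
qed

text \<open>The value i + 1 would need a point of entry i outside entry i + 1.\<close>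

lemma stair_ascent_not_surj:
  assumes "Suc i < length v" "v ! i \<subseteq> v ! Suc i"
  shows "stair m v \<notin> surj_maps (length v) m"
proof
  assume "stair m v \<in> surj_maps (length v) m"
  then have "Suc i \<in> stair m v ` {..m}" using assms by (simp add: surj_maps_def)
  then obtain x where x: "length (takeWhile (\<lambda>U. x \<in> U) v) = Suc i" by (auto simp: stair_def)
  then have "x \<notin> v ! Suc i" using nth_length_takeWhile[of "\<lambda>U. x \<in> U" v] assms(1) by auto
  moreover have "x \<in> v ! i"
    using x by (metis lessI nth_mem set_takeWhileD takeWhile_nth)
  ultimately show False using assms by auto
qed

text \<open>A trivial up-set has a constant indicator, so it represents 0 in K(1);
  \<open>xytens\<close> has to respect this in each of its 2n places.\<close>

lemma xytens_trivial:
  assumes "length v = 2 * n" "i < 2 * n" "trivial_upset m (v ! i)"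
  shows "xytens n m v = 0"
proof (cases "i < n")
  case True
  then have "stair m (take n v) \<notin> surj_maps n m"
    using stair_trivial_not_surj[of i "take n v" m] assms by simp
  then show ?thesis by (simp add: xytens_def xvar_def)
next
  case False
  then have "stair m (drop n v) \<notin> surj_maps n m"
    using stair_trivial_not_surj[of "i - n" "drop n v" m] assms by simp
  then show ?thesis by (simp add: xytens_def yvar_def)
qed

lemma act_xytens:
  assumes "simp_op m m' \<theta>" "length v = 2 * n" "\<forall>U\<in>set v. upset m U"
  shows "act n m m' \<theta> (xytens n m v) = xytens n m' (map (preim m' \<theta>) v)"
proof -
  have "stair m (take n v) \<in> mono_maps n m" "stair m (drop n v) \<in> mono_maps n m"
    using stair_mono_maps[of "take n v" m] stair_mono_maps[of "drop n v" m] assms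
    by (auto dest: in_set_takeD in_set_dropD)
  then show ?thesis
    using act_xvar[OF assms(1)] act_yvar[OF assms(1)]
    by (simp add: xytens_def act_def poly_eval_mult pull_stair[OF assms(1)] take_map drop_map)
qed

lemma set_list_update_upset:
  "\<forall>U\<in>set v. upset m U \<Longrightarrow> upset m W \<Longrightarrow> \<forall>U\<in>set (v[k := W]). upset m U"
  using set_update_subset_insert[of v k W] by auto

lemma swap_at_upsets:
  assumes "\<forall>U\<in>set v. upset m U" "Suc k < length v"
  shows "\<forall>U\<in>set (swap_at k v). upset m U"
  unfolding swap_at_def using assms by (intro set_list_update_upset) auto

lemma length_swap_at [simp]: "length (swap_at k v) = length v"
  by (simp add: swap_at_def)

lemma map_swap_at: "Suc k < length v \<Longrightarrow> map f (swap_at k v) = swap_at k (map f v)"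
  by (simp add: swap_at_def map_update)

text \<open>The correction term drops out because its entry k is the full set, and intersecting with
  the full set changes nothing in the other two.\<close>

lemma swap_htpy_top:
  assumes "length v = 2 * n" "Suc k < 2 * n" "\<forall>U\<in>set v. upset m U"
  shows "swap_htpy n m {..m} k v = xytens n m v + xytens n m (swap_at k v)"
proof -
  have "U \<inter> {..m} = U" if "U \<in> set v" for U using assms(3) that by (auto simp: upset_def)
  then have *: "v ! k \<inter> {..m} = v ! k" "v ! Suc k \<inter> {..m} = v ! Suc k" using assms by auto
  have "xytens n m (v[k := {..m}, Suc k := v ! k \<inter> v ! Suc k]) = 0"
    using assms by (intro xytens_trivial[of _ n k]) (auto simp: trivial_upset_def nth_list_update)
  then show ?thesis by (simp add: swap_htpy_def swap_at_def *)
qed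

lemma swap_htpy_empty:
  assumes "length v = 2 * n" "Suc k < 2 * n"
  shows "swap_htpy n m {} k v = 0"
proof -
  have "xytens n m (v[k := {}]) = 0" "xytens n m (v[k := {}, Suc k := W]) = 0" for W
    using assms by (auto intro!: xytens_trivial[of _ n k] simp: trivial_upset_def nth_list_update)
  then show ?thesis by (simp add: swap_htpy_def)
qed

text \<open>A trivial entry away from k and k + 1 survives in all three terms. At k or k + 1 it
  makes f(x) - f(y) or g(x) - g(y) vanish; in terms of sets, an empty entry makes all three terms
  trivial, a full one makes one term trivial and lets the other two cancel.\<close>

lemma swap_htpy_trivial:
  assumes v: "length v = 2 * n" "Suc k < 2 * n" "\<forall>U\<in>set v. upset m U" "upset m \<chi>"
    and i: "i < 2 * n" "trivial_upset m (v ! i)"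
  shows "swap_htpy n m \<chi> k v = 0"
proof -
  have z: "xytens n m w = 0" if "length w = 2 * n" "j < 2 * n" "w ! j = {} \<or> w ! j = {..m}" for w j
    using that by (intro xytens_trivial[of w n j]) (auto simp: trivial_upset_def)
  have sub: "v ! k \<subseteq> {..m}" "v ! Suc k \<subseteq> {..m}" "\<chi> \<subseteq> {..m}" using v by (auto simp: upset_def)
  consider "i \<noteq> k" "i \<noteq> Suc k" | "i = k" "v ! k = {}" | "i = k" "v ! k = {..m}"
    | "i = Suc k" "v ! Suc k = {}" | "i = Suc k" "v ! Suc k = {..m}"
    using i by (auto simp: trivial_upset_def)
  then show ?thesis
  proof cases
    case 1
    then show ?thesis unfolding swap_htpy_def using v i
      by (simp add: z[of _ i] nth_list_update trivial_upset_def)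
  next
    case 2
    then show ?thesis unfolding swap_htpy_def using v
      by (simp add: z[of _ k] z[of _ "Suc k"] nth_list_update)
  next
    case 3
    then have "{..m} \<inter> \<chi> = \<chi>" "{..m} \<inter> v ! Suc k = v ! Suc k" using sub by auto
    moreover have "v[k := \<chi>, Suc k := v ! Suc k] = v[k := \<chi>]"
      by (metis list_update_id list_update_swap n_not_Suc_n)
    moreover have "xytens n m (v[k := v ! Suc k \<inter> \<chi>, Suc k := {..m}]) = 0"
      using v by (intro z[of _ "Suc k"]) auto
    ultimately show ?thesis unfolding swap_htpy_def using 3 by simp
  next
    case 4
    then show ?thesis unfolding swap_htpy_def using v
      by (simp add: z[of _ k] z[of _ "Suc k"] nth_list_update)
  next
    case 5
    then have "{..m} \<inter> \<chi> = \<chi>" "v ! k \<inter> {..m} = v ! k" using sub by auto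
    moreover have "xytens n m (v[k := v ! k \<inter> \<chi>]) = 0"
      using v 5 by (intro z[of _ "Suc k"]) auto
    ultimately show ?thesis unfolding swap_htpy_def using 5 by simp
  qed
qed

lemma act_diff: "act n m m' \<theta> (u - v) = act n m m' \<theta> u - act n m m' \<theta> v"
  and act_add: "act n m m' \<theta> (u + v) = act n m m' \<theta> u + act n m m' \<theta> v"
  and act_mult: "act n m m' \<theta> (u * v) = act n m m' \<theta> u * act n m m' \<theta> v"
  and act_0 [simp]: "act n m m' \<theta> 0 = 0"
  and act_sum: "act n m m' \<theta> (sum g A) = (\<Sum>a\<in>A. act n m m' \<theta> (g a))"
  and act_sum_mset: "act n m m' \<theta> (\<Sum>a\<in>#M. f a) = (\<Sum>a\<in>#M. act n m m' \<theta> (f a))"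
  by (simp_all add: act_def poly_eval_diff poly_eval_add poly_eval_mult poly_eval_sum poly_eval_sum_mset)

lemma act_power_minus_one: "act n m m' \<theta> ((-1) ^ i * u) = (-1) ^ i * act n m m' \<theta> u"
  unfolding act_def by (rule poly_eval_power_minus_one)

lemma act_swap_htpy:
  assumes v: "simp_op m m' \<theta>" "length v = 2 * n" "Suc k < 2 * n" "\<forall>U\<in>set v. upset m U" "upset m \<chi>"
  shows "act n m m' \<theta> (swap_htpy n m \<chi> k v) = swap_htpy n m' (preim m' \<theta> \<chi>) k (map (preim m' \<theta>) v)"
proof -
  have a1: "act n m m' \<theta> (xytens n m (v[k := W])) = xytens n m' ((map (preim m' \<theta>) v)[k := preim m' \<theta> W])"
    if W: "upset m W" for W
    using act_xytens[OF v(1) _ set_list_update_upset[OF v(4) W, of k]] v(2) by (simp add: map_update)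
  have a2: "act n m m' \<theta> (xytens n m (v[k := W, Suc k := W']))
      = xytens n m' ((map (preim m' \<theta>) v)[k := preim m' \<theta> W, Suc k := preim m' \<theta> W'])"
    if W: "upset m W" "upset m W'" for W W'
    using act_xytens[OF v(1) _ set_list_update_upset[OF set_list_update_upset[OF v(4) W(1), of k] W(2), of "Suc k"]] v(2)
    by (simp add: map_update)
  have u: "upset m (v ! k)" "upset m (v ! Suc k)" using v by auto
  have e: "map (preim m' \<theta>) v ! k = preim m' \<theta> (v ! k)" "map (preim m' \<theta>) v ! Suc k = preim m' \<theta> (v ! Suc k)"
    using v by auto
  show ?thesis
    unfolding swap_htpy_def act_diff act_add e a1[OF upset_Int[OF u(1) v(5)]]
      a2[OF upset_Int[OF u(2) v(5)] u(1)] a2[OF v(5) upset_Int[OF u]] preim_Int ..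
qed

lemma word_htpy_top:
  assumes "length v = 2 * n" "\<forall>k\<in>set ks. Suc k < 2 * n" "\<forall>U\<in>set v. upset m U"
  shows "word_htpy n m {..m} ks v = xytens n m v - (-1) ^ length ks * xytens n m (fold swap_at ks v)"
  using assms
proof (induction ks arbitrary: v)
  case (Cons k ks)
  then show ?case
    using Cons.IH[of "swap_at k v"] swap_at_upsets[of v m k] by (simp add: swap_htpy_top)
qed auto

lemma word_htpy_empty:
  assumes "length v = 2 * n" "\<forall>k\<in>set ks. Suc k < 2 * n"
  shows "word_htpy n m {} ks v = 0"
  using assms by (induction ks arbitrary: v) (auto simp: swap_htpy_empty)

lemma word_htpy_trivial:
  assumes "length v = 2 * n" "\<forall>k\<in>set ks. Suc k < 2 * n" "\<forall>U\<in>set v. upset m U" "upset m \<chi>"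
    and "i < 2 * n" "trivial_upset m (v ! i)"
  shows "word_htpy n m \<chi> ks v = 0"
  using assms
proof (induction ks arbitrary: v i)
  case (Cons k ks)
  \<comment> \<open>The place of the trivial entry after the swap.\<close>
  define j where "j = (if i = k then Suc k else if i = Suc k then k else i)"
  have "j < 2 * n" "swap_at k v ! j = v ! i"
    using Cons.prems by (auto simp: j_def swap_at_def nth_list_update)
  then have "word_htpy n m \<chi> ks (swap_at k v) = 0"
    using Cons.prems swap_at_upsets[of v m k] by (intro Cons.IH[of _ j]) auto
  moreover have "swap_htpy n m \<chi> k v = 0"
    using Cons.prems by (intro swap_htpy_trivial) auto
  ultimately show ?case by simp
qed auto

lemma act_word_htpy:
  assumes "simp_op m m' \<theta>" "length v = 2 * n" "\<forall>k\<in>set ks. Suc k < 2 * n" "\<forall>U\<in>set v. upset m U" "upset m \<chi>"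
  shows "act n m m' \<theta> (word_htpy n m \<chi> ks v) = word_htpy n m' (preim m' \<theta> \<chi>) ks (map (preim m' \<theta>) v)"
  using assms
proof (induction ks arbitrary: v)
  case (Cons k ks)
  then show ?case
    using Cons.IH[of "swap_at k v"] swap_at_upsets[of v m k]
    by (simp add: act_diff act_swap_htpy map_swap_at)
qed auto

section \<open>From tensor powers of K(1) to K(n) by alternation\<close>

fun alt :: "('a list \<Rightarrow> 'b::ab_group_add) \<Rightarrow> 'a list \<Rightarrow> 'b" where
  "alt G [a, b] = G [a, b] - G [b, a]"
| "alt G [a, b, c] = G [a, b, c] - G [b, a, c] + G [b, c, a] - G [c, b, a] + G [c, a, b] - G [a, c, b]"
| "alt G _ = 0"

text \<open>Alternating the level sets of \<open>\<sigma>\<close> embeds \<open>K(n)\<close> into \<open>K(1)\<^bsup>\<otimes>n\<^esup>\<close>: if \<open>\<sigma>\<close> misses a value, then two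
  consecutive levels agree or one of them is trivial.\<close>

definition level :: "nat \<Rightarrow> (nat \<Rightarrow> nat) \<Rightarrow> nat \<Rightarrow> nat set" where
  "level m \<sigma> j = {x \<in> {..m}. j \<le> \<sigma> x}"

definition levels :: "nat \<Rightarrow> nat \<Rightarrow> (nat \<Rightarrow> nat) \<Rightarrow> nat set list" where
  "levels n m \<sigma> = map (level m \<sigma>) [1..<Suc n]"

text \<open>For each i the letters n + i - 1, ..., i carry entry n + i down to place i, so at the
  end the second block stands before the first. The number of letters is n^2, which has the parity
  of n.\<close>

definition block_swap :: "nat \<Rightarrow> nat list" where
  "block_swap n = concat (map (\<lambda>i. rev [i..<n + i]) [0..<n])"

text \<open>The homotopy of the block exchange, preceded by the embedding of each factor (alternated
  \<open>levels\<close>) and followed by the retraction, which is built into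
  \<open>xytens\<close>.\<close>

definition interchange_htpy :: "nat \<Rightarrow> nat \<Rightarrow> nat set \<Rightarrow> (nat \<Rightarrow> nat) \<Rightarrow> (nat \<Rightarrow> nat) \<Rightarrow> bipoly" where
  "interchange_htpy n m \<chi> \<sigma> \<tau> =
     alt (\<lambda>v. alt (\<lambda>w. word_htpy n m \<chi> (block_swap n) (v @ w)) (levels n m \<tau>)) (levels n m \<sigma>)"

lemma levels_2: "levels 2 m \<sigma> = [level m \<sigma> 1, level m \<sigma> 2]"
  and levels_3: "levels 3 m \<sigma> = [level m \<sigma> 1, level m \<sigma> 2, level m \<sigma> 3]"
  by (simp_all add: levels_def numeral_eq_Suc)

lemma block_swap_2: "block_swap 2 = [1, 0, 2, 1]"
  and block_swap_3: "block_swap 3 = [2, 1, 0, 3, 2, 1, 4, 3, 2]"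
  by (simp_all add: block_swap_def numeral_eq_Suc)

lemma upset_level: "\<sigma> \<in> mono_maps n m \<Longrightarrow> upset m (level m \<sigma> j)"
  unfolding upset_def level_def mono_maps_def monotone_on_def by (auto intro: order_trans)

lemma preim_level: "simp_op m m' \<theta> \<Longrightarrow> preim m' \<theta> (level m \<sigma> j) = level m' (pull m' \<theta> \<sigma>) j"
  by (auto simp: preim_def level_def pull_def simp_op_def)

lemma map_preim_levels: "simp_op m m' \<theta> \<Longrightarrow> map (preim m' \<theta>) (levels n m \<sigma>) = levels n m' (pull m' \<theta> \<sigma>)"
  by (simp add: levels_def preim_level o_def)

context
  fixes n :: nat
  assumes n: "n = 2 \<or> n = 3"
begin

lemma block_swap_bound: "k \<in> set (block_swap n) \<Longrightarrow> Suc k < 2 * n"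
  using n by (auto simp: block_swap_2 block_swap_3)

lemma fold_block_swap:
  assumes "length v = n" "length w = n"
  shows "fold swap_at (block_swap n) (v @ w) = w @ v"
  using n
proof
  assume n2: "n = 2"
  obtain a b c d where "v = [a, b]" "w = [c, d]"
    using assms n2 by (auto simp: numeral_eq_Suc length_Suc_conv)
  then show ?thesis unfolding n2 block_swap_2 by (simp add: swap_at_def numeral_eq_Suc)
next
  assume n3: "n = 3"
  obtain a b c d e f where "v = [a, b, c]" "w = [d, e, f]"
    using assms n3 by (auto simp: numeral_eq_Suc length_Suc_conv)
  then show ?thesis unfolding n3 block_swap_3 by (simp add: swap_at_def numeral_eq_Suc)
qed

lemma length_block_swap: "(-1) ^ length (block_swap n) = ((-1) ^ n :: 'a::ring_1)"
  using n by (auto simp: block_swap_2 block_swap_3)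

lemma alt_levels_cong:
  assumes "\<sigma> \<in> mono_maps n m"
    and "\<And>v. length v = n \<Longrightarrow> \<forall>U\<in>set v. upset m U \<Longrightarrow> F v = G v"
  shows "alt F (levels n m \<sigma>) = alt G (levels n m \<sigma>)"
  using n assms upset_level[OF assms(1)] by (elim disjE) (simp_all add: levels_2 levels_3)

text \<open>This is the well-definedness of the embedding: a generator of K(n) that is degenerate
  must go to 0 in the tensor power of K(1). Vanishing on trivial entries is what makes G a function
  on that tensor power.\<close>

lemma alt_levels_not_surj:
  fixes G :: "nat set list \<Rightarrow> 'b::ab_group_add"
  assumes \<sigma>: "\<sigma> \<in> mono_maps n m" "\<sigma> \<notin> surj_maps n m"
    and G: "\<And>v i. length v = n \<Longrightarrow> \<forall>U\<in>set v. upset m U \<Longrightarrow> i < n \<Longrightarrow> trivial_upset m (v ! i) \<Longrightarrow> G v = 0"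
  shows "alt G (levels n m \<sigma>) = 0"
proof -
  let ?L = "level m \<sigma>"
  note u = upset_level[OF \<sigma>(1)]
  have triv: "trivial_upset m {}" "trivial_upset m {..m}" "upset m {}" "upset m {..m}"
    by (auto simp: trivial_upset_def upset_def)
  from \<sigma> obtain k where k: "k \<le> n" "k \<notin> \<sigma> ` {..m}"
    by (auto simp: surj_maps_def mono_maps_def)
  have 0: "?L 1 = {..m}" if "k = 0" using k that by (auto simp: level_def Suc_le_eq neq0_conv intro!: gr0I)
  have top: "?L n = {}" if "k = n"
    using k that \<sigma>(1) by (force simp: level_def mono_maps_def)
  have mid: "?L k = ?L (Suc k)"
    using k by (auto simp: level_def Suc_le_eq le_less)
  from n show ?thesis
  proof
    assume n2: "n = 2"
    then consider "k = 0" | "k = 1" | "k = 2" using k by linarith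
    then show ?thesis
    proof cases
      case 1
      then show ?thesis using 0 n2 u G[of "[?L 1, ?L 2]" 0] G[of "[?L 2, ?L 1]" 1] triv by (simp add: levels_2)
    next
      case 2
      then have "?L 2 = ?L 1" using mid by (simp add: numeral_2_eq_2)
      then show ?thesis using n2 by (simp add: levels_2)
    next
      case 3
      then show ?thesis using top n2 u G[of "[?L 1, ?L 2]" 1] G[of "[?L 2, ?L 1]" 0] triv by (simp add: levels_2)
    qed
  next
    assume n3: "n = 3"
    then consider "k = 0" | "k = 1" | "k = 2" | "k = 3" using k by linarith
    then show ?thesis
    proof cases
      case 1
      have "G [?L 1, b, c] = 0" "G [b, ?L 1, c] = 0" "G [b, c, ?L 1] = 0" if "upset m b" "upset m c" for b c
        using 0 1 n3 u that triv G[of "[?L 1, b, c]" 0] G[of "[b, ?L 1, c]" 1] G[of "[b, c, ?L 1]" 2] by simp_all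
      then show ?thesis using n3 u by (simp add: levels_3)
    next
      case 2
      then show ?thesis using mid n3 by (simp add: levels_3 numeral_2_eq_2)
    next
      case 3
      then show ?thesis using mid n3 by (simp add: levels_3)
    next
      case 4
      have "G [?L 3, b, c] = 0" "G [b, ?L 3, c] = 0" "G [b, c, ?L 3] = 0" if "upset m b" "upset m c" for b c
        using top 4 n3 u that triv G[of "[?L 3, b, c]" 0] G[of "[b, ?L 3, c]" 1] G[of "[b, c, ?L 3]" 2] by simp_all
      then show ?thesis using n3 u by (simp add: levels_3)
    qed
  qed
qed

lemma stair_levels:
  assumes "\<sigma> \<in> surj_maps n m"
  shows "stair m (levels n m \<sigma>) = \<sigma>"
proof
  fix x
  have "\<sigma> x \<le> n" if "x \<le> m" using assms that by (auto simp: surj_maps_def)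
  then show "stair m (levels n m \<sigma>) x = \<sigma> x"
    using assms n by (auto simp: stair_def levels_2 levels_3 level_def surj_maps_def extensional_def)
qed

text \<open>The retraction splits the embedding. The levels decrease, so every order but the given
  one has an ascent and its stair is not onto, while the given order has stair \<sigma>.\<close>

lemma alt_stair_levels:
  fixes f :: "(nat \<Rightarrow> nat) \<Rightarrow> bipoly"
  assumes f: "\<And>\<rho>. \<rho> \<notin> surj_maps n m \<Longrightarrow> f \<rho> = 0" and \<sigma>: "\<sigma> \<in> mono_maps n m"
  shows "alt (\<lambda>v. f (stair m v)) (levels n m \<sigma>) = f \<sigma>"
proof (cases "\<sigma> \<in> surj_maps n m")
  case False
  have "alt (\<lambda>v. f (stair m v)) (levels n m \<sigma>) = 0"
    using \<sigma> False f stair_trivial_not_surj by (intro alt_levels_not_surj) blast+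
  then show ?thesis using f False by simp
next
  case True
  have z: "f (stair m v) = 0" if "length v = n" "Suc i < n" "v ! i \<subseteq> v ! Suc i" for v i
    using stair_ascent_not_surj[of i v m] that f by auto
  from n show ?thesis
  proof
    assume n2: "n = 2"
    then have "f (stair m [level m \<sigma> 2, level m \<sigma> 1]) = 0"
      by (intro z[of _ 0]) (auto simp: level_def)
    then show ?thesis using n2 stair_levels[OF True] by (simp add: levels_2)
  next
    assume n3: "n = 3"
    have "f (stair m [level m \<sigma> 2, level m \<sigma> 1, A]) = 0" "f (stair m [level m \<sigma> 3, level m \<sigma> 1, A]) = 0"
      "f (stair m [level m \<sigma> 3, level m \<sigma> 2, A]) = 0" for A
      using n3 by (auto intro!: z[of _ 0] simp: level_def)
    moreover have "f (stair m [A, level m \<sigma> 3, level m \<sigma> 1]) = 0" "f (stair m [A, level m \<sigma> 3, level m \<sigma> 2]) = 0" for A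
      using n3 by (auto intro!: z[of _ 1] simp: level_def)
    ultimately show ?thesis using n3 stair_levels[OF True] by (simp add: levels_3)
  qed
qed

lemma alt_zero: "(\<And>v. F v = 0) \<Longrightarrow> alt F L = 0"
  by (cases "(F, L)" rule: alt.cases) simp_all

lemma alt_mult_left: "alt (\<lambda>v. (c :: 'b::ring_1) * F v) L = c * alt F L"
  by (cases "(F, L)" rule: alt.cases) (simp_all add: algebra_simps)

lemma alt_mult_right: "alt (\<lambda>v. F v * (c :: 'b::ring_1)) L = alt F L * c"
  by (cases "(F, L)" rule: alt.cases) (simp_all add: algebra_simps)

lemma alt_diff: "alt (\<lambda>v. F v - G v) L = alt F L - alt G L"
  by (cases "(F, L)" rule: alt.cases) (simp_all add: algebra_simps)

lemma interchange_htpy_empty: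
  assumes "\<sigma> \<in> mono_maps n m" "\<tau> \<in> mono_maps n m"
  shows "interchange_htpy n m {} \<sigma> \<tau> = 0"
proof -
  have "interchange_htpy n m {} \<sigma> \<tau> = alt (\<lambda>v. alt (\<lambda>w. 0) (levels n m \<tau>)) (levels n m \<sigma>)"
    unfolding interchange_htpy_def
    by (intro alt_levels_cong assms word_htpy_empty) (auto simp: block_swap_bound)
  then show ?thesis by (simp add: alt_zero)
qed

lemma interchange_htpy_top:
  assumes \<sigma>: "\<sigma> \<in> mono_maps n m" and \<tau>: "\<tau> \<in> mono_maps n m"
  shows "interchange_htpy n m {..m} \<sigma> \<tau> = xvar n m \<sigma> * yvar n m \<tau> - (-1) ^ n * (xvar n m \<tau> * yvar n m \<sigma>)"
proof -
  let ?x = "\<lambda>v. xvar n m (stair m v)" and ?y = "\<lambda>v. yvar n m (stair m v)"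
  have "interchange_htpy n m {..m} \<sigma> \<tau>
    = alt (\<lambda>v. alt (\<lambda>w. ?x v * ?y w - (-1) ^ n * ?y v * ?x w) (levels n m \<tau>)) (levels n m \<sigma>)"
    unfolding interchange_htpy_def
  proof (intro alt_levels_cong \<sigma> \<tau>)
    fix v w :: "nat set list"
    assume vw: "length v = n" "\<forall>U\<in>set v. upset m U" "length w = n" "\<forall>U\<in>set w. upset m U"
    then have "word_htpy n m {..m} (block_swap n) (v @ w)
      = xytens n m (v @ w) - (-1) ^ n * xytens n m (w @ v)"
      using word_htpy_top[of "v @ w" n "block_swap n" m] block_swap_bound
      by (auto simp: length_block_swap fold_block_swap)
    then show "word_htpy n m {..m} (block_swap n) (v @ w) = ?x v * ?y w - (-1) ^ n * ?y v * ?x w"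
      using vw by (simp add: xytens_def mult_ac)
  qed
  \<comment> \<open>Each of the two terms is a function of v times a function of w, so the two
    alternations act on separate factors.\<close>
  also have "\<dots> = alt ?x (levels n m \<sigma>) * alt ?y (levels n m \<tau>) - (-1) ^ n * alt ?y (levels n m \<sigma>) * alt ?x (levels n m \<tau>)"
    by (simp add: alt_diff alt_mult_left alt_mult_right)
  also have "\<dots> = xvar n m \<sigma> * yvar n m \<tau> - (-1) ^ n * yvar n m \<sigma> * xvar n m \<tau>"
  proof -
    have "xvar n m \<rho> = 0" "yvar n m \<rho> = 0" if "\<rho> \<notin> surj_maps n m" for \<rho>
      using that by (simp_all add: xvar_def yvar_def)
    then show ?thesis
      using alt_stair_levels[of m "xvar n m"] alt_stair_levels[of m "yvar n m"] \<sigma> \<tau> by simp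
  qed
  finally show ?thesis by (simp add: mult_ac)
qed

text \<open>A trivial entry stays trivial for the homotopy of the whole word, whichever block
  contains it, so \<open>alt_levels_not_surj\<close> applies to either argument. It is needed for
  every \<chi> because operators can turn basis elements into maps that are not onto.\<close>

lemma interchange_htpy_not_surj:
  assumes \<sigma>: "\<sigma> \<in> mono_maps n m" and \<tau>: "\<tau> \<in> mono_maps n m" and \<chi>: "upset m \<chi>"
    and ns: "\<not> (\<sigma> \<in> surj_maps n m \<and> \<tau> \<in> surj_maps n m)"
  shows "interchange_htpy n m \<chi> \<sigma> \<tau> = 0"
proof -
  have b: "\<forall>k\<in>set (block_swap n). Suc k < 2 * n" using block_swap_bound by auto
  have w1: "word_htpy n m \<chi> (block_swap n) (v @ w) = 0"
    if "length v = n" "\<forall>U\<in>set v. upset m U" "length w = n" "\<forall>U\<in>set w. upset m U" "i < n" "trivial_upset m (v ! i)" for v w i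
    using that \<chi> b by (intro word_htpy_trivial[of _ _ _ _ _ i]) (auto simp: nth_append)
  have w2: "word_htpy n m \<chi> (block_swap n) (v @ w) = 0"
    if "length v = n" "\<forall>U\<in>set v. upset m U" "length w = n" "\<forall>U\<in>set w. upset m U" "i < n" "trivial_upset m (w ! i)" for v w i
    using that \<chi> b by (intro word_htpy_trivial[of _ _ _ _ _ "n + i"]) (auto simp: nth_append)
  show ?thesis
  proof (cases "\<sigma> \<in> surj_maps n m")
    case False
    have "alt (\<lambda>w. word_htpy n m \<chi> (block_swap n) (v @ w)) (levels n m \<tau>) = 0"
      if "length v = n" "\<forall>U\<in>set v. upset m U" "i < n" "trivial_upset m (v ! i)" for v i
    proof -
      have "alt (\<lambda>w. word_htpy n m \<chi> (block_swap n) (v @ w)) (levels n m \<tau>) = alt (\<lambda>w. 0) (levels n m \<tau>)"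
        using that by (intro alt_levels_cong \<tau> w1[of v _ i])
      then show ?thesis by (simp add: alt_zero)
    qed
    then show ?thesis unfolding interchange_htpy_def by (rule alt_levels_not_surj[OF \<sigma> False])
  next
    case True
    then have t: "\<tau> \<notin> surj_maps n m" using ns by simp
    have "interchange_htpy n m \<chi> \<sigma> \<tau> = alt (\<lambda>v. 0) (levels n m \<sigma>)"
      unfolding interchange_htpy_def
      by (intro alt_levels_cong[OF \<sigma>] alt_levels_not_surj[OF \<tau> t] w2)
    then show ?thesis by (simp add: alt_zero)
  qed
qed

lemma act_alt: "act n m m' \<theta> (alt G L) = alt (\<lambda>v. act n m m' \<theta> (G v)) L"
  by (cases "(G, L)" rule: alt.cases) (simp_all add: act_diff act_add)

lemma alt_map: "alt G (map f L) = alt (\<lambda>v. G (map f v)) L"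
  by (cases "(\<lambda>v. G (map f v), L)" rule: alt.cases) simp_all

text \<open>Levels, intersections, swaps and stairs all commute with taking preimages, so the
  homotopy is natural in simplex and up-set together.\<close>

lemma act_interchange_htpy:
  assumes \<theta>: "simp_op m m' \<theta>" and \<sigma>: "\<sigma> \<in> mono_maps n m" and \<tau>: "\<tau> \<in> mono_maps n m" and \<chi>: "upset m \<chi>"
  shows "act n m m' \<theta> (interchange_htpy n m \<chi> \<sigma> \<tau>)
    = interchange_htpy n m' (preim m' \<theta> \<chi>) (pull m' \<theta> \<sigma>) (pull m' \<theta> \<tau>)"
proof -
  have b: "\<forall>k\<in>set (block_swap n). Suc k < 2 * n" using block_swap_bound by auto
  have "act n m m' \<theta> (interchange_htpy n m \<chi> \<sigma> \<tau>) =
    alt (\<lambda>v. alt (\<lambda>w. act n m m' \<theta> (word_htpy n m \<chi> (block_swap n) (v @ w))) (levels n m \<tau>)) (levels n m \<sigma>)"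
    by (simp add: interchange_htpy_def act_alt)
  also have "\<dots> = alt (\<lambda>v. alt (\<lambda>w. word_htpy n m' (preim m' \<theta> \<chi>) (block_swap n)
      (map (preim m' \<theta>) v @ map (preim m' \<theta>) w)) (levels n m \<tau>)) (levels n m \<sigma>)"
    using \<chi> by (intro alt_levels_cong \<sigma> \<tau>) (subst act_word_htpy[OF \<theta> _ b]; auto)
  also have "\<dots> = interchange_htpy n m' (preim m' \<theta> \<chi>) (pull m' \<theta> \<sigma>) (pull m' \<theta> \<tau>)"
    unfolding interchange_htpy_def map_preim_levels[OF \<theta>, symmetric] alt_map ..
  finally show ?thesis .
qed

end

section \<open>Transport along the prism operator\<close>

lemma sum_mset_const_diff:
  "(\<Sum>a\<in>#A. c - b * f a) = of_nat (size A) * c - b * (\<Sum>a\<in>#A. f a)" for b c :: "'b::comm_ring_1"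
  by (induction A) (auto simp: algebra_simps)

text \<open>The extension of B to monomials as a biderivation: one x variable and one y variable are
  traded for B in all ways, counted with multiplicity.\<close>

definition biderivation_terms ::
    "nat \<Rightarrow> nat \<Rightarrow> ((nat \<Rightarrow> nat) \<Rightarrow> (nat \<Rightarrow> nat) \<Rightarrow> bipoly)
      \<Rightarrow> (nat \<Rightarrow> nat) multiset \<Rightarrow> (nat \<Rightarrow> nat) multiset \<Rightarrow> bipoly" where
  "biderivation_terms n m B M N =
     (\<Sum>\<sigma>\<in>#M. \<Sum>\<tau>\<in>#N. monom_xy n m (M - {#\<sigma>#}) (N - {#\<tau>#}) * B \<sigma> \<tau>)"

text \<open>D m - 1 on S^k tensor S^1 is the sum, over the k factors on the left, of the interchange
  with the factor on the right; the homotopy is the corresponding sum of interchange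
  homotopies.\<close>

definition hook_htpy :: "nat \<Rightarrow> nat \<Rightarrow> nat set \<Rightarrow> bipoly \<Rightarrow> bipoly" where
  "hook_htpy n m \<chi> = frag_extend (\<lambda>(M, N).
     if set_mset M \<subseteq> surj_maps n m \<and> set_mset N \<subseteq> surj_maps n m
     then biderivation_terms n m (interchange_htpy n m \<chi>) M N else 0)"

lemma hook_htpy_diff: "hook_htpy n m \<chi> (u - v) = hook_htpy n m \<chi> u - hook_htpy n m \<chi> v"
  and hook_htpy_add: "hook_htpy n m \<chi> (u + v) = hook_htpy n m \<chi> u + hook_htpy n m \<chi> v"
  and hook_htpy_0 [simp]: "hook_htpy n m \<chi> 0 = 0"
  and hook_htpy_minus: "hook_htpy n m \<chi> (- u) = - hook_htpy n m \<chi> u"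
  by (simp_all add: hook_htpy_def frag_extend_diff frag_extend_add frag_extend_minus)

lemma hook_htpy_sum: "hook_htpy n m \<chi> (sum g A) = (\<Sum>a\<in>A. hook_htpy n m \<chi> (g a))"
  by (induction A rule: infinite_finite_induct) (auto simp: hook_htpy_add)

lemma hook_htpy_power_minus_one: "hook_htpy n m \<chi> ((-1) ^ i * u) = (-1) ^ i * hook_htpy n m \<chi> u"
  by (cases "even i") (auto simp: hook_htpy_minus)

context
  fixes n :: nat
  assumes n: "n = 2 \<or> n = 3"
begin

text \<open>A map that is not onto either stays in the leftover monomial or is fed to the
  interchange homotopy, and in both cases the product is 0.\<close>

lemma biderivation_terms_not_surj:
  assumes M: "set_mset M \<subseteq> mono_maps n m" and N: "set_mset N \<subseteq> mono_maps n m" and \<chi>: "upset m \<chi>"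
    and ns: "\<not> (set_mset M \<subseteq> surj_maps n m \<and> set_mset N \<subseteq> surj_maps n m)"
  shows "biderivation_terms n m (interchange_htpy n m \<chi>) M N = 0"
proof -
  have "monom_xy n m (M - {#\<sigma>#}) (N - {#\<tau>#}) * interchange_htpy n m \<chi> \<sigma> \<tau> = 0"
    if st: "\<sigma> \<in># M" "\<tau> \<in># N" for \<sigma> \<tau>
  proof (cases "\<sigma> \<in> surj_maps n m \<and> \<tau> \<in> surj_maps n m")
    case True
    have "\<not> (set_mset (M - {#\<sigma>#}) \<subseteq> surj_maps n m \<and> set_mset (N - {#\<tau>#}) \<subseteq> surj_maps n m)"
      using ns st True by (metis insert_DiffM insert_subset set_mset_add_mset_insert)
    then show ?thesis by (simp add: monom_not_surj)
  next
    case False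
    then show ?thesis using interchange_htpy_not_surj[OF n subsetD[OF M st(1)] subsetD[OF N st(2)] \<chi>] by simp
  qed
  then have "image_mset (\<lambda>\<sigma>. \<Sum>\<tau>\<in>#N. monom_xy n m (M - {#\<sigma>#}) (N - {#\<tau>#}) * interchange_htpy n m \<chi> \<sigma> \<tau>) M
      = image_mset (\<lambda>\<sigma>. 0) M"
    by (intro image_mset_cong) (simp cong: image_mset_cong)
  then show ?thesis by (simp add: biderivation_terms_def)
qed

lemma hook_htpy_monom:
  assumes "set_mset M \<subseteq> mono_maps n m" "set_mset N \<subseteq> mono_maps n m" "upset m \<chi>"
  shows "hook_htpy n m \<chi> (monom_xy n m M N) = biderivation_terms n m (interchange_htpy n m \<chi>) M N"
  using biderivation_terms_not_surj[OF assms] monom_surj[of M n m N] monom_not_surj[of M n m N]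
  by (cases "set_mset M \<subseteq> surj_maps n m \<and> set_mset N \<subseteq> surj_maps n m") (auto simp: hook_htpy_def)

lemma act_biderivation_terms:
  assumes \<theta>: "simp_op m m' \<theta>" and M: "set_mset M \<subseteq> mono_maps n m" and N: "set_mset N \<subseteq> mono_maps n m"
    and \<chi>: "upset m \<chi>"
  shows "act n m m' \<theta> (biderivation_terms n m (interchange_htpy n m \<chi>) M N)
    = biderivation_terms n m' (interchange_htpy n m' (preim m' \<theta> \<chi>))
        (image_mset (pull m' \<theta>) M) (image_mset (pull m' \<theta>) N)"
proof -
  let ?p = "pull m' \<theta>"
  have "act n m m' \<theta> (monom_xy n m (M - {#\<sigma>#}) (N - {#\<tau>#}) * interchange_htpy n m \<chi> \<sigma> \<tau>)
     = monom_xy n m' (image_mset ?p M - {#?p \<sigma>#}) (image_mset ?p N - {#?p \<tau>#})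
        * interchange_htpy n m' (preim m' \<theta> \<chi>) (?p \<sigma>) (?p \<tau>)" if "\<sigma> \<in># M" "\<tau> \<in># N" for \<sigma> \<tau>
  proof -
    have sub: "set_mset (M - {#\<sigma>#}) \<subseteq> mono_maps n m" "set_mset (N - {#\<tau>#}) \<subseteq> mono_maps n m"
      using M N by (auto dest: in_diffD)
    have img: "image_mset ?p (M - {#\<sigma>#}) = image_mset ?p M - {#?p \<sigma>#}"
      "image_mset ?p (N - {#\<tau>#}) = image_mset ?p N - {#?p \<tau>#}"
      using that image_mset_Diff[of "{#\<sigma>#}" M ?p] image_mset_Diff[of "{#\<tau>#}" N ?p] by auto
    have "\<sigma> \<in> mono_maps n m" "\<tau> \<in> mono_maps n m" using that M N by auto
    then show ?thesis
      by (simp add: act_mult act_interchange_htpy[OF n \<theta> _ _ \<chi>] act_monom[OF \<theta> sub] img)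
  qed
  then show ?thesis
    by (simp add: biderivation_terms_def act_sum_mset image_mset.compositionality o_def cong: image_mset_cong)
qed

text \<open>Since up-sets are the simplices of the interval, this makes \<open>hook_htpy\<close> a
  simplicial map on the product with the interval, running from 0 (\<open>hook_htpy_empty\<close>)
  to the map in \<open>hook_htpy_top\<close>.\<close>

lemma act_hook_htpy:
  assumes \<theta>: "simp_op m m' \<theta>" and \<chi>: "upset m \<chi>"
  shows "act n m m' \<theta> (hook_htpy n m \<chi> z) = hook_htpy n m' (preim m' \<theta> \<chi>) (act n m m' \<theta> z)"
  using subset_UNIV[of "Poly_Mapping.keys z"]
proof (induction z rule: frag_induction)
  case (one x)
  obtain M N where x: "x = (M, N)" by (cases x)
  show ?case
  proof (cases "set_mset M \<subseteq> surj_maps n m \<and> set_mset N \<subseteq> surj_maps n m")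
    case True
    then have mm: "set_mset M \<subseteq> mono_maps n m" "set_mset N \<subseteq> mono_maps n m"
      using surj_maps_subset by blast+
    have mono: "monom_xy n m M N = frag_of x" using True by (simp add: monom_surj x)
    have img: "set_mset (image_mset (pull m' \<theta>) M) \<subseteq> mono_maps n m'"
      "set_mset (image_mset (pull m' \<theta>) N) \<subseteq> mono_maps n m'"
      using mm pull_mono_maps[OF \<theta>] by auto
    show ?thesis
      unfolding mono[symmetric] hook_htpy_monom[OF mm \<chi>] act_monom[OF \<theta> mm]
        act_biderivation_terms[OF \<theta> mm \<chi>] hook_htpy_monom[OF img upset_preim[OF \<theta> \<chi>]] ..
  next
    case False
    have "act n m m' \<theta> (frag_of (M, N)) = 0"
    proof -
      from False obtain \<rho> where "\<rho> \<notin> surj_maps n m" "\<rho> \<in># M \<or> \<rho> \<in># N" by auto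
      then show ?thesis by (auto simp: act_def dest!: multi_member_split)
    qed
    then show ?thesis using False by (auto simp: x hook_htpy_def)
  qed
qed (auto simp: act_diff hook_htpy_diff)

lemma hook_htpy_empty: "hook_htpy n m {} z = 0"
  using subset_UNIV[of "Poly_Mapping.keys z"]
proof (induction z rule: frag_induction)
  case (one x)
  obtain M N where x: "x = (M, N)" by (cases x)
  have "biderivation_terms n m (interchange_htpy n m {}) M N = 0"
    if "set_mset M \<subseteq> surj_maps n m" "set_mset N \<subseteq> surj_maps n m"
  proof -
    have "interchange_htpy n m {} \<sigma> \<tau> = 0" if "\<sigma> \<in># M" "\<tau> \<in># N" for \<sigma> \<tau>
      using that \<open>set_mset M \<subseteq> _\<close> \<open>set_mset N \<subseteq> _\<close> surj_maps_subset by (intro interchange_htpy_empty[OF n]) blast+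
    then show ?thesis by (simp add: biderivation_terms_def cong: image_mset_cong)
  qed
  then show ?case by (simp add: x hook_htpy_def)
qed (auto simp: hook_htpy_diff)

text \<open>The sum on the right is D m - 1 on this monomial: D m splits off each variable of M and
  \<tau> in turn, and splitting off \<tau> returns the monomial itself.\<close>

lemma hook_htpy_top:
  assumes M: "set_mset M \<subseteq> surj_maps n m" and t: "\<tau> \<in> surj_maps n m"
  shows "hook_htpy n m {..m} (frag_of (M, {#\<tau>#}))
    = of_nat (size M) * frag_of (M, {#\<tau>#}) - (-1) ^ n * (\<Sum>\<sigma>\<in>#M. frag_of (add_mset \<tau> (M - {#\<sigma>#}), {#\<sigma>#}))"
proof -
  have "monom_xy n m (M - {#\<sigma>#}) {#} * interchange_htpy n m {..m} \<sigma> \<tau>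
      = frag_of (M, {#\<tau>#}) - (-1) ^ n * frag_of (add_mset \<tau> (M - {#\<sigma>#}), {#\<sigma>#})" if s: "\<sigma> \<in># M" for \<sigma>
  proof -
    have sub: "set_mset (M - {#\<sigma>#}) \<subseteq> surj_maps n m" using M by (auto dest: in_diffD)
    have sM: "\<sigma> \<in> surj_maps n m" using M s by auto
    have mm: "\<sigma> \<in> mono_maps n m" "\<tau> \<in> mono_maps n m" using sM t surj_maps_subset by blast+
    have e: "monom_xy n m (M - {#\<sigma>#}) {#} * (xvar n m \<alpha> * yvar n m \<beta>) = frag_of (add_mset \<alpha> (M - {#\<sigma>#}), {#\<beta>#})"
      if "\<alpha> \<in> surj_maps n m" "\<beta> \<in> surj_maps n m" for \<alpha> \<beta>
      using that sub by (simp add: monom_surj xvar_def yvar_def frag_of_pair_mult)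
    show ?thesis
      unfolding interchange_htpy_top[OF n mm] right_diff_distrib mult.left_commute[of _ "(-1) ^ n"]
        e[OF sM t] e[OF t sM] using s by simp
  qed
  then have "hook_htpy n m {..m} (frag_of (M, {#\<tau>#}))
    = (\<Sum>\<sigma>\<in>#M. frag_of (M, {#\<tau>#}) - (-1) ^ n * frag_of (add_mset \<tau> (M - {#\<sigma>#}), {#\<sigma>#}))"
    using M t by (simp add: hook_htpy_def biderivation_terms_def cong: image_mset_cong)
  also have "\<dots> = of_nat (size M) * frag_of (M, {#\<tau>#}) - (-1) ^ n * (\<Sum>\<sigma>\<in>#M. frag_of (add_mset \<tau> (M - {#\<sigma>#}), {#\<sigma>#}))"
    by (rule sum_mset_const_diff)
  finally show ?thesis .
qed

end

section \<open>The prism operator\<close>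

lemma alternating_prism_sum:
  fixes t :: "nat \<Rightarrow> nat \<Rightarrow> 'a::ab_group_add"
  assumes less: "\<And>i j. i \<le> q \<Longrightarrow> j < i \<Longrightarrow> t i j = g (i - 1) j"
    and diag: "\<And>i. i \<le> q \<Longrightarrow> t i i = u i" "\<And>i. i \<le> q \<Longrightarrow> t i (Suc i) = - u (Suc i)"
    and greater: "\<And>i j. i \<le> q \<Longrightarrow> Suc i < j \<Longrightarrow> j \<le> Suc q \<Longrightarrow> t i j = g i (j - 1)"
  shows "(\<Sum>i\<le>q. \<Sum>j\<le>Suc q. t i j) = u 0 - u (Suc q) + (\<Sum>k<q. \<Sum>l\<le>q. g k l)"
proof -
  \<comment> \<open>Row i is cut at its two diagonal entries j = i and j = i + 1, whose values
    telescope when summed over i.\<close>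
  have row: "(\<Sum>j\<le>Suc q. t i j) = (\<Sum>j<i. g (i - 1) j) + (u i - u (Suc i)) + (\<Sum>l\<in>{i<..q}. g i l)" if i: "i \<le> q" for i
  proof -
    have "{..Suc q} = {..<i} \<union> ({i, Suc i} \<union> {Suc i<..Suc q})" using i by auto
    then have "(\<Sum>j\<le>Suc q. t i j) = (\<Sum>j<i. t i j) + ((\<Sum>j\<in>{i, Suc i}. t i j) + (\<Sum>j\<in>{Suc i<..Suc q}. t i j))"
      by (simp only:) (subst sum.union_disjoint; auto)+
    also have "(\<Sum>j\<in>{Suc i<..Suc q}. t i j) = (\<Sum>l\<in>{i<..q}. g i l)"
      using i greater by (intro sum.reindex_bij_witness[of _ Suc "\<lambda>j. j - 1"]) auto
    finally show ?thesis using i less diag by (simp add: algebra_simps)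
  qed
  have "(\<Sum>i\<le>q. \<Sum>j\<le>Suc q. t i j) = (\<Sum>i\<le>q. \<Sum>j<i. g (i - 1) j) + (\<Sum>i\<le>q. u i - u (Suc i)) + (\<Sum>i\<le>q. \<Sum>l\<in>{i<..q}. g i l)"
    by (simp add: row sum.distrib del: sum.atMost_Suc)
  also have "(\<Sum>i\<le>q. u i - u (Suc i)) = u 0 - u (Suc q)"
    by (rule sum_telescope)
  also have "(\<Sum>i\<le>q. \<Sum>j<i. g (i - 1) j) = (\<Sum>k<q. \<Sum>j\<le>k. g k j)"
    by (cases q) (simp_all add: sum.atMost_Suc_shift lessThan_Suc_atMost del: sum.atMost_Suc)
  also have "(\<Sum>i\<le>q. \<Sum>l\<in>{i<..q}. g i l) = (\<Sum>k<q. \<Sum>l\<in>{k<..q}. g k l)"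
    by (intro sum.mono_neutral_right) auto
  finally have "(\<Sum>i\<le>q. \<Sum>j\<le>Suc q. t i j)
      = u 0 - u (Suc q) + ((\<Sum>k<q. \<Sum>j\<le>k. g k j) + (\<Sum>k<q. \<Sum>l\<in>{k<..q}. g k l))" by simp
  \<comment> \<open>What lies below the diagonal in row k + 1 and what lies above it in row k fit
    together to the full k-th row of g.\<close>
  also have "(\<Sum>k<q. \<Sum>j\<le>k. g k j) + (\<Sum>k<q. \<Sum>l\<in>{k<..q}. g k l) = (\<Sum>k<q. \<Sum>l\<le>q. g k l)"
    unfolding sum.distrib[symmetric]
  proof (intro sum.cong refl)
    fix k assume "k \<in> {..<q}"
    then have "{..q} = {..k} \<union> {k<..q}" by auto
    then show "(\<Sum>j\<le>k. g k j) + (\<Sum>l\<in>{k<..q}. g k l) = (\<Sum>l\<le>q. g k l)"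
      by (simp only:) (subst sum.union_disjoint; auto)
  qed
  finally show ?thesis .
qed

definition codegen :: "nat \<Rightarrow> nat \<Rightarrow> nat" where
  "codegen i j = (if j \<le> i then j else j - 1)"

lemma simp_op_coface: "j \<le> Suc q \<Longrightarrow> simp_op (Suc q) q (coface j)"
  by (auto simp: simp_op_def coface_def monotone_on_def)

lemma simp_op_codegen: "i \<le> q \<Longrightarrow> simp_op q (Suc q) (codegen i)"
  by (auto simp: simp_op_def codegen_def monotone_on_def)

text \<open>The boundary of the prism over z is the homotopy at the full up-set, minus its value at
  the empty one, minus the prism over the boundary of z. The second is 0, and so is the third
  because z is a cycle. The assumption \<open>id\<close> says that z involves only basis
  variables.\<close>

lemma prism_boundary:
  assumes n: "n = 2 \<or> n = 3"
    and z: "0 < q \<Longrightarrow> (\<Sum>j\<le>q. (-1) ^ j * act n q (q - 1) (coface j) z) = 0"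
    and id: "act n q q (\<lambda>j. j) z = z"
  shows "\<exists>w. (\<Sum>j\<le>Suc q. (-1) ^ j * act n (Suc q) q (coface j) w) = hook_htpy n q {..q} z"
proof
  let ?s = "\<lambda>i. act n q (Suc q) (codegen i)" and ?d = "\<lambda>j. act n (Suc q) q (coface j)"
  \<comment> \<open>The i-th simplex of the prism is the i-th degeneracy of z together with the
    simplex of the interval that jumps from 0 to 1 after vertex i.\<close>
  let ?P = "\<Sum>i\<le>q. (-1) ^ i * hook_htpy n (Suc q) {i<..Suc q} (?s i z)"
  define t where "t = (\<lambda>i j. (-1) ^ j * ((-1) ^ i * ?d j (hook_htpy n (Suc q) {i<..Suc q} (?s i z))))"
  \<comment> \<open>Up to sign, u i is the i-th face shared by prism simplices i - 1 and i; u 0 and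
    u (Suc q) belong to the two ends of the interval.\<close>
  define u where "u = (\<lambda>i. hook_htpy n q {i..q} z)"
  define g where "g = (\<lambda>k l. - ((-1) ^ k * hook_htpy n q {k<..q}
      (act n (q - 1) q (codegen k) ((-1) ^ l * act n q (q - 1) (coface l) z))))"
  have up: "upset (Suc q) {i<..Suc q}" for i by (auto simp: upset_def)
  have t: "t i j = (-1) ^ j * ((-1) ^ i * hook_htpy n q (preim q (coface j) {i<..Suc q}) (act n q q (codegen i \<circ> coface j) z))"
    if "i \<le> q" "j \<le> Suc q" for i j
    unfolding t_def act_hook_htpy[OF n simp_op_coface[OF that(2)] up]
      act_comp[OF simp_op_codegen[OF that(1)] simp_op_coface[OF that(2)]] ..
  have "(\<Sum>j\<le>Suc q. (-1) ^ j * ?d j ?P) = (\<Sum>j\<le>Suc q. \<Sum>i\<le>q. t i j)"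
    by (simp only: act_sum act_power_minus_one sum_distrib_left t_def)
  also have "\<dots> = (\<Sum>i\<le>q. \<Sum>j\<le>Suc q. t i j)" by (rule sum.swap)
  also have "\<dots> = u 0 - u (Suc q) + (\<Sum>k<q. \<Sum>l\<le>q. g k l)"
  proof (rule alternating_prism_sum[where t = t and u = u and g = g])
    fix i j assume ij: "i \<le> q" "j < i"
    have "preim q (coface j) {i<..Suc q} = {i - 1<..q}"
      using ij by (auto simp: preim_def coface_def)
    moreover have "act n q q (codegen i \<circ> coface j) z = act n (q - 1) q (codegen (i - 1)) (act n q (q - 1) (coface j) z)"
    proof -
      obtain r where r: "q = Suc r" using ij by (cases q) auto
      have "act n q q (codegen i \<circ> coface j) = act n q q (coface j \<circ> codegen (i - 1))"
        using ij by (intro act_cong) (auto simp: codegen_def coface_def)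
      then show ?thesis
        using act_comp[OF simp_op_coface[of j r] simp_op_codegen[of "i - 1" r]] ij r by simp
    qed
    ultimately show "t i j = g (i - 1) j"
      using ij by (cases i) (simp_all add: t g_def act_power_minus_one hook_htpy_power_minus_one mult_ac)
  next
    fix i assume i: "i \<le> q"
    have "preim q (coface i) {i<..Suc q} = {i..q}"
      using i by (auto simp: preim_def coface_def)
    moreover have "act n q q (codegen i \<circ> coface i) = act n q q (\<lambda>j. j)"
      by (intro act_cong) (auto simp: codegen_def coface_def)
    ultimately show "t i i = u i"
      using i id by (simp add: t u_def mult.assoc[symmetric] flip: power_add mult_2)
    have "preim q (coface (Suc i)) {i<..Suc q} = {Suc i..q}"
      using i by (auto simp: preim_def coface_def)
    moreover have "act n q q (codegen i \<circ> coface (Suc i)) = act n q q (\<lambda>j. j)"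
      by (intro act_cong) (auto simp: codegen_def coface_def)
    ultimately show "t i (Suc i) = - u (Suc i)"
      using i id by (simp add: t u_def mult.assoc[symmetric] flip: power_add mult_2)
  next
    fix i j assume ij: "i \<le> q" "Suc i < j" "j \<le> Suc q"
    have "preim q (coface j) {i<..Suc q} = {i<..q}"
      using ij by (auto simp: preim_def coface_def)
    moreover have "act n q q (codegen i \<circ> coface j) z = act n (q - 1) q (codegen i) (act n q (q - 1) (coface (j - 1)) z)"
    proof -
      obtain r where r: "q = Suc r" using ij by (cases q) auto
      have "act n q q (codegen i \<circ> coface j) = act n q q (coface (j - 1) \<circ> codegen i)"
        using ij by (intro act_cong) (auto simp: codegen_def coface_def)
      then show ?thesis
        using act_comp[OF simp_op_coface[of "j - 1" r] simp_op_codegen[of i r]] ij r by simp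
    qed
    ultimately show "t i j = g i (j - 1)"
      using ij by (cases j) (simp_all add: t g_def act_power_minus_one hook_htpy_power_minus_one mult_ac)
  qed
  also have "(\<Sum>k<q. \<Sum>l\<le>q. g k l) = 0"
  proof (rule sum.neutral, rule ballI)
    fix k assume "k \<in> {..<q}"
    then have "0 < q" by auto
    have "(\<Sum>l\<le>q. g k l) = - ((-1) ^ k * hook_htpy n q {k<..q} (act n (q - 1) q (codegen k)
        (\<Sum>l\<le>q. (-1) ^ l * act n q (q - 1) (coface l) z)))"
      by (simp only: g_def act_sum hook_htpy_sum sum_distrib_left sum_negf)
    then show "(\<Sum>l\<le>q. g k l) = 0" using z[OF \<open>0 < q\<close>] by simp
  qed
  also have "u 0 - u (Suc q) + 0 = hook_htpy n q {..q} z"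
    by (simp add: u_def hook_htpy_empty[OF n] atLeast0AtMost)
  finally show "(\<Sum>j\<le>Suc q. (-1) ^ j * ?d j ?P) = hook_htpy n q {..q} z" .
qed

section \<open>The simplicial groups \<open>K(n)\<close>\<close>

lemma finprod_integer_group:
  assumes "finite A"
  shows "finprod integer_group f A = sum f A"
  using assms
proof (induction A rule: finite_induct)
  case empty
  show ?case
    using comm_monoid.finprod_empty[OF comm_group.axioms(1)[OF abelian_integer_group]] by simp
next
  case (insert a A)
  then show ?case
    using comm_monoid.finprod_insert[OF comm_group.axioms(1)[OF abelian_integer_group], of A a f] by simp
qed

text \<open>Induction from below gives j \<le> \<delta> j, and from above \<delta> j \<le> j.
  Between summands of equal degree the injective part of the factorisation is therefore the
  identity, and its existence becomes an equation between surjections.\<close>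

lemma strict_mono_self_map_id:
  fixes \<delta> :: "nat \<Rightarrow> nat"
  assumes "strict_mono_on {..n} \<delta>" "\<delta> ` {..n} \<subseteq> {..n}" "i \<le> n"
  shows "\<delta> i = i"
proof (rule antisym)
  have "j \<le> \<delta> j" if "j \<le> n" for j
    using that
  proof (induction j)
    case (Suc j)
    then have "\<delta> j < \<delta> (Suc j)" by (simp add: strict_mono_onD[OF assms(1)])
    then show ?case using Suc by simp
  qed simp
  then show "i \<le> \<delta> i" using assms by simp
  have "\<delta> (n - j) \<le> n - j" if "j \<le> n" for j
    using that
  proof (induction j)
    case 0
    then show ?case using assms(2) by auto
  next
    case (Suc j)
    then have "\<delta> (n - Suc j) < \<delta> (n - j)" by (simp add: strict_mono_onD[OF assms(1)])
    then show ?case using Suc by simp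
  qed
  from this[of "n - i"] show "\<delta> i \<le> i" using assms by simp
qed

lemma dk_index_iff: "(n, \<sigma>) \<in> dk_index m \<longleftrightarrow> \<sigma> \<in> surj_maps n m"
  by (auto simp: dk_index_def surj_maps_def)

lemma finite_dk_index: "finite (dk_index m)"
proof -
  have "dk_index m \<subseteq> (SIGMA k:{..m}. {..m} \<rightarrow>\<^sub>E {..k})"
  proof
    fix s assume s: "s \<in> dk_index m"
    obtain k \<sigma> where ks: "s = (k, \<sigma>)" by (cases s)
    then have im: "\<sigma> ` {..m} = {..k}" using s by (simp add: dk_index_def)
    have "card {..k} \<le> card {..m}" unfolding im[symmetric] by (rule card_image_le) simp
    then show "s \<in> (SIGMA k:{..m}. {..m} \<rightarrow>\<^sub>E {..k})" using s ks im by (auto simp: dk_index_def PiE_iff)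
  qed
  then show ?thesis by (rule finite_subset) (auto intro!: finite_SigmaI finite_PiE)
qed

lemma finite_surj_maps: "finite (surj_maps n m)"
proof -
  have "surj_maps n m \<subseteq> snd ` dk_index m" by (force simp flip: dk_index_iff)
  then show ?thesis using finite_dk_index finite_surj by blast
qed

lemma sob_K: "sob (K n) m = sum_group (dk_index m) (\<lambda>s. if fst s = n then integer_group else singleton_group 0)"
  by (simp add: K_def dold_kan_def int_concentrated_def)

lemma comm_group_sob_K: "comm_group (sob (K n) m)"
proof -
  have "group (sob (K n) m)" unfolding sob_K by (rule sum_group) simp
  then show ?thesis
    by (rule group.group_comm_groupI) (auto simp: sob_K singleton_group_def intro!: restrict_ext)
qed

lemma group_sob_K: "group (sob (K n) m)"
  using comm_group_sob_K by (rule comm_group.axioms(2))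

lemma carrier_sob_K:
  "f \<in> carrier (sob (K n) m) \<longleftrightarrow> f \<in> extensional (dk_index m) \<and> (\<forall>t\<in>dk_index m. fst t \<noteq> n \<longrightarrow> f t = 0)"
  by (auto simp: sob_K carrier_sum_group PiE_iff finite_dk_index)

lemma mult_sob_K:
  "f \<in> carrier (sob (K n) m) \<Longrightarrow> g \<in> carrier (sob (K n) m) \<Longrightarrow> f \<otimes>\<^bsub>sob (K n) m\<^esub> g = (\<lambda>t\<in>dk_index m. f t + g t)"
  by (auto simp: carrier_sob_K, auto simp: sob_K singleton_group_def intro!: restrict_ext)

lemma one_sob_K: "\<one>\<^bsub>sob (K n) m\<^esub> = (\<lambda>t\<in>dk_index m. 0)"
  by (auto simp: sob_K singleton_group_def intro!: restrict_ext)

text \<open>Only the group in degree n is nonzero, so the differential and the default clause both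
  yield 0. The condition on x expresses that the other summands carry only 0.\<close>

lemma dk_coeff_concentrated:
  assumes t: "t \<in> dk_index m'" and n: "fst t = n" and x: "fst s \<noteq> n \<Longrightarrow> x = 0"
  shows "dk_coeff (int_concentrated n) m' \<theta> s t x = (if fst s = n \<and> pull m' \<theta> (snd s) = snd t then x else 0)"
proof (cases "fst s = n")
  case False
  then show ?thesis using x n by (auto simp: dk_coeff_def int_concentrated_def)
next
  case True
  have \<tau>: "snd t \<in> extensional {..m'}" "\<And>j. j \<le> m' \<Longrightarrow> snd t j \<le> n"
    using t n by (auto simp: dk_index_def)
  have "(\<exists>\<delta>. dk_target m' \<theta> s t \<delta>) \<longleftrightarrow> pull m' \<theta> (snd s) = snd t"
  proof
    assume "\<exists>\<delta>. dk_target m' \<theta> s t \<delta>"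
    then obtain \<delta> where \<delta>: "strict_mono_on {..n} \<delta>" "\<delta> ` {..n} \<subseteq> {..n}" "\<forall>j\<le>m'. \<delta> (snd t j) = snd s (\<theta> j)"
      using True n by (auto simp: dk_target_def)
    then have "\<forall>j\<le>m'. snd t j = snd s (\<theta> j)" using strict_mono_self_map_id[OF \<delta>(1,2)] \<tau>(2) by metis
    then show "pull m' \<theta> (snd s) = snd t" using \<tau>(1) by (auto simp: pull_def extensional_def fun_eq_iff restrict_def)
  next
    assume p: "pull m' \<theta> (snd s) = snd t"
    have "dk_target m' \<theta> s t (\<lambda>j. j)"
      using True n by (auto simp: dk_target_def strict_mono_on_def pull_def simp flip: p)
    then show "\<exists>\<delta>. dk_target m' \<theta> s t \<delta>" by blast
  qed
  then show ?thesis using True n by (simp add: dk_coeff_def) (simp add: int_concentrated_def)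
qed

lemma sop_K:
  assumes f: "f \<in> carrier (sob (K n) m)"
  shows "sop (K n) m m' \<theta> f = (\<lambda>t\<in>dk_index m'. if fst t = n
     then \<Sum>\<sigma> | \<sigma> \<in> surj_maps n m \<and> pull m' \<theta> \<sigma> = snd t. f (n, \<sigma>) else 0)"
proof -
  have f0: "f s = 0" if "s \<in> dk_index m" "fst s \<noteq> n" for s using f that by (auto simp: carrier_sob_K)
  have "finprod (cob (int_concentrated n) (fst t)) (\<lambda>s. dk_coeff (int_concentrated n) m' \<theta> s t (f s)) (dk_index m)
    = (if fst t = n then \<Sum>\<sigma> | \<sigma> \<in> surj_maps n m \<and> pull m' \<theta> \<sigma> = snd t. f (n, \<sigma>) else 0)"
    if t: "t \<in> dk_index m'" for t
  proof (cases "fst t = n")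
    case True
    then have "finprod (cob (int_concentrated n) (fst t)) (\<lambda>s. dk_coeff (int_concentrated n) m' \<theta> s t (f s)) (dk_index m)
      = (\<Sum>s\<in>dk_index m. dk_coeff (int_concentrated n) m' \<theta> s t (f s))"
      by (simp add: int_concentrated_def[of n] finprod_integer_group finite_dk_index)
    also have "\<dots> = (\<Sum>s\<in>dk_index m. if fst s = n \<and> pull m' \<theta> (snd s) = snd t then f s else 0)"
      by (intro sum.cong refl dk_coeff_concentrated[OF t True] f0)
    also have "\<dots> = (\<Sum>s | s \<in> dk_index m \<and> fst s = n \<and> pull m' \<theta> (snd s) = snd t. f s)"
      by (simp add: sum.inter_filter finite_dk_index)
    also have "\<dots> = (\<Sum>\<sigma> | \<sigma> \<in> surj_maps n m \<and> pull m' \<theta> \<sigma> = snd t. f (n, \<sigma>))"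
      by (intro sum.reindex_bij_witness[of _ "\<lambda>\<sigma>. (n, \<sigma>)" snd]) (auto simp: dk_index_iff)
    finally show ?thesis using True by simp
  next
    case False
    let ?G = "cob (int_concentrated n) (fst t)"
    interpret G: comm_group ?G using False by (simp add: int_concentrated_def)
    have "(\<lambda>s. dk_coeff (int_concentrated n) m' \<theta> s t (f s)) \<in> dk_index m \<rightarrow> carrier ?G"
      using False f0 by (auto simp: dk_coeff_def int_concentrated_def singleton_group_def)
    \<comment> \<open>The summand is the zero group, so membership already determines the
      value.\<close>
    then have "finprod ?G (\<lambda>s. dk_coeff (int_concentrated n) m' \<theta> s t (f s)) (dk_index m) \<in> carrier ?G"
      by (rule G.finprod_closed)
    then show ?thesis using False by (simp add: int_concentrated_def)
  qed
  then show ?thesis by (auto simp: K_def dold_kan_def intro!: restrict_ext)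
qed

lemma sop_K_hom: "sop (K n) m m' \<theta> \<in> hom (sob (K n) m) (sob (K n) m')"
proof (rule homI)
  fix f g assume fg: "f \<in> carrier (sob (K n) m)" "g \<in> carrier (sob (K n) m)"
  interpret comm_group "sob (K n) m" by (rule comm_group_sob_K)
  show cl: "sop (K n) m m' \<theta> f \<in> carrier (sob (K n) m')" if "f \<in> carrier (sob (K n) m)" for f
    unfolding sop_K[OF that] carrier_sob_K by simp
  have *: "(f \<otimes>\<^bsub>sob (K n) m\<^esub> g) (n, \<sigma>) = f (n, \<sigma>) + g (n, \<sigma>)" if "\<sigma> \<in> surj_maps n m" for \<sigma>
    using that fg by (simp add: mult_sob_K dk_index_iff)
  show "sop (K n) m m' \<theta> (f \<otimes>\<^bsub>sob (K n) m\<^esub> g)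
      = sop (K n) m m' \<theta> f \<otimes>\<^bsub>sob (K n) m'\<^esub> sop (K n) m m' \<theta> g"
    unfolding mult_sob_K[OF cl[OF fg(1)] cl[OF fg(2)]] unfolding sop_K[OF m_closed[OF fg]] sop_K[OF fg(1)] sop_K[OF fg(2)]
    by (rule restrict_ext) (simp add: * sum.distrib)
qed

text \<open>Outside the basis this is the zero function, the same convention as for
  \<open>xvar\<close>; \<open>sop_K_gen\<close> then needs no case distinction in its
  conclusion.\<close>

definition K_gen :: "nat \<Rightarrow> nat \<Rightarrow> (nat \<Rightarrow> nat) \<Rightarrow> nat \<times> (nat \<Rightarrow> nat) \<Rightarrow> int" where
  "K_gen n m \<sigma> = (\<lambda>t\<in>dk_index m. if t = (n, \<sigma>) then 1 else 0)"

lemma K_gen_closed: "K_gen n m \<sigma> \<in> carrier (sob (K n) m)"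
  by (auto simp: carrier_sob_K K_gen_def)

lemma K_gen_not_surj: "\<sigma> \<notin> surj_maps n m \<Longrightarrow> K_gen n m \<sigma> = \<one>\<^bsub>sob (K n) m\<^esub>"
  unfolding one_sob_K K_gen_def by (rule restrict_ext) (auto simp: dk_index_iff)

lemma sop_K_gen:
  assumes "simp_op m m' \<theta>" "\<sigma> \<in> mono_maps n m"
  shows "sop (K n) m m' \<theta> (K_gen n m \<sigma>) = K_gen n m' (pull m' \<theta> \<sigma>)"
  unfolding sop_K[OF K_gen_closed]
proof (subst (2) K_gen_def, rule restrict_ext)
  fix t assume t: "t \<in> dk_index m'"
  have "(\<Sum>\<rho> | \<rho> \<in> surj_maps n m \<and> pull m' \<theta> \<rho> = snd t. K_gen n m \<sigma> (n, \<rho>))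
    = (\<Sum>\<rho> | \<rho> \<in> surj_maps n m \<and> pull m' \<theta> \<rho> = snd t. if \<rho> = \<sigma> then 1 else 0)"
    by (intro sum.cong) (auto simp: K_gen_def dk_index_iff)
  also have "\<dots> = (if \<sigma> \<in> surj_maps n m \<and> pull m' \<theta> \<sigma> = snd t then 1 else 0)"
    by (simp add: finite_surj_maps)
  finally have s: "(\<Sum>\<rho> | \<rho> \<in> surj_maps n m \<and> pull m' \<theta> \<rho> = snd t. K_gen n m \<sigma> (n, \<rho>))
    = (if \<sigma> \<in> surj_maps n m \<and> pull m' \<theta> \<sigma> = snd t then 1 else 0)" .
  show "(if fst t = n then \<Sum>\<rho> | \<rho> \<in> surj_maps n m \<and> pull m' \<theta> \<rho> = snd t. K_gen n m \<sigma> (n, \<rho>) else 0)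
    = (if t = (n, pull m' \<theta> \<sigma>) then 1 else 0)"
    unfolding s using t pull_surj_imp_surj[OF assms] by (cases t) (auto simp: dk_index_iff)
qed

lemma generate_K_gen: "generate (sob (K n) m) (K_gen n m ` surj_maps n m) = carrier (sob (K n) m)"
proof
  let ?G = "sob (K n) m"
  let ?B = "generate ?G (K_gen n m ` surj_maps n m)"
  interpret G: comm_group ?G by (rule comm_group_sob_K)
  have sub: "K_gen n m ` surj_maps n m \<subseteq> carrier ?G" using K_gen_closed by auto
  show "?B \<subseteq> carrier ?G" using sub by (rule G.generate_incl)
  interpret B: subgroup ?B ?G using sub by (rule G.generate_is_subgroup)
  have multiple: "(\<lambda>t\<in>dk_index m. if t = (n, \<sigma>) then k else 0) \<in> ?B" if \<sigma>: "\<sigma> \<in> surj_maps n m" for \<sigma> k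
  proof -
    let ?h = "\<lambda>k. \<lambda>t\<in>dk_index m. if t = (n, \<sigma>) then k else (0 :: int)"
    have h: "?h k \<in> carrier ?G" for k by (auto simp: carrier_sob_K)
    have "?h \<in> hom integer_group ?G"
      using h by (intro homI) (auto simp: mult_sob_K fun_eq_iff)
    then have "?h k = ?h 1 [^]\<^bsub>?G\<^esub> k"
      using hom_int_pow[of ?h integer_group ?G 1 k] unfolding group_int_pow_integer_group mult_1_right by simp
    moreover have "?h 1 \<in> ?B" using \<sigma> by (auto simp: K_gen_def intro!: generate.incl)
    ultimately show ?thesis using G.subgroup_int_pow_closed[OF B.subgroup_axioms] by simp
  qed
  \<comment> \<open>Induction on a finite set S containing the support of f, splitting off one
    coordinate at a time.\<close>
  have "f \<in> ?B" if "finite S" "f \<in> carrier ?G" "\<And>t. t \<in> dk_index m \<Longrightarrow> t \<notin> S \<Longrightarrow> f t = 0" for S f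
    using that
  proof (induction S arbitrary: f rule: finite_induct)
    case empty
    then have "f = \<one>\<^bsub>?G\<^esub>" unfolding one_sob_K by (auto simp: carrier_sob_K extensional_def fun_eq_iff)
    then show ?case by simp
  next
    case (insert s S)
    show ?case
    proof (cases "s \<in> dk_index m \<and> fst s = n")
      case False
      then have "f t = 0" if "t \<in> dk_index m" "t \<notin> S" for t
        using insert.prems that by (cases "t = s") (auto simp: carrier_sob_K)
      then show ?thesis using insert by blast
    next
      case True
      let ?g = "f(s := 0)" and ?h = "\<lambda>t\<in>dk_index m. if t = s then f s else 0"
      have g: "?g \<in> carrier ?G" and h: "?h \<in> carrier ?G"
        using insert.prems True by (auto simp: carrier_sob_K extensional_def)
      have "?g \<in> ?B"
      proof (rule insert.IH[OF g])
        show "?g t = 0" if "t \<in> dk_index m" "t \<notin> S" for t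
          using insert.prems(2)[of t] that by (cases "t = s") auto
      qed
      moreover have "?h \<in> ?B" using True multiple[of "snd s" "f s"] by (cases s) (auto simp: dk_index_iff)
      moreover have "f = ?g \<otimes>\<^bsub>?G\<^esub> ?h"
        unfolding mult_sob_K[OF g h] using insert.prems by (auto simp: carrier_sob_K extensional_def fun_eq_iff)
      ultimately show ?thesis using B.m_closed by metis
    qed
  qed
  from this[OF finite_dk_index[of m]] show "carrier ?G \<subseteq> ?B" by auto
qed

section \<open>The simplicial group K(n) tensor Z\<close>

definition KZ :: "nat \<Rightarrow> nat \<Rightarrow> ((nat \<times> (nat \<Rightarrow> nat) \<Rightarrow> int) \<times> int \<Rightarrow>\<^sub>0 int) set monoid" where
  "KZ n m = tensor_group (sob (K n) m) integer_group"

definition KZ_gen where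
  "KZ_gen n m \<sigma> = tensor_elem (sob (K n) m) integer_group (K_gen n m \<sigma>) 1"

definition KZ_op where
  "KZ_op n m m' \<theta> = tensor_map (sob (K n) m') integer_group (sop (K n) m m' \<theta>) (\<lambda>v. v)"

text \<open>The linear extension of prescribed values v on the generators \<open>KZ_gen\<close>.
  That arbitrary values are possible shows that these generators are independent.\<close>

definition KZ_form ::
    "nat \<Rightarrow> nat \<Rightarrow> ((nat \<Rightarrow> nat) \<Rightarrow> 'b \<Rightarrow>\<^sub>0 int) \<Rightarrow> ((nat \<times> (nat \<Rightarrow> nat) \<Rightarrow> int) \<times> int \<Rightarrow>\<^sub>0 int) set \<Rightarrow> 'b \<Rightarrow>\<^sub>0 int" where
  "KZ_form n m v = presented_lift (free_Abelian_group UNIV)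
     (\<lambda>(f, k). \<Sum>\<sigma>\<in>surj_maps n m. frag_cmul (f (n, \<sigma>) * k) (v \<sigma>))"

lemma comm_group_KZ: "comm_group (KZ n m)"
  unfolding KZ_def by (rule comm_group_tensor_group[OF group_sob_K group_integer_group])

lemma group_KZ: "group (KZ n m)"
  using comm_group_KZ by (rule comm_group.axioms(2))

lemma KZ_gen_closed: "KZ_gen n m \<sigma> \<in> carrier (KZ n m)"
  unfolding KZ_def KZ_gen_def by (rule tensor_elem_closed[OF group_sob_K group_integer_group K_gen_closed]) simp

lemma KZ_gen_not_surj: "\<sigma> \<notin> surj_maps n m \<Longrightarrow> KZ_gen n m \<sigma> = \<one>\<^bsub>KZ n m\<^esub>"
  unfolding KZ_def KZ_gen_def
  using hom_one[OF tensor_elem_left_hom[OF group_sob_K group_integer_group] group_sob_K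
      comm_group.axioms(2)[OF comm_group_tensor_group[OF group_sob_K group_integer_group]], of 1 n m]
  by (simp add: K_gen_not_surj)

lemma KZ_op_hom: "KZ_op n m m' \<theta> \<in> hom (KZ n m) (KZ n m')"
  unfolding KZ_op_def KZ_def
  by (rule tensor_map_hom[OF group_sob_K group_integer_group group_sob_K group_integer_group sop_K_hom])
    (simp add: hom_def)

lemma KZ_op_gen:
  assumes "simp_op m m' \<theta>" "\<sigma> \<in> mono_maps n m"
  shows "KZ_op n m m' \<theta> (KZ_gen n m \<sigma>) = KZ_gen n m' (pull m' \<theta> \<sigma>)"
  unfolding KZ_op_def KZ_gen_def sop_K_gen[OF assms, symmetric]
  by (rule tensor_map_elem[OF group_sob_K group_integer_group group_sob_K group_integer_group sop_K_hom _ K_gen_closed])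
    (simp_all add: hom_def)

lemma KZ_form_facts:
  "k \<in> carrier integer_group \<Longrightarrow> (\<lambda>f. \<Sum>\<sigma>\<in>surj_maps n m. frag_cmul (f (n, \<sigma>) * k) (v \<sigma>))
     \<in> hom (sob (K n) m) (free_Abelian_group UNIV)"
  "f \<in> carrier (sob (K n) m) \<Longrightarrow> (\<lambda>k. \<Sum>\<sigma>\<in>surj_maps n m. frag_cmul (f (n, \<sigma>) * k) (v \<sigma>))
     \<in> hom integer_group (free_Abelian_group UNIV)"
  by (auto intro!: homI simp: mult_sob_K dk_index_iff distrib_left distrib_right frag_cmul_distrib sum.distrib[symmetric]
      intro!: sum.cong)

lemma KZ_form_hom: "KZ_form n m v \<in> hom (KZ n m) (free_Abelian_group UNIV)"
  unfolding KZ_form_def KZ_def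
  by (rule tensor_lift_hom[OF group_sob_K group_integer_group abelian_free_Abelian_group KZ_form_facts])

lemma KZ_form_gen:
  assumes "\<sigma> \<in> surj_maps n m"
  shows "KZ_form n m v (KZ_gen n m \<sigma>) = v \<sigma>"
proof -
  have "KZ_form n m v (KZ_gen n m \<sigma>) = (\<Sum>\<rho>\<in>surj_maps n m. frag_cmul (K_gen n m \<sigma> (n, \<rho>) * 1) (v \<rho>))"
    unfolding KZ_form_def KZ_gen_def
    by (rule tensor_lift_elem[OF group_sob_K group_integer_group abelian_free_Abelian_group KZ_form_facts K_gen_closed]) simp_all
  also have "\<dots> = (\<Sum>\<rho>\<in>surj_maps n m. if \<rho> = \<sigma> then v \<rho> else 0)"
    by (intro sum.cong refl) (auto simp: K_gen_def dk_index_iff)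
  also have "\<dots> = v \<sigma>" using assms by (simp add: finite_surj_maps)
  finally show ?thesis .
qed

lemma generate_KZ_gen: "generate (KZ n m) (KZ_gen n m ` surj_maps n m) = carrier (KZ n m)"
proof
  let ?G = "sob (K n) m"
  let ?B = "generate (KZ n m) (KZ_gen n m ` surj_maps n m)"
  interpret A: comm_group "KZ n m" by (rule comm_group_KZ)
  interpret G: comm_group ?G by (rule comm_group_sob_K)
  have sub: "KZ_gen n m ` surj_maps n m \<subseteq> carrier (KZ n m)" using KZ_gen_closed by auto
  show "?B \<subseteq> carrier (KZ n m)" using sub by (rule A.generate_incl)
  interpret B: subgroup ?B "KZ n m" using sub by (rule A.generate_is_subgroup)
  let ?l = "\<lambda>f. tensor_elem ?G integer_group f 1"
  interpret l: group_hom ?G "KZ n m" ?l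
    using tensor_elem_left_hom[OF group_sob_K group_integer_group, of 1]
    by (intro group_homI group_sob_K group_KZ) (simp add: KZ_def)
  have Gsub: "K_gen n m ` surj_maps n m \<subseteq> carrier ?G" using K_gen_closed by auto
  have l: "?l f \<in> ?B" if "f \<in> carrier ?G" for f
  proof -
    have "f \<in> generate ?G (K_gen n m ` surj_maps n m)" using that generate_K_gen by simp
    then show ?thesis
    proof (induction rule: generate.induct)
      case one
      then show ?case using l.hom_one by simp
    next
      case (incl h)
      then show ?case by (auto simp: KZ_gen_def[symmetric] intro: generate.incl)
    next
      case (inv h)
      then have "?l h \<in> ?B" by (auto simp: KZ_gen_def[symmetric] intro: generate.incl)
      then show ?case using inv Gsub l.hom_inv[of h] B.m_inv_closed by auto
    next
      case (eng a b)
      then have "a \<in> carrier ?G" "b \<in> carrier ?G" using generate_K_gen by auto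
      then show ?case using eng by simp
    qed
  qed
  have "tensor_elem ?G integer_group f k \<in> ?B" if f: "f \<in> carrier ?G" for f k
  proof -
    have "tensor_elem ?G integer_group f \<in> hom integer_group (KZ n m)"
      unfolding KZ_def by (rule tensor_elem_right_hom[OF group_sob_K group_integer_group f])
    from hom_int_pow[OF this, of 1 k] have "tensor_elem ?G integer_group f k = ?l f [^]\<^bsub>KZ n m\<^esub> k" by simp
    then show ?thesis using l[OF f] A.subgroup_int_pow_closed[OF B.subgroup_axioms] by simp
  qed
  then have "presented_gen (carrier ?G \<times> carrier integer_group) (tensor_rels ?G integer_group) ` (carrier ?G \<times> carrier integer_group) \<subseteq> ?B"
    by (auto simp: tensor_elem_def)
  then have "generate (KZ n m) (presented_gen (carrier ?G \<times> carrier integer_group) (tensor_rels ?G integer_group) ` (carrier ?G \<times> carrier integer_group)) \<subseteq> ?B"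
    by (rule A.generate_subgroup_incl[OF _ B.subgroup_axioms])
  then show "carrier (KZ n m) \<subseteq> ?B"
    unfolding KZ_def tensor_group_def generate_presented_gen[OF tensor_rels_carrier[OF group_sob_K group_integer_group]] .
qed

section \<open>The hook tensor product and its polynomial model\<close>

text \<open>The group T in simplicial degree m, with k = d - 1.\<close>

definition hook_tensor where
  "hook_tensor n k m = tensor_group (sym_power k (KZ n m)) (sym_power 1 (KZ n m))"

definition hook_tensor_gen where
  "hook_tensor_gen n k m M N = tensor_elem (sym_power k (KZ n m)) (sym_power 1 (KZ n m))
     (sym_elem k (KZ n m) (image_mset (KZ_gen n m) M)) (sym_elem 1 (KZ n m) (image_mset (KZ_gen n m) N))"

definition hook_tensor_op where
  "hook_tensor_op n k m m' \<theta> = tensor_map (sym_power k (KZ n m')) (sym_power 1 (KZ n m'))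
     (sym_power_map k (KZ n m') (KZ_op n m m' \<theta>)) (sym_power_map 1 (KZ n m') (KZ_op n m m' \<theta>))"

abbreviation ZF :: "('a \<Rightarrow>\<^sub>0 int) monoid" where "ZF \<equiv> free_Abelian_group UNIV"

lemma group_sym_KZ: "group (sym_power k (KZ n m))"
  by (rule group_sym_power[OF group_KZ])

lemma comm_group_hook_tensor: "comm_group (hook_tensor n k m)"
  unfolding hook_tensor_def by (rule comm_group_tensor_group[OF group_sym_KZ group_sym_KZ])

lemma group_hook_tensor: "group (hook_tensor n k m)"
  using comm_group_hook_tensor by (rule comm_group.axioms(2))

lemma image_KZ_gen_subset: "set_mset (image_mset (KZ_gen n m) M) \<subseteq> carrier (KZ n m)"
  using KZ_gen_closed by auto

lemma sym_gen_closed: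
  "size M = k \<Longrightarrow> sym_elem k (KZ n m) (image_mset (KZ_gen n m) M) \<in> carrier (sym_power k (KZ n m))"
  using image_KZ_gen_subset by (intro sym_elem_closed[OF group_KZ]) auto

lemma hook_tensor_gen_closed: "size M = k \<Longrightarrow> size N = 1 \<Longrightarrow> hook_tensor_gen n k m M N \<in> carrier (hook_tensor n k m)"
  unfolding hook_tensor_gen_def hook_tensor_def by (intro tensor_elem_closed[OF group_sym_KZ group_sym_KZ] sym_gen_closed)

lemma multiset_image_lift:
  assumes "set_mset M \<subseteq> f ` S"
  obtains M' where "M = image_mset f M'" "set_mset M' \<subseteq> S"
proof -
  have "\<exists>M'. M = image_mset f M' \<and> set_mset M' \<subseteq> S"
    using assms
  proof (induction M)
    case (add x M)
    then obtain M' s where "M = image_mset f M'" "set_mset M' \<subseteq> S" "x = f s" "s \<in> S" by auto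
    then have "add_mset x M = image_mset f (add_mset s M')" "set_mset (add_mset s M') \<subseteq> S" by auto
    then show ?case by blast
  qed auto
  then show ?thesis using that by blast
qed

lemma sym_KZ_hom_eqI:
  assumes L: "group L" and f: "f \<in> hom (sym_power k (KZ n m)) L" and g: "g \<in> hom (sym_power k (KZ n m)) L"
    and eq: "\<And>M. size M = k \<Longrightarrow> set_mset M \<subseteq> surj_maps n m \<Longrightarrow>
      f (sym_elem k (KZ n m) (image_mset (KZ_gen n m) M)) = g (sym_elem k (KZ n m) (image_mset (KZ_gen n m) M))"
    and t: "t \<in> carrier (sym_power k (KZ n m))"
  shows "f t = g t"
proof (rule sym_hom_eq_on_basis[OF group_KZ L f g _ generate_KZ_gen _ t])
  show "KZ_gen n m ` surj_maps n m \<subseteq> carrier (KZ n m)" using KZ_gen_closed by auto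
  fix M assume "size M = k" "set_mset M \<subseteq> KZ_gen n m ` surj_maps n m"
  then show "f (sym_elem k (KZ n m) M) = g (sym_elem k (KZ n m) M)"
    using eq by (metis multiset_image_lift size_image_mset)
qed

lemma hook_tensor_hom_eqI:
  assumes L: "group L" and f: "f \<in> hom (hook_tensor n k m) L" and g: "g \<in> hom (hook_tensor n k m) L"
    and eq: "\<And>M N. size M = k \<Longrightarrow> size N = 1 \<Longrightarrow> set_mset M \<subseteq> surj_maps n m \<Longrightarrow> set_mset N \<subseteq> surj_maps n m \<Longrightarrow>
      f (hook_tensor_gen n k m M N) = g (hook_tensor_gen n k m M N)"
    and t: "t \<in> carrier (hook_tensor n k m)"
  shows "f t = g t"
proof (rule tensor_hom_eqI[OF group_sym_KZ group_sym_KZ L f[unfolded hook_tensor_def] g[unfolded hook_tensor_def] _ t[unfolded hook_tensor_def]])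
  let ?S = "sym_power k (KZ n m)" and ?S1 = "sym_power 1 (KZ n m)"
  let ?e = "\<lambda>k M. sym_elem k (KZ n m) (image_mset (KZ_gen n m) M)"
  fix x y assume x: "x \<in> carrier ?S" and y: "y \<in> carrier ?S1"
  have left: "(\<lambda>x. h (tensor_elem ?S ?S1 x y)) \<in> hom ?S L" if "h \<in> hom (hook_tensor n k m) L" "y \<in> carrier ?S1" for h y
    using hom_compose[OF tensor_elem_left_hom[OF group_sym_KZ group_sym_KZ that(2)] that(1)[unfolded hook_tensor_def]]
    by (simp add: o_def)
  have right: "(\<lambda>y. h (tensor_elem ?S ?S1 x y)) \<in> hom ?S1 L" if "h \<in> hom (hook_tensor n k m) L" "x \<in> carrier ?S" for h x
    using hom_compose[OF tensor_elem_right_hom[OF group_sym_KZ group_sym_KZ that(2)] that(1)[unfolded hook_tensor_def]]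
    by (simp add: o_def)
  have "f (tensor_elem ?S ?S1 (?e k M) y) = g (tensor_elem ?S ?S1 (?e k M) y)"
    if M: "size M = k" "set_mset M \<subseteq> surj_maps n m" for M
  proof (rule sym_KZ_hom_eqI[OF L right[OF f] right[OF g] _ y])
    show "?e k M \<in> carrier ?S" "?e k M \<in> carrier ?S" using M sym_gen_closed by auto
    show "f (tensor_elem ?S ?S1 (?e k M) (?e 1 N)) = g (tensor_elem ?S ?S1 (?e k M) (?e 1 N))"
      if "size N = 1" "set_mset N \<subseteq> surj_maps n m" for N
      using eq[OF M(1) that(1) M(2) that(2)] by (simp add: hook_tensor_gen_def)
  qed
  then show "f (tensor_elem ?S ?S1 x y) = g (tensor_elem ?S ?S1 x y)"
    by (rule sym_KZ_hom_eqI[OF L left[OF f y] left[OF g y] _ x])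
qed

lemma sym_elem_one:
  assumes G: "group G" and M: "set_mset M \<subseteq> carrier G" "size M = d" "\<one>\<^bsub>G\<^esub> \<in># M"
  shows "sym_elem d G M = \<one>\<^bsub>sym_power d G\<^esub>"
proof -
  obtain M' where M': "M = add_mset \<one>\<^bsub>G\<^esub> M'" using M by (auto dest: multi_member_split)
  have "(\<lambda>x. sym_elem d G (add_mset x M')) \<in> hom G (sym_power d G)"
    using M M' by (intro sym_elem_hom[OF G]) auto
  from hom_one[OF this G group_sym_power[OF G]] show ?thesis by (simp add: M')
qed

text \<open>A neutral factor kills a multilinear expression. This matches
  \<open>monom_not_surj\<close>, so generators and monomials degenerate alike.\<close>

lemma hook_tensor_gen_not_surj:
  assumes "size M = k" "size N = 1" "\<not> (set_mset M \<subseteq> surj_maps n m \<and> set_mset N \<subseteq> surj_maps n m)"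
  shows "hook_tensor_gen n k m M N = \<one>\<^bsub>hook_tensor n k m\<^esub>"
proof -
  let ?S = "sym_power k (KZ n m)" and ?S1 = "sym_power 1 (KZ n m)"
  have one: "sym_elem j (KZ n m) (image_mset (KZ_gen n m) A) = \<one>\<^bsub>sym_power j (KZ n m)\<^esub>"
    if "size A = j" "\<not> set_mset A \<subseteq> surj_maps n m" for A j
    using that KZ_gen_not_surj[of _ n m] KZ_gen_closed
    by (intro sym_elem_one[OF group_KZ]) (force simp: subset_iff image_iff)+
  from assms(3) consider "\<not> set_mset M \<subseteq> surj_maps n m" | "\<not> set_mset N \<subseteq> surj_maps n m" by blast
  then show ?thesis
  proof cases
    case 1
    have "tensor_elem ?S ?S1 \<one>\<^bsub>?S\<^esub> (sym_elem 1 (KZ n m) (image_mset (KZ_gen n m) N)) = \<one>\<^bsub>hook_tensor n k m\<^esub>"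
      unfolding hook_tensor_def
      using hom_one[OF tensor_elem_left_hom[OF group_sym_KZ group_sym_KZ sym_gen_closed[OF assms(2)]] group_sym_KZ group_hook_tensor[unfolded hook_tensor_def]] .
    then show ?thesis unfolding hook_tensor_gen_def one[OF assms(1) 1] .
  next
    case 2
    have "tensor_elem ?S ?S1 (sym_elem k (KZ n m) (image_mset (KZ_gen n m) M)) \<one>\<^bsub>?S1\<^esub> = \<one>\<^bsub>hook_tensor n k m\<^esub>"
      unfolding hook_tensor_def
      using hom_one[OF tensor_elem_right_hom[OF group_sym_KZ group_sym_KZ sym_gen_closed[OF assms(1)]] group_sym_KZ group_hook_tensor[unfolded hook_tensor_def]] .
    then show ?thesis unfolding hook_tensor_gen_def one[OF assms(2) 2] .
  qed
qed

lemma hook_tensor_op_hom: "hook_tensor_op n k m m' \<theta> \<in> hom (hook_tensor n k m) (hook_tensor n k m')"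
  unfolding hook_tensor_op_def hook_tensor_def
  by (intro tensor_map_hom group_sym_KZ sym_power_map_hom[OF group_KZ group_KZ KZ_op_hom])

lemma hook_tensor_op_gen:
  assumes \<theta>: "simp_op m m' \<theta>" and M: "size M = k" "set_mset M \<subseteq> mono_maps n m"
    and N: "size N = 1" "set_mset N \<subseteq> mono_maps n m"
  shows "hook_tensor_op n k m m' \<theta> (hook_tensor_gen n k m M N) = hook_tensor_gen n k m' (image_mset (pull m' \<theta>) M) (image_mset (pull m' \<theta>) N)"
proof -
  have s: "sym_power_map j (KZ n m') (KZ_op n m m' \<theta>) (sym_elem j (KZ n m) (image_mset (KZ_gen n m) A))
    = sym_elem j (KZ n m') (image_mset (KZ_gen n m') (image_mset (pull m' \<theta>) A))"
    if "size A = j" "set_mset A \<subseteq> mono_maps n m" for A j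
  proof -
    have "image_mset (KZ_op n m m' \<theta>) (image_mset (KZ_gen n m) A) = image_mset (KZ_gen n m') (image_mset (pull m' \<theta>) A)"
      unfolding image_mset.compositionality using that KZ_op_gen[OF \<theta>] by (intro image_mset_cong) auto
    moreover have "sym_power_map j (KZ n m') (KZ_op n m m' \<theta>) (sym_elem j (KZ n m) (image_mset (KZ_gen n m) A))
      = sym_elem j (KZ n m') (image_mset (KZ_op n m m' \<theta>) (image_mset (KZ_gen n m) A))"
      using that by (intro sym_power_map_elem[OF group_KZ group_KZ KZ_op_hom image_KZ_gen_subset]) simp
    ultimately show ?thesis by simp
  qed
  show ?thesis
    unfolding hook_tensor_op_def hook_tensor_gen_def s[OF M, symmetric] s[OF N, symmetric]
    by (rule tensor_map_elem[OF group_sym_KZ group_sym_KZ group_sym_KZ group_sym_KZ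
      sym_power_map_hom[OF group_KZ group_KZ KZ_op_hom] sym_power_map_hom[OF group_KZ group_KZ KZ_op_hom]
      sym_gen_closed[OF M(1)] sym_gen_closed[OF N(1)]])
qed

section \<open>The polynomial model\<close>

definition sym_form where
  "sym_form n m v = presented_lift ZF (\<lambda>M. \<Prod>a\<in>#M. KZ_form n m v a)"

lemma sym_form_facts:
  fixes v :: "(nat \<Rightarrow> nat) \<Rightarrow> bipoly"
  shows "set_mset M \<subseteq> carrier (KZ n m) \<Longrightarrow> Suc (size M) = j \<Longrightarrow>
      (\<lambda>x. \<Prod>a\<in>#add_mset x M. KZ_form n m v a) \<in> hom (KZ n m) ZF"
    and "set_mset M \<subseteq> carrier (KZ n m) \<Longrightarrow> size M = j \<Longrightarrow> (\<Prod>a\<in>#M. KZ_form n m v a) \<in> carrier ZF"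
  using hom_mult[OF KZ_form_hom[of n m v]] by (auto intro!: homI simp: distrib_right)

lemma sym_form_hom: "sym_form n m v \<in> hom (sym_power j (KZ n m)) (ZF :: bipoly monoid)"
  unfolding sym_form_def
  by (rule sym_lift_hom[OF group_KZ abelian_free_Abelian_group sym_form_facts])

lemma sym_form_elem:
  fixes v :: "(nat \<Rightarrow> nat) \<Rightarrow> bipoly"
  assumes "set_mset M \<subseteq> carrier (KZ n m)" "size M = j"
  shows "sym_form n m v (sym_elem j (KZ n m) M) = (\<Prod>a\<in>#M. KZ_form n m v a)"
  unfolding sym_form_def
  by (rule sym_lift_elem[OF group_KZ abelian_free_Abelian_group sym_form_facts assms])

lemma KZ_form_gen_var:
  assumes "\<And>\<sigma>. \<sigma> \<notin> surj_maps n m \<Longrightarrow> v \<sigma> = 0"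
  shows "KZ_form n m v (KZ_gen n m \<sigma>) = v \<sigma>"
  using KZ_form_gen[of \<sigma> n m v] assms[of \<sigma>] KZ_gen_not_surj[of \<sigma> n m]
    hom_one[OF KZ_form_hom group_KZ group_free_Abelian_group, of n m v]
  by (cases "\<sigma> \<in> surj_maps n m") auto

lemma sym_form_gen:
  fixes v :: "(nat \<Rightarrow> nat) \<Rightarrow> bipoly"
  assumes "\<And>\<sigma>. \<sigma> \<notin> surj_maps n m \<Longrightarrow> v \<sigma> = 0" "size M = j"
  shows "sym_form n m v (sym_elem j (KZ n m) (image_mset (KZ_gen n m) M)) = (\<Prod>\<sigma>\<in>#M. v \<sigma>)"
proof -
  have "sym_form n m v (sym_elem j (KZ n m) (image_mset (KZ_gen n m) M))
    = (\<Prod>a\<in>#image_mset (KZ_gen n m) M. KZ_form n m v a)"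
    using assms(2) by (intro sym_form_elem[OF image_KZ_gen_subset]) simp
  then show ?thesis
    using KZ_form_gen_var[of n m v, OF assms(1)] by (simp add: image_mset.compositionality o_def)
qed

text \<open>Separate variables for the two tensor factors ensure that multiplying the two
  polynomials loses no information.\<close>

definition hook_to_poly where
  "hook_to_poly n k m = presented_lift ZF (\<lambda>(P, Q). sym_form n m (xvar n m) P * sym_form n m (yvar n m) Q)"

definition hook_index :: "nat \<Rightarrow> nat \<Rightarrow> nat \<Rightarrow> ((nat \<Rightarrow> nat) multiset \<times> (nat \<Rightarrow> nat) multiset) set" where
  "hook_index n k m = {(M, N). size M = k \<and> size N = 1 \<and> set_mset M \<subseteq> surj_maps n m \<and> set_mset N \<subseteq> surj_maps n m}"

text \<open>Monomials of another bidegree, or with a variable outside the basis, go to the neutral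
  element, so the map is a homomorphism on the whole polynomial ring and composes freely with
  operations on polynomials.\<close>

definition poly_to_hook where
  "poly_to_hook n k m = free_ext (hook_tensor n k m)
     (\<lambda>b. if b \<in> hook_index n k m then hook_tensor_gen n k m (fst b) (snd b) else \<one>\<^bsub>hook_tensor n k m\<^esub>)"

lemma hook_to_poly_facts:
  "Q \<in> carrier (sym_power 1 (KZ n m)) \<Longrightarrow>
    (\<lambda>P. sym_form n m (xvar n m) P * sym_form n m (yvar n m) Q) \<in> hom (sym_power k (KZ n m)) ZF"
  "P \<in> carrier (sym_power k (KZ n m)) \<Longrightarrow>
    (\<lambda>Q. sym_form n m (xvar n m) P * sym_form n m (yvar n m) Q) \<in> hom (sym_power 1 (KZ n m)) ZF"
  using hom_mult[OF sym_form_hom[of n m "xvar n m" k]] hom_mult[OF sym_form_hom[of n m "yvar n m" 1]]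
  by (auto intro!: homI simp: distrib_right distrib_left)

lemma hook_to_poly_hom: "hook_to_poly n k m \<in> hom (hook_tensor n k m) ZF"
  unfolding hook_to_poly_def hook_tensor_def
  by (rule tensor_lift_hom[OF group_sym_KZ group_sym_KZ abelian_free_Abelian_group hook_to_poly_facts])

lemma hook_to_poly_gen:
  assumes "size M = k" "size N = 1"
  shows "hook_to_poly n k m (hook_tensor_gen n k m M N) = monom_xy n m M N"
proof -
  have "hook_to_poly n k m (hook_tensor_gen n k m M N)
    = sym_form n m (xvar n m) (sym_elem k (KZ n m) (image_mset (KZ_gen n m) M))
      * sym_form n m (yvar n m) (sym_elem 1 (KZ n m) (image_mset (KZ_gen n m) N))"
    unfolding hook_to_poly_def hook_tensor_gen_def
    by (rule tensor_lift_elem[OF group_sym_KZ group_sym_KZ abelian_free_Abelian_group hook_to_poly_facts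
      sym_gen_closed[OF assms(1)] sym_gen_closed[OF assms(2)]])
  then show ?thesis
    using sym_form_gen[of n m "xvar n m"] sym_form_gen[of n m "yvar n m"] assms
    by (simp add: monom_xy_def xvar_def yvar_def)
qed

lemma poly_to_hook_hom: "poly_to_hook n k m \<in> hom ZF (hook_tensor n k m)"
proof -
  interpret comm_group "hook_tensor n k m" by (rule comm_group_hook_tensor)
  show ?thesis unfolding poly_to_hook_def
    by (rule free_ext_hom[OF comm_group_hook_tensor]) (auto simp: hook_index_def hook_tensor_gen_closed)
qed

lemma poly_to_hook_frag_of:
  "poly_to_hook n k m (frag_of (M, N)) = (if (M, N) \<in> hook_index n k m then hook_tensor_gen n k m M N else \<one>\<^bsub>hook_tensor n k m\<^esub>)"
proof -
  interpret comm_group "hook_tensor n k m" by (rule comm_group_hook_tensor)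
  show ?thesis unfolding poly_to_hook_def
    by (subst free_ext_frag_of[OF comm_group_hook_tensor]) (auto simp: hook_index_def hook_tensor_gen_closed)
qed

lemma poly_to_hook_0: "poly_to_hook n k m 0 = \<one>\<^bsub>hook_tensor n k m\<^esub>"
  using hom_one[OF poly_to_hook_hom group_free_Abelian_group group_hook_tensor] by simp

lemma poly_to_hook_monom:
  "poly_to_hook n k m (monom_xy n m M N) = (if size M = k \<and> size N = 1 then hook_tensor_gen n k m M N else \<one>\<^bsub>hook_tensor n k m\<^esub>)"
proof (cases "set_mset M \<subseteq> surj_maps n m \<and> set_mset N \<subseteq> surj_maps n m")
  case True
  then show ?thesis by (simp add: monom_surj poly_to_hook_frag_of hook_index_def)
next
  case False
  then show ?thesis using hook_tensor_gen_not_surj[of M k N n m] by (auto simp: monom_not_surj[OF False] poly_to_hook_0)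
qed

text \<open>Both maps are homomorphisms and match generators with monomials. This composite carries
  identities of polynomials back to T; the opposite one is only a projection onto the span of
  \<open>hook_index\<close>.\<close>

lemma poly_to_hook_hook_to_poly:
  assumes "t \<in> carrier (hook_tensor n k m)"
  shows "poly_to_hook n k m (hook_to_poly n k m t) = t"
proof -
  have "(poly_to_hook n k m \<circ> hook_to_poly n k m) t = (\<lambda>t. t) t"
    by (rule hook_tensor_hom_eqI[OF group_hook_tensor hom_compose[OF hook_to_poly_hom poly_to_hook_hom] _ _ assms])
      (simp_all add: hook_to_poly_gen poly_to_hook_monom hom_def)
  then show ?thesis by simp
qed

lemma frag_extend_hom: "frag_extend f \<in> hom ZF ZF"
  by (auto intro!: homI simp: frag_extend_add)

lemma act_hom: "act n m m' \<theta> \<in> hom ZF ZF"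
  unfolding act_def poly_eval_def by (rule frag_extend_hom)

lemma hook_to_poly_op:
  assumes \<theta>: "simp_op m m' \<theta>" and t: "t \<in> carrier (hook_tensor n k m)"
  shows "hook_to_poly n k m' (hook_tensor_op n k m m' \<theta> t) = act n m m' \<theta> (hook_to_poly n k m t)"
proof -
  have "(hook_to_poly n k m' \<circ> hook_tensor_op n k m m' \<theta>) t = (act n m m' \<theta> \<circ> hook_to_poly n k m) t"
  proof (rule hook_tensor_hom_eqI[OF group_free_Abelian_group hom_compose[OF hook_tensor_op_hom hook_to_poly_hom]
        hom_compose[OF hook_to_poly_hom act_hom] _ t])
    fix M N assume MN: "size M = k" "size N = 1" "set_mset M \<subseteq> surj_maps n m" "set_mset N \<subseteq> surj_maps n m"
    then have "set_mset M \<subseteq> mono_maps n m" "set_mset N \<subseteq> mono_maps n m" using surj_maps_subset by blast+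
    then show "(hook_to_poly n k m' \<circ> hook_tensor_op n k m m' \<theta>) (hook_tensor_gen n k m M N)
        = (act n m m' \<theta> \<circ> hook_to_poly n k m) (hook_tensor_gen n k m M N)"
      using MN by (simp add: hook_tensor_op_gen[OF \<theta>] hook_to_poly_gen act_monom[OF \<theta>])
  qed
  then show ?thesis by simp
qed

lemma free_hom_eqI:
  assumes L: "group L" and f: "f \<in> hom ZF L" and g: "g \<in> hom ZF L" and "\<And>b. f (frag_of b) = g (frag_of b)"
  shows "f c = g c"
proof -
  interpret f: group_hom ZF L f using L f by (intro group_homI) auto
  interpret g: group_hom ZF L g using L g by (intro group_homI) auto
  show ?thesis
    using subset_UNIV[of "Poly_Mapping.keys c"]
  proof (induction c rule: frag_induction)
    case zero
    then show ?case using f.hom_one g.hom_one by simp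
  next
    case (diff a b)
    then show ?case
      using f.hom_mult[of a "inv\<^bsub>ZF\<^esub> b"] g.hom_mult[of a "inv\<^bsub>ZF\<^esub> b"] f.hom_inv[of b] g.hom_inv[of b] by simp
  qed (rule assms(4))
qed

lemma poly_to_hook_act:
  assumes \<theta>: "simp_op m m' \<theta>"
  shows "poly_to_hook n k m' (act n m m' \<theta> c) = hook_tensor_op n k m m' \<theta> (poly_to_hook n k m c)"
proof -
  have "(poly_to_hook n k m' \<circ> act n m m' \<theta>) c = (hook_tensor_op n k m m' \<theta> \<circ> poly_to_hook n k m) c"
  proof (rule free_hom_eqI[OF group_hook_tensor hom_compose[OF act_hom poly_to_hook_hom] hom_compose[OF poly_to_hook_hom hook_tensor_op_hom]])
    fix b :: "(nat \<Rightarrow> nat) multiset \<times> (nat \<Rightarrow> nat) multiset"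
    obtain M N where b: "b = (M, N)" by (cases b)
    have one: "hook_tensor_op n k m m' \<theta> \<one>\<^bsub>hook_tensor n k m\<^esub> = \<one>\<^bsub>hook_tensor n k m'\<^esub>" by (rule hom_one[OF hook_tensor_op_hom group_hook_tensor group_hook_tensor])
    show "(poly_to_hook n k m' \<circ> act n m m' \<theta>) (frag_of b) = (hook_tensor_op n k m m' \<theta> \<circ> poly_to_hook n k m) (frag_of b)"
    proof (cases "set_mset M \<subseteq> surj_maps n m \<and> set_mset N \<subseteq> surj_maps n m")
      case True
      then have mm: "set_mset M \<subseteq> mono_maps n m" "set_mset N \<subseteq> mono_maps n m" using surj_maps_subset by blast+
      have "frag_of b = monom_xy n m M N" using True by (simp add: b monom_surj)
      then show ?thesis using mm by (simp add: act_monom[OF \<theta>] poly_to_hook_monom one hook_tensor_op_gen[OF \<theta>])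
    next
      case False
      then obtain \<rho> where "\<rho> \<notin> surj_maps n m" "\<rho> \<in># M \<or> \<rho> \<in># N" by auto
      then have "act n m m' \<theta> (frag_of (M, N)) = 0" by (auto simp: act_def dest!: multi_member_split)
      then show ?thesis using False by (auto simp: b poly_to_hook_0 poly_to_hook_frag_of one hook_index_def)
    qed
  qed
  then show ?thesis by simp
qed

text \<open>The projection onto the span of \<open>hook_index\<close> fixes the images of the
  generators, hence the whole image.\<close>

lemma keys_hook_to_poly:
  assumes "t \<in> carrier (hook_tensor n k m)"
  shows "Poly_Mapping.keys (hook_to_poly n k m t) \<subseteq> hook_index n k m"
proof -
  let ?p = "frag_extend (\<lambda>b. if b \<in> hook_index n k m then frag_of b else 0)"
  have "(?p \<circ> hook_to_poly n k m) t = hook_to_poly n k m t"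
    by (rule hook_tensor_hom_eqI[OF group_free_Abelian_group hom_compose[OF hook_to_poly_hom frag_extend_hom] hook_to_poly_hom _ assms])
      (simp add: hook_to_poly_gen monom_surj hook_index_def)
  then show ?thesis
    using keys_frag_extend[of "\<lambda>b. if b \<in> hook_index n k m then frag_of b else 0" "hook_to_poly n k m t"]
    by (auto split: if_splits)
qed

section \<open>The Schur functor inside the hook tensor product\<close>

definition hook_mult where
  "hook_mult n k m = sym_mult k 1 (KZ n m)"

definition hook_group where
  "hook_group n k m = (hook_tensor n k m)\<lparr>carrier := kernel (hook_tensor n k m) (sym_power (k + 1) (KZ n m)) (hook_mult n k m)\<rparr>"

lemma hook_mult_hom: "hook_mult n k m \<in> hom (hook_tensor n k m) (sym_power (k + 1) (KZ n m))"
  unfolding hook_mult_def hook_tensor_def by (rule sym_mult_hom[OF group_KZ])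

lemma hook_mult_gen:
  "size M = k \<Longrightarrow> size N = 1 \<Longrightarrow>
    hook_mult n k m (hook_tensor_gen n k m M N) = sym_elem (k + 1) (KZ n m) (image_mset (KZ_gen n m) (M + N))"
  unfolding hook_mult_def hook_tensor_gen_def image_mset_union
  by (intro sym_mult_elem[OF group_KZ] image_KZ_gen_subset) auto

text \<open>On generators both sides pull back all factors of the product; it follows that the
  operators preserve the kernel F.\<close>

lemma hook_mult_op:
  assumes \<theta>: "simp_op m m' \<theta>" and t: "t \<in> carrier (hook_tensor n k m)"
  shows "hook_mult n k m' (hook_tensor_op n k m m' \<theta> t) = sym_power_map (k + 1) (KZ n m') (KZ_op n m m' \<theta>) (hook_mult n k m t)"
proof -
  have "(hook_mult n k m' \<circ> hook_tensor_op n k m m' \<theta>) t = (sym_power_map (k + 1) (KZ n m') (KZ_op n m m' \<theta>) \<circ> hook_mult n k m) t"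
  proof (rule hook_tensor_hom_eqI[OF group_sym_KZ hom_compose[OF hook_tensor_op_hom hook_mult_hom]
        hom_compose[OF hook_mult_hom sym_power_map_hom[OF group_KZ group_KZ KZ_op_hom]] _ t])
    fix M N assume MN: "size M = k" "size N = 1" "set_mset M \<subseteq> surj_maps n m" "set_mset N \<subseteq> surj_maps n m"
    then have mm: "set_mset M \<subseteq> mono_maps n m" "set_mset N \<subseteq> mono_maps n m" using surj_maps_subset by blast+
    have "image_mset (KZ_op n m m' \<theta>) (image_mset (KZ_gen n m) (M + N))
        = image_mset (KZ_gen n m') (image_mset (pull m' \<theta>) (M + N))"
      unfolding image_mset.compositionality using mm KZ_op_gen[OF \<theta>] by (intro image_mset_cong) auto
    moreover have "sym_power_map (k + 1) (KZ n m') (KZ_op n m m' \<theta>) (sym_elem (k + 1) (KZ n m) (image_mset (KZ_gen n m) (M + N)))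
      = sym_elem (k + 1) (KZ n m') (image_mset (KZ_op n m m' \<theta>) (image_mset (KZ_gen n m) (M + N)))"
      using MN by (intro sym_power_map_elem[OF group_KZ group_KZ KZ_op_hom image_KZ_gen_subset]) simp
    ultimately show "(hook_mult n k m' \<circ> hook_tensor_op n k m m' \<theta>) (hook_tensor_gen n k m M N)
        = (sym_power_map (k + 1) (KZ n m') (KZ_op n m m' \<theta>) \<circ> hook_mult n k m) (hook_tensor_gen n k m M N)"
      using MN mm by (simp add: hook_tensor_op_gen[OF \<theta>] hook_mult_gen del: One_nat_def)
  qed
  then show ?thesis by simp
qed

lemma subgroup_hook: "subgroup (carrier (hook_group n k m)) (hook_tensor n k m)"
proof -
  interpret group_hom "hook_tensor n k m" "sym_power (k + 1) (KZ n m)" "hook_mult n k m"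
    by (intro group_homI group_hook_tensor group_sym_KZ hook_mult_hom)
  show ?thesis unfolding hook_group_def using subgroup_kernel by simp
qed

lemma carrier_hook_group:
  "t \<in> carrier (hook_group n k m) \<longleftrightarrow> t \<in> carrier (hook_tensor n k m) \<and> hook_mult n k m t = \<one>\<^bsub>sym_power (k + 1) (KZ n m)\<^esub>"
  by (simp add: hook_group_def kernel_def)

lemma comm_group_hook: "comm_group (hook_group n k m)"
proof -
  have "hook_group n k m = (hook_tensor n k m)\<lparr>carrier := carrier (hook_group n k m)\<rparr>" by (simp add: hook_group_def)
  then have "group (hook_group n k m)"
    using subgroup.subgroup_is_group[OF subgroup_hook group_hook_tensor] by metis
  then show ?thesis
    using comm_group.axioms(1)[OF comm_group_hook_tensor, of n k m]
    by (intro group.group_comm_groupI) (auto simp: carrier_hook_group, auto simp: hook_group_def comm_monoid.m_comm)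
qed

lemma group_hook: "group (hook_group n k m)"
  using comm_group_hook by (rule comm_group.axioms(2))

lemma hook_tensor_op_hook_hom:
  assumes "simp_op m m' \<theta>"
  shows "hook_tensor_op n k m m' \<theta> \<in> hom (hook_group n k m) (hook_group n k m')"
proof (rule homI)
  fix t assume t: "t \<in> carrier (hook_group n k m)"
  have "sym_power_map (k + 1) (KZ n m') (KZ_op n m m' \<theta>) \<one>\<^bsub>sym_power (k + 1) (KZ n m)\<^esub> = \<one>\<^bsub>sym_power (k + 1) (KZ n m')\<^esub>"
    by (rule hom_one[OF sym_power_map_hom[OF group_KZ group_KZ KZ_op_hom] group_sym_KZ group_sym_KZ])
  then show "hook_tensor_op n k m m' \<theta> t \<in> carrier (hook_group n k m')"
    using t hook_mult_op[OF assms, of t n k] hom_in_carrier[OF hook_tensor_op_hom, of t n k m m' \<theta>] by (simp add: carrier_hook_group)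
next
  fix s t assume "s \<in> carrier (hook_group n k m)" "t \<in> carrier (hook_group n k m)"
  then show "hook_tensor_op n k m m' \<theta> (s \<otimes>\<^bsub>hook_group n k m\<^esub> t) = hook_tensor_op n k m m' \<theta> s \<otimes>\<^bsub>hook_group n k m'\<^esub> hook_tensor_op n k m m' \<theta> t"
    unfolding carrier_hook_group by (simp add: hook_group_def hom_mult[OF hook_tensor_op_hom])
qed

lemma hook_to_poly_hook_hom: "hook_to_poly n k m \<in> hom (hook_group n k m) ZF"
  by (auto intro!: homI simp: carrier_hook_group, simp add: hook_group_def hom_mult[OF hook_to_poly_hom])

section \<open>The map d - D m on polynomials\<close>

lemma set_mset_diff_subset: "set_mset A \<subseteq> S \<Longrightarrow> set_mset (A - B) \<subseteq> S"
  by (meson in_diffD subset_iff)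

text \<open>This is d - D m with d = k + 1, extended by 0 outside bidegree (k, 1): forming M + N is
  the multiplication m, and the sum over its entries is the polarisation D.\<close>

definition hook_proj :: "nat \<Rightarrow> nat \<Rightarrow> nat \<Rightarrow> bipoly \<Rightarrow> bipoly" where
  "hook_proj n k m = frag_extend (\<lambda>(M, N). if (M, N) \<in> hook_index n k m
     then of_nat (Suc k) * frag_of (M, N) - (\<Sum>\<sigma>\<in>#M + N. frag_of (M + N - {#\<sigma>#}, {#\<sigma>#})) else 0)"

lemma hook_proj_hom: "hook_proj n k m \<in> hom ZF ZF"
  unfolding hook_proj_def by (rule frag_extend_hom)

lemma hook_proj_monom:
  assumes "size M = k" "size N = 1"
  shows "hook_proj n k m (monom_xy n m M N)
    = of_nat (Suc k) * monom_xy n m M N - (\<Sum>\<sigma>\<in>#M + N. monom_xy n m (M + N - {#\<sigma>#}) {#\<sigma>#})"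
proof (cases "set_mset M \<subseteq> surj_maps n m \<and> set_mset N \<subseteq> surj_maps n m")
  case True
  have "monom_xy n m (M + N - {#\<sigma>#}) {#\<sigma>#} = frag_of (M + N - {#\<sigma>#}, {#\<sigma>#})" if "\<sigma> \<in># M + N" for \<sigma>
    using True that by (intro monom_surj set_mset_diff_subset) auto
  then have "image_mset (\<lambda>\<sigma>. monom_xy n m (M + N - {#\<sigma>#}) {#\<sigma>#}) (M + N)
      = image_mset (\<lambda>\<sigma>. frag_of (M + N - {#\<sigma>#}, {#\<sigma>#})) (M + N)"
    by (rule image_mset_cong)
  then show ?thesis using True assms by (simp add: monom_surj hook_proj_def hook_index_def)
next
  case False
  then obtain \<rho> where \<rho>: "\<rho> \<notin> surj_maps n m" "\<rho> \<in># M + N" by auto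
  have "monom_xy n m (M + N - {#\<sigma>#}) {#\<sigma>#} = 0" if "\<sigma> \<in># M + N" for \<sigma>
  proof (rule monom_not_surj)
    \<comment> \<open>A variable outside the basis survives every splitting, on the y side if it is
      the one split off and on the x side otherwise.\<close>
    have "\<rho> = \<sigma> \<or> \<rho> \<in># M + N - {#\<sigma>#}"
      using \<rho>(2) that by (metis insert_DiffM insert_noteq_member)
    then show "\<not> (set_mset (M + N - {#\<sigma>#}) \<subseteq> surj_maps n m \<and> set_mset {#\<sigma>#} \<subseteq> surj_maps n m)"
      using \<rho>(1) by auto
  qed
  then have "image_mset (\<lambda>\<sigma>. monom_xy n m (M + N - {#\<sigma>#}) {#\<sigma>#}) (M + N) = image_mset (\<lambda>\<sigma>. 0) (M + N)"
    by (rule image_mset_cong)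
  then have "(\<Sum>\<sigma>\<in>#M + N. monom_xy n m (M + N - {#\<sigma>#}) {#\<sigma>#}) = 0"
    by (simp only: sum_mset.neutral_const)
  then show ?thesis by (simp only: monom_not_surj[OF False]) (simp add: hook_proj_def)
qed

lemma act_not_surj:
  assumes "\<not> (set_mset M \<subseteq> surj_maps n m \<and> set_mset N \<subseteq> surj_maps n m)"
  shows "act n m m' \<theta> (frag_of (M, N)) = 0"
proof -
  from assms obtain \<rho> where "\<rho> \<notin> surj_maps n m" "\<rho> \<in># M \<or> \<rho> \<in># N" by auto
  then show ?thesis by (auto simp: act_def dest!: multi_member_split)
qed

lemma act_hook_proj:
  assumes \<theta>: "simp_op m m' \<theta>"
  shows "act n m m' \<theta> (hook_proj n k m c) = hook_proj n k m' (act n m m' \<theta> c)"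
proof -
  have "(act n m m' \<theta> \<circ> hook_proj n k m) c = (hook_proj n k m' \<circ> act n m m' \<theta>) c"
  proof (rule free_hom_eqI[OF group_free_Abelian_group hom_compose[OF hook_proj_hom act_hom] hom_compose[OF act_hom hook_proj_hom]])
    fix b :: "(nat \<Rightarrow> nat) multiset \<times> (nat \<Rightarrow> nat) multiset"
    obtain M N where b: "b = (M, N)" by (cases b)
    let ?p = "pull m' \<theta>"
    consider "b \<in> hook_index n k m" | "\<not> (set_mset M \<subseteq> surj_maps n m \<and> set_mset N \<subseteq> surj_maps n m)"
      | "set_mset M \<subseteq> surj_maps n m" "set_mset N \<subseteq> surj_maps n m" "\<not> (size M = k \<and> size N = 1)"
      by (auto simp: b hook_index_def)
    then show "(act n m m' \<theta> \<circ> hook_proj n k m) (frag_of b) = (hook_proj n k m' \<circ> act n m m' \<theta>) (frag_of b)"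
    proof cases
      case 1
      then have s: "size M = k" "size N = 1" "set_mset M \<subseteq> surj_maps n m" "set_mset N \<subseteq> surj_maps n m"
        by (auto simp: b hook_index_def)
      then have mm: "set_mset M \<subseteq> mono_maps n m" "set_mset N \<subseteq> mono_maps n m" using surj_maps_subset by blast+
      have fb: "frag_of b = monom_xy n m M N" using s by (simp add: b monom_surj)
      have "act n m m' \<theta> (monom_xy n m (M + N - {#\<sigma>#}) {#\<sigma>#})
          = monom_xy n m' (image_mset ?p M + image_mset ?p N - {#?p \<sigma>#}) {#?p \<sigma>#}" if \<sigma>: "\<sigma> \<in># M + N" for \<sigma>
      proof -
        have "set_mset (M + N - {#\<sigma>#}) \<subseteq> mono_maps n m"
          using mm by (intro set_mset_diff_subset) auto
        moreover have "set_mset {#\<sigma>#} \<subseteq> mono_maps n m" using mm \<sigma> by auto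
        moreover have "image_mset ?p (M + N - {#\<sigma>#}) = image_mset ?p M + image_mset ?p N - {#?p \<sigma>#}"
          using \<sigma> image_mset_Diff[of "{#\<sigma>#}" "M + N" ?p] by simp
        ultimately show ?thesis by (simp add: act_monom[OF \<theta>])
      qed
      then have "image_mset (\<lambda>\<sigma>. act n m m' \<theta> (monom_xy n m (M + N - {#\<sigma>#}) {#\<sigma>#})) (M + N)
        = image_mset (\<lambda>\<sigma>. monom_xy n m' (image_mset ?p M + image_mset ?p N - {#?p \<sigma>#}) {#?p \<sigma>#}) (M + N)"
        by (rule image_mset_cong)
      moreover have "act n m m' \<theta> (of_nat (Suc k) * c) = of_nat (Suc k) * act n m m' \<theta> c" for c
        using poly_eval_of_int[of _ _ "int (Suc k)" c] by (simp add: act_def del: of_nat_Suc)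
      ultimately show ?thesis
        unfolding comp_def fb act_monom[OF \<theta> mm] hook_proj_monom[OF s(1,2)]
        using hook_proj_monom[of "image_mset ?p M" k "image_mset ?p N" n m'] s
        by (simp add: act_diff act_sum_mset act_monom[OF \<theta> mm] image_mset.compositionality o_def
            del: of_nat_Suc image_mset_union) (simp add: image_mset.compositionality o_def)
    next
      case 2
      then show ?thesis by (auto simp: b act_not_surj hook_proj_def hook_index_def)
    next
      case 3
      then have mm: "set_mset M \<subseteq> mono_maps n m" "set_mset N \<subseteq> mono_maps n m" using surj_maps_subset by blast+
      have "act n m m' \<theta> (frag_of b) = monom_xy n m' (image_mset ?p M) (image_mset ?p N)"
        using act_monom[OF \<theta> mm] 3 by (simp add: b monom_surj)
      \<comment> \<open>An operator keeps the bidegree of a monomial or sends it to 0, so in the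
        wrong bidegree both sides vanish.\<close>
      moreover have "hook_proj n k m' (monom_xy n m' M' N') = 0" if "\<not> (size M' = k \<and> size N' = 1)" for M' N'
      proof (cases "set_mset M' \<subseteq> surj_maps n m' \<and> set_mset N' \<subseteq> surj_maps n m'")
        case True
        then have "monom_xy n m' M' N' = frag_of (M', N')" by (simp add: monom_surj)
        then show ?thesis using that by (auto simp: hook_proj_def hook_index_def)
      next
        case False
        then show ?thesis by (simp only: monom_not_surj[OF False]) (simp add: hook_proj_def)
      qed
      ultimately show ?thesis using 3 by (auto simp: b hook_proj_def hook_index_def)
    qed
  qed
  then show ?thesis by simp
qed

lemma hom_ZF_sum_mset_const:
  assumes L: "group L" and f: "f \<in> hom ZF L" and g: "\<And>a. a \<in># A \<Longrightarrow> f (g a) = s" and s: "s \<in> carrier L"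
  shows "f (\<Sum>a\<in>#A. g a) = s [^]\<^bsub>L\<^esub> size A"
proof -
  interpret L: group L by (rule L)
  have one: "f 0 = \<one>\<^bsub>L\<^esub>" using hom_one[OF f group_free_Abelian_group L] by simp
  have mult: "f (x + y) = f x \<otimes>\<^bsub>L\<^esub> f y" for x y using hom_mult[OF f, of x y] by simp
  show ?thesis
    using g
  proof (induction A)
    case (add x A)
    then have "f (\<Sum>a\<in>#add_mset x A. g a) = s \<otimes>\<^bsub>L\<^esub> s [^]\<^bsub>L\<^esub> size A" by (simp add: mult)
    then show ?case by (metis L.nat_pow_Suc2 s size_add_mset)
  qed (simp add: one)
qed

text \<open>Each of the d terms of D m multiplies back to the product of M + N, so their sum cancels
  d times that product.\<close>

lemma hook_mult_hook_proj: "hook_mult n k m (poly_to_hook n k m (hook_proj n k m c)) = \<one>\<^bsub>sym_power (k + 1) (KZ n m)\<^esub>"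
proof -
  let ?L = "sym_power (k + 1) (KZ n m)"
  let ?F = "hook_mult n k m \<circ> poly_to_hook n k m"
  interpret L: comm_group ?L by (rule comm_group_sym_power[OF group_KZ])
  have F: "?F \<in> hom ZF ?L" by (rule hom_compose[OF poly_to_hook_hom hook_mult_hom])
  interpret F: group_hom ZF ?L ?F by (intro group_homI L.is_group F) simp
  have "(?F \<circ> hook_proj n k m) c = (\<lambda>c. \<one>\<^bsub>?L\<^esub>) c"
  proof (rule free_hom_eqI[OF L.is_group hom_compose[OF hook_proj_hom F]])
    show "(\<lambda>c. \<one>\<^bsub>?L\<^esub>) \<in> hom ZF ?L"
      by (intro homI L.one_closed L.l_one[symmetric])
    fix b :: "(nat \<Rightarrow> nat) multiset \<times> (nat \<Rightarrow> nat) multiset"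
    obtain M N where b: "b = (M, N)" by (cases b)
    show "(?F \<circ> hook_proj n k m) (frag_of b) = \<one>\<^bsub>?L\<^esub>"
    proof (cases "b \<in> hook_index n k m")
      case True
      then have s: "size M = k" "size N = 1" "set_mset M \<subseteq> surj_maps n m" "set_mset N \<subseteq> surj_maps n m"
        by (auto simp: b hook_index_def)
      let ?e = "sym_elem (k + 1) (KZ n m) (image_mset (KZ_gen n m) (M + N))"
      have e: "?e \<in> carrier ?L" using s by (intro sym_gen_closed) auto
      have 1: "?F (frag_of (M, N)) = ?e"
        using s True b by (simp add: poly_to_hook_frag_of hook_mult_gen del: One_nat_def)
      have 2: "?F (frag_of (M + N - {#\<sigma>#}, {#\<sigma>#})) = ?e" if \<sigma>: "\<sigma> \<in># M + N" for \<sigma>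
      proof -
        have "M + N - {#\<sigma>#} + {#\<sigma>#} = M + N" using \<sigma> by simp
        moreover have "size (M + N - {#\<sigma>#}) = k" using s \<sigma> by (simp add: size_Diff_singleton)
        moreover have "set_mset (M + N - {#\<sigma>#}) \<subseteq> surj_maps n m"
          using s by (intro set_mset_diff_subset) auto
        moreover have "\<sigma> \<in> surj_maps n m" using s \<sigma> by auto
        ultimately show ?thesis
          using hook_mult_gen[of "M + N - {#\<sigma>#}" k "{#\<sigma>#}" n m]
          by (simp add: poly_to_hook_frag_of hook_index_def)
      qed
      let ?u = "\<Sum>\<sigma>\<in>#M + N. frag_of (M, N)" and ?v = "\<Sum>\<sigma>\<in>#M + N. frag_of (M + N - {#\<sigma>#}, {#\<sigma>#})"
      \<comment> \<open>The multiple of the monomial is rewritten as a sum over the same multiset,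
        so that both parts are mapped to the same power.\<close>
      have "?u = of_nat (Suc k) * frag_of (M, N)" using s by (simp add: sum_mset_constant algebra_simps)
      then have "hook_proj n k m (frag_of b) = ?u - ?v" using True by (simp add: hook_proj_def b del: of_nat_Suc)
      moreover have "?F ?u = ?e [^]\<^bsub>?L\<^esub> size (M + N)" "?F ?v = ?e [^]\<^bsub>?L\<^esub> size (M + N)"
        by (rule hom_ZF_sum_mset_const[OF L.is_group F _ e], use 1 2 in simp)+
      moreover have "?F (u - v) = ?F u \<otimes>\<^bsub>?L\<^esub> inv\<^bsub>?L\<^esub> ?F v" for u v
        using F.hom_mult[of u "inv\<^bsub>ZF\<^esub> v"] F.hom_inv[of v] by simp
      ultimately have "?F (hook_proj n k m (frag_of b)) = ?e [^]\<^bsub>?L\<^esub> size (M + N) \<otimes>\<^bsub>?L\<^esub> inv\<^bsub>?L\<^esub> (?e [^]\<^bsub>?L\<^esub> size (M + N))"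
        by (simp only:)
      then show ?thesis using L.r_inv[OF L.nat_pow_closed[OF e]] by (simp only: comp_apply)
    next
      case False
      then show ?thesis using F.hom_one by (auto simp: hook_proj_def b)
    qed
  qed
  then show ?thesis by simp
qed

text \<open>The map d - D m with values in F; it brings chains of polynomials into the Schur
  functor.\<close>

definition hook_lift where
  "hook_lift n k m c = poly_to_hook n k m (hook_proj n k m c)"

lemma hook_lift_hom: "hook_lift n k m \<in> hom ZF (hook_group n k m)"
  using hom_compose[OF hook_proj_hom poly_to_hook_hom, of n k m n k m] hook_mult_hook_proj[of n k m]
  unfolding hom_def by (auto simp: hook_lift_def[abs_def] carrier_hook_group, auto simp: hook_group_def)

lemma hook_lift_act:
  "simp_op m m' \<theta> \<Longrightarrow> hook_lift n k m' (act n m m' \<theta> c) = hook_tensor_op n k m m' \<theta> (hook_lift n k m c)"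
  by (simp add: hook_lift_def act_hook_proj[symmetric] poly_to_hook_act)

text \<open>On F the multiplication vanishes, so only the term d of d - D m remains.\<close>

lemma hook_proj_kernel:
  assumes z: "z \<in> carrier (hook_group n k m)"
  shows "hook_proj n k m (hook_to_poly n k m z) = of_nat (Suc k) * hook_to_poly n k m z"
proof -
  \<comment> \<open>The polynomial forms of m, which turns y variables into x variables, and of D.
    Since \<open>sym_form\<close> in the x variables carries \<open>hook_mult\<close> to the former,
    the former vanishes on the kernel.\<close>
  let ?mh = "frag_extend (\<lambda>(M, N). frag_of (M + N, {#})) :: bipoly \<Rightarrow> bipoly"
  let ?Dh = "frag_extend (\<lambda>(M, N). \<Sum>\<sigma>\<in>#M. frag_of (M - {#\<sigma>#}, {#\<sigma>#})) :: bipoly \<Rightarrow> bipoly"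
  have zT: "z \<in> carrier (hook_tensor n k m)" using z by (simp add: carrier_hook_group)
  have "(?mh \<circ> hook_to_poly n k m) z = (sym_form n m (xvar n m) \<circ> hook_mult n k m) z"
  proof (rule hook_tensor_hom_eqI[OF group_free_Abelian_group hom_compose[OF hook_to_poly_hom frag_extend_hom]
        hom_compose[OF hook_mult_hom sym_form_hom] _ zT])
    fix M N assume MN: "size M = k" "size N = 1" "set_mset M \<subseteq> surj_maps n m" "set_mset N \<subseteq> surj_maps n m"
    have "sym_form n m (xvar n m) (sym_elem (k + 1) (KZ n m) (image_mset (KZ_gen n m) (M + N)))
      = (\<Prod>\<sigma>\<in>#M + N. xvar n m \<sigma>)"
      using MN by (intro sym_form_gen) (auto simp: xvar_def)
    also have "\<dots> = frag_of (M + N, {#})"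
      using monom_surj[of "M + N" n m "{#}"] MN by (simp add: monom_xy_def)
    finally show "(?mh \<circ> hook_to_poly n k m) (hook_tensor_gen n k m M N) = (sym_form n m (xvar n m) \<circ> hook_mult n k m) (hook_tensor_gen n k m M N)"
      using MN by (simp add: hook_to_poly_gen monom_surj hook_mult_gen del: One_nat_def)
  qed
  moreover have "sym_form n m (xvar n m) \<one>\<^bsub>sym_power (k + 1) (KZ n m)\<^esub> = 0"
    using hom_one[OF sym_form_hom group_sym_KZ group_free_Abelian_group] by simp
  ultimately have 0: "?mh (hook_to_poly n k m z) = 0" using z by (simp add: carrier_hook_group)
  have "hook_proj n k m c = of_nat (Suc k) * c - ?Dh (?mh c)" if "Poly_Mapping.keys c \<subseteq> hook_index n k m" for c
    using that
    by (induction c rule: frag_induction)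
      (auto simp: hook_proj_def frag_extend_diff right_diff_distrib simp del: of_nat_Suc image_mset_union)
  from this[OF keys_hook_to_poly[OF zT]] show ?thesis using 0 by simp
qed

text \<open>As \<open>hook_proj\<close> is k + 1 - D m, the sum D m - 1 occurring in
  \<open>hook_htpy_top\<close> is k minus \<open>hook_proj\<close>.\<close>

lemma hook_htpy_top_hook_proj:
  assumes n: "n = 2 \<or> n = 3" and c: "Poly_Mapping.keys c \<subseteq> hook_index n k m"
  shows "hook_htpy n m {..m} c = of_nat k * c - (-1) ^ n * (of_nat k * c - hook_proj n k m c)"
  using c
proof (induction c rule: frag_induction)
  case (one x)
  then obtain M N where MN: "x = (M, N)" "size M = k" "size N = 1" "set_mset M \<subseteq> surj_maps n m" "set_mset N \<subseteq> surj_maps n m"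
    by (auto simp: hook_index_def)
  then obtain \<tau> where "N = {#\<tau>#}" using size_1_singleton_mset by blast
  with MN have x: "x = (M, {#\<tau>#})" "size M = k" "set_mset M \<subseteq> surj_maps n m" "\<tau> \<in> surj_maps n m" by auto
  have "image_mset (\<lambda>\<sigma>. frag_of (add_mset \<tau> M - {#\<sigma>#}, {#\<sigma>#})) M = image_mset (\<lambda>\<sigma>. frag_of (add_mset \<tau> (M - {#\<sigma>#}), {#\<sigma>#})) M"
    by (intro image_mset_cong) simp
  then have "hook_proj n k m (frag_of x)
    = of_nat k * frag_of x - (\<Sum>\<sigma>\<in>#M. frag_of (add_mset \<tau> (M - {#\<sigma>#}), {#\<sigma>#}))"
    using one x by (simp add: hook_proj_def algebra_simps)
  then show ?case using hook_htpy_top[OF n x(3,4)] x by simp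
next
  case (diff a b)
  have "hook_proj n k m (a - b) = hook_proj n k m a - hook_proj n k m b" by (simp add: hook_proj_def frag_extend_diff)
  then show ?case unfolding hook_htpy_diff using diff by (simp add: right_diff_distrib)
qed (simp add: hook_proj_def)

section \<open>Homology\<close>

text \<open>Writing d as \<open>Suc k\<close> lets the truncated difference d - 1 in
  \<open>schur_hook\<close> simplify to k.\<close>

abbreviation hook_cx where
  "hook_cx n k \<equiv> simp_apply (schur_hook (Suc k)) (simp_tensor (K n) integer_group)"

lemma sob_hook_cx: "sob (hook_cx n k) m = hook_group n k m"
  by (simp add: simp_apply_def schur_hook_def simp_tensor_def hook_group_def hook_tensor_def hook_mult_def KZ_def Let_def)

lemma sop_hook_cx: "sop (hook_cx n k) m m' \<theta> = hook_tensor_op n k m m' \<theta>"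
  by (simp add: simp_apply_def schur_hook_def simp_tensor_def hook_tensor_op_def KZ_op_def KZ_def)

section \<open>The boundary in terms of polynomials\<close>

lemma finprod_pow_hom:
  assumes H: "comm_group H" and f: "\<And>i. i \<in> A \<Longrightarrow> f i \<in> hom G H"
  shows "(\<lambda>x. finprod H (\<lambda>i. f i x [^]\<^bsub>H\<^esub> (e i :: int)) A) \<in> hom G H"
proof -
  interpret H: comm_group H by fact
  show ?thesis
  proof (rule homI)
    fix x assume "x \<in> carrier G"
    then show "finprod H (\<lambda>i. f i x [^]\<^bsub>H\<^esub> (e i :: int)) A \<in> carrier H"
      using hom_in_carrier[OF f] by (intro H.finprod_closed) auto
  next
    fix x y assume xy: "x \<in> carrier G" "y \<in> carrier G"
    have "finprod H (\<lambda>i. f i (x \<otimes>\<^bsub>G\<^esub> y) [^]\<^bsub>H\<^esub> (e i :: int)) A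
      = finprod H (\<lambda>i. f i x [^]\<^bsub>H\<^esub> e i \<otimes>\<^bsub>H\<^esub> f i y [^]\<^bsub>H\<^esub> e i) A"
      using xy hom_in_carrier[OF f] hom_mult[OF f]
      by (intro H.finprod_cong) (auto simp: simp_implies_def H.int_pow_distrib)
    also have "\<dots> = finprod H (\<lambda>i. f i x [^]\<^bsub>H\<^esub> e i) A \<otimes>\<^bsub>H\<^esub> finprod H (\<lambda>i. f i y [^]\<^bsub>H\<^esub> e i) A"
      using xy hom_in_carrier[OF f] by (intro H.finprod_multf) auto
    finally show "finprod H (\<lambda>i. f i (x \<otimes>\<^bsub>G\<^esub> y) [^]\<^bsub>H\<^esub> (e i :: int)) A
      = finprod H (\<lambda>i. f i x [^]\<^bsub>H\<^esub> e i) A \<otimes>\<^bsub>H\<^esub> finprod H (\<lambda>i. f i y [^]\<^bsub>H\<^esub> e i) A" .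
  qed
qed

lemma boundary_hook_cx:
  "boundary (hook_cx n k) (Suc m) x
    = finprod (hook_group n k m) (\<lambda>i. hook_tensor_op n k (Suc m) m (coface i) x [^]\<^bsub>hook_group n k m\<^esub> ((- 1) ^ i :: int)) {..Suc m}"
  by (simp add: boundary_def sob_hook_cx sop_hook_cx)

lemma boundary_hook_hom:
  "boundary (hook_cx n k) (Suc m) \<in> hom (hook_group n k (Suc m)) (hook_group n k m)"
proof -
  have "(\<lambda>x. boundary (hook_cx n k) (Suc m) x) \<in> hom (hook_group n k (Suc m)) (hook_group n k m)"
    unfolding boundary_hook_cx
    by (intro finprod_pow_hom comm_group_hook hook_tensor_op_hook_hom simp_op_coface) auto
  then show ?thesis by simp
qed

lemma int_pow_ZF: "x [^]\<^bsub>ZF\<^esub> (e :: int) = of_int e * x" for x :: "'a::comm_monoid_add \<Rightarrow>\<^sub>0 int"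
  by (simp add: frag_cmul_eq_times)

lemma hook_lift_int_pow:
  "hook_lift n k m (of_int e * c) = hook_lift n k m c [^]\<^bsub>hook_group n k m\<^esub> e"
  unfolding int_pow_ZF[symmetric]
  by (rule hom_int_pow[OF hook_lift_hom _ group_free_Abelian_group group_hook]) simp

lemma poly_to_hook_int_pow:
  "poly_to_hook n k m (of_int e * c) = poly_to_hook n k m c [^]\<^bsub>hook_tensor n k m\<^esub> e"
  unfolding int_pow_ZF[symmetric]
  by (rule hom_int_pow[OF poly_to_hook_hom _ group_free_Abelian_group group_hook_tensor]) simp

lemma hom_ZF_finprod:
  assumes G: "comm_group G" and f: "f \<in> hom G ZF" and g: "g \<in> A \<rightarrow> carrier G" and A: "finite A"
  shows "f (finprod G g A) = (\<Sum>a\<in>A. f (g a))"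
proof -
  interpret G: comm_group G by fact
  show ?thesis
    using A g
  proof (induction A rule: finite_induct)
    case empty
    then show ?case using hom_one[OF f G.is_group group_free_Abelian_group] by simp
  next
    case (insert a A)
    then have "g \<in> A \<rightarrow> carrier G" "g a \<in> carrier G" by auto
    then show ?case using insert hom_mult[OF f] by simp
  qed
qed

lemma finprod_hom_ZF:
  assumes G: "comm_group G" and f: "f \<in> hom ZF G" and A: "finite A"
  shows "finprod G (\<lambda>a. f (g a)) A = f (\<Sum>a\<in>A. g a)"
proof -
  interpret G: comm_group G by fact
  have cl: "f x \<in> carrier G" for x using hom_in_carrier[OF f] by simp
  show ?thesis
    using A
  proof (induction A rule: finite_induct)
    case empty
    then show ?case using hom_one[OF f group_free_Abelian_group G.is_group] by simp
  next
    case (insert a A)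
    then show ?case using cl hom_mult[OF f, of "g a" "sum g A"] by simp
  qed
qed

lemma hook_to_poly_boundary:
  assumes x: "x \<in> carrier (hook_group n k (Suc m))"
  shows "hook_to_poly n k m (boundary (hook_cx n k) (Suc m) x)
    = (\<Sum>j\<le>Suc m. (-1) ^ j * act n (Suc m) m (coface j) (hook_to_poly n k (Suc m) x))"
proof -
  interpret G: comm_group "hook_group n k m" by (rule comm_group_hook)
  have cl: "hook_tensor_op n k (Suc m) m (coface j) x \<in> carrier (hook_group n k m)" if "j \<le> Suc m" for j
    using hom_in_carrier[OF hook_tensor_op_hook_hom[OF simp_op_coface[OF that]] x] .
  have xT: "x \<in> carrier (hook_tensor n k (Suc m))" using x by (simp add: carrier_hook_group)
  have "hook_to_poly n k m (boundary (hook_cx n k) (Suc m) x)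
    = (\<Sum>j\<le>Suc m. hook_to_poly n k m (hook_tensor_op n k (Suc m) m (coface j) x [^]\<^bsub>hook_group n k m\<^esub> ((- 1) ^ j :: int)))"
    unfolding boundary_hook_cx using cl by (intro hom_ZF_finprod[OF comm_group_hook hook_to_poly_hook_hom]) auto
  also have "\<dots> = (\<Sum>j\<le>Suc m. (-1) ^ j * act n (Suc m) m (coface j) (hook_to_poly n k (Suc m) x))"
  proof (intro sum.cong refl)
    fix j assume "j \<in> {..Suc m}"
    then have j: "j \<le> Suc m" by simp
    show "hook_to_poly n k m (hook_tensor_op n k (Suc m) m (coface j) x [^]\<^bsub>hook_group n k m\<^esub> ((- 1) ^ j :: int))
      = (-1) ^ j * act n (Suc m) m (coface j) (hook_to_poly n k (Suc m) x)"
      unfolding hom_int_pow[OF hook_to_poly_hook_hom cl[OF j] G.is_group group_free_Abelian_group] int_pow_ZF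
        hook_to_poly_op[OF simp_op_coface[OF j] xT] by simp
  qed
  finally show ?thesis .
qed

lemma boundary_hook_lift:
  "boundary (hook_cx n k) (Suc m) (hook_lift n k (Suc m) w)
    = hook_lift n k m (\<Sum>j\<le>Suc m. (-1) ^ j * act n (Suc m) m (coface j) w)"
proof -
  interpret G: comm_group "hook_group n k m" by (rule comm_group_hook)
  have "hook_tensor_op n k (Suc m) m (coface j) (hook_lift n k (Suc m) w) [^]\<^bsub>hook_group n k m\<^esub> ((- 1) ^ j :: int)
      = hook_lift n k m ((-1) ^ j * act n (Suc m) m (coface j) w)" if "j \<le> Suc m" for j
    unfolding hook_lift_act[OF simp_op_coface[OF that], symmetric]
    using hook_lift_int_pow[of n k m "(-1) ^ j"] by simp
  then have "boundary (hook_cx n k) (Suc m) (hook_lift n k (Suc m) w)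
    = finprod (hook_group n k m) (\<lambda>j. hook_lift n k m ((-1) ^ j * act n (Suc m) m (coface j) w)) {..Suc m}"
    unfolding boundary_hook_cx using hom_in_carrier[OF hook_lift_hom]
    by (intro G.finprod_cong) (auto simp: simp_implies_def)
  also have "\<dots> = hook_lift n k m (\<Sum>j\<le>Suc m. (-1) ^ j * act n (Suc m) m (coface j) w)"
    by (intro finprod_hom_ZF comm_group_hook hook_lift_hom) simp
  finally show ?thesis .
qed

lemma subgroup_cycles: "subgroup (cycles (hook_cx n k) q) (hook_group n k q)"
proof (cases q)
  case 0
  then show ?thesis by (simp add: cycles_def sob_hook_cx group.subgroup_self group_hook)
next
  case (Suc r)
  interpret group_hom "hook_group n k q" "hook_group n k r" "boundary (hook_cx n k) q"
    unfolding Suc by (intro group_homI group_hook boundary_hook_hom)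
  show ?thesis using subgroup_kernel by (simp add: cycles_def sob_hook_cx Suc)
qed

lemma subgroup_boundaries:
  "subgroup (boundary (hook_cx n k) (Suc q) ` carrier (sob (hook_cx n k) (Suc q))) (hook_group n k q)"
  unfolding sob_hook_cx
  by (intro group_hom.img_is_subgroup group_homI group_hook boundary_hook_hom)

text \<open>Since D m = 0 on F, the homotopy at the full up-set multiplies z by k + (-1)^n, and the
  prism operator makes this multiple a boundary of polynomials. Applying \<open>hook_lift\<close>
  turns it into a boundary in F and contributes the factor k + 1.\<close>

lemma cycle_power_boundary:
  assumes n: "n = 2 \<or> n = 3" and z: "z \<in> cycles (hook_cx n k) q"
  shows "z [^]\<^bsub>hook_group n k q\<^esub> (int (Suc k) * (int k + (-1) ^ n))
    \<in> boundary (hook_cx n k) (Suc q) ` carrier (sob (hook_cx n k) (Suc q))"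
proof -
  interpret G: comm_group "hook_group n k q" by (rule comm_group_hook)
  let ?z = "hook_to_poly n k q z"
  have zG: "z \<in> carrier (hook_group n k q)" using z subgroup.subset[OF subgroup_cycles] by blast
  then have zT: "z \<in> carrier (hook_tensor n k q)" by (simp add: carrier_hook_group)
  note keys = keys_hook_to_poly[OF zT]
  have "act n q q (\<lambda>j. j) c = c" if "Poly_Mapping.keys c \<subseteq> hook_index n k q" for c
    using that by (induction c rule: frag_induction) (auto simp: act_id hook_index_def act_diff)
  then have id: "act n q q (\<lambda>j. j) ?z = ?z" using keys .
  have cyc: "(\<Sum>j\<le>q. (-1) ^ j * act n q (q - 1) (coface j) ?z) = 0" if "0 < q"
  proof -
    obtain r where r: "q = Suc r" using \<open>0 < q\<close> by (cases q) auto
    have "boundary (hook_cx n k) q z = \<one>\<^bsub>hook_group n k r\<^esub>"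
      using z by (simp add: cycles_def r sob_hook_cx kernel_def)
    then have "hook_to_poly n k r (boundary (hook_cx n k) q z) = 0"
      using hom_one[OF hook_to_poly_hook_hom group_hook group_free_Abelian_group] by simp
    then show ?thesis using hook_to_poly_boundary[of z n k r] zG by (simp add: r)
  qed
  \<comment> \<open>The chain w is only a polynomial; its image under \<open>hook_lift\<close> is
    the chain of F that is used.\<close>
  obtain w where w: "(\<Sum>j\<le>Suc q. (-1) ^ j * act n (Suc q) q (coface j) w) = hook_htpy n q {..q} ?z"
    using prism_boundary[OF n cyc id] by blast
  \<comment> \<open>With \<open>hook_proj\<close> acting as k + 1, the factor is k - (-1)^n (k - (k
    + 1)) = k + (-1)^n.\<close>
  have "hook_htpy n q {..q} ?z = of_int (int k + (-1) ^ n) * ?z"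
    unfolding hook_htpy_top_hook_proj[OF n keys] hook_proj_kernel[OF zG] by (simp add: algebra_simps)
  then have "boundary (hook_cx n k) (Suc q) (hook_lift n k (Suc q) w) = hook_lift n k q (of_int (int k + (-1) ^ n) * ?z)"
    unfolding boundary_hook_lift w by simp
  also have "\<dots> = hook_lift n k q ?z [^]\<^bsub>hook_group n k q\<^esub> (int k + (-1) ^ n)"
    by (rule hook_lift_int_pow)
  also have "hook_lift n k q ?z = poly_to_hook n k q (of_int (int (Suc k)) * ?z)"
    unfolding hook_lift_def hook_proj_kernel[OF zG] by simp
  also have "\<dots> = poly_to_hook n k q ?z [^]\<^bsub>hook_tensor n k q\<^esub> int (Suc k)"
    by (rule poly_to_hook_int_pow)
  also have "\<dots> = z [^]\<^bsub>hook_group n k q\<^esub> int (Suc k)"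
    unfolding poly_to_hook_hook_to_poly[OF zT]
    using group.int_pow_consistent[OF group_hook_tensor subgroup_hook zG] by (simp add: hook_group_def)
  finally have "boundary (hook_cx n k) (Suc q) (hook_lift n k (Suc q) w)
      = z [^]\<^bsub>hook_group n k q\<^esub> (int (Suc k) * (int k + (-1) ^ n))"
    using zG by (simp add: G.int_pow_pow)
  moreover have "hook_lift n k (Suc q) w \<in> carrier (sob (hook_cx n k) (Suc q))"
    unfolding sob_hook_cx using hom_in_carrier[OF hook_lift_hom] by simp
  ultimately show ?thesis by (metis image_eqI)
qed

section \<open>Torsion in tensor products and subquotients\<close>

lemma trivial_tensor_torsion:
  assumes H: "group H" and N: "\<And>x. x \<in> carrier H \<Longrightarrow> x [^]\<^bsub>H\<^esub> (N :: int) = \<one>\<^bsub>H\<^esub>" and cop: "coprime N (int p)"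
  shows "trivial_group (tensor_group H (integer_mod_group p))"
proof -
  let ?C = "integer_mod_group p"
  let ?T = "tensor_group H ?C"
  have C: "group ?C" by simp
  interpret T: comm_group ?T by (rule comm_group_tensor_group[OF H C])
  have one: "tensor_elem H ?C x c = \<one>\<^bsub>?T\<^esub>" if x: "x \<in> carrier H" and c: "c \<in> carrier ?C" for x c
  proof -
    let ?t = "tensor_elem H ?C x c"
    have t: "?t \<in> carrier ?T" by (rule tensor_elem_closed[OF H C x c])
    have "?t [^]\<^bsub>?T\<^esub> N = tensor_elem H ?C (x [^]\<^bsub>H\<^esub> N) c"
      using hom_int_pow[OF tensor_elem_left_hom[OF H C c] x H T.is_group] by simp
    also have "\<dots> = \<one>\<^bsub>?T\<^esub>"
      unfolding N[OF x] by (rule hom_one[OF tensor_elem_left_hom[OF H C c] H T.is_group])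
    finally have tN: "?t [^]\<^bsub>?T\<^esub> N = \<one>\<^bsub>?T\<^esub>" .
    have "?t [^]\<^bsub>?T\<^esub> int p = tensor_elem H ?C x (c [^]\<^bsub>?C\<^esub> int p)"
      using hom_int_pow[OF tensor_elem_right_hom[OF H C x] c C T.is_group] by simp
    also have "\<dots> = \<one>\<^bsub>?T\<^esub>"
      using hom_one[OF tensor_elem_right_hom[OF H C x] C T.is_group] by (simp add: int_pow_integer_mod_group)
    finally have tp: "?t [^]\<^bsub>?T\<^esub> int p = \<one>\<^bsub>?T\<^esub>" .
    \<comment> \<open>A pure tensor is killed by N through its left factor and by p through its
      right one, hence by 1.\<close>
    obtain a b where ab: "a * N + b * int p = 1"
      using bezout_int[of N "int p"] cop by auto
    have "?t = ?t [^]\<^bsub>?T\<^esub> (a * N + b * int p)" using t by (simp add: ab)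
    also have "\<dots> = ?t [^]\<^bsub>?T\<^esub> (N * a) \<otimes>\<^bsub>?T\<^esub> ?t [^]\<^bsub>?T\<^esub> (int p * b)"
      using t by (simp add: T.int_pow_mult mult.commute)
    also have "\<dots> = \<one>\<^bsub>?T\<^esub>"
      using t by (simp add: T.int_pow_pow[symmetric] tN tp)
    finally show ?thesis .
  qed
  have "t = \<one>\<^bsub>?T\<^esub>" if "t \<in> carrier ?T" for t
  proof -
    have "(\<lambda>t. t) t = (\<lambda>t. \<one>\<^bsub>?T\<^esub>) t"
    proof (rule tensor_hom_eqI[OF H C T.is_group _ _ _ that])
      show "tensor_elem H ?C x c = \<one>\<^bsub>?T\<^esub>" if "x \<in> carrier H" "c \<in> carrier ?C" for x c
        using one[OF that] .
      show "(\<lambda>t. t) \<in> hom ?T ?T" "(\<lambda>t. \<one>\<^bsub>?T\<^esub>) \<in> hom ?T ?T" by (auto intro!: homI)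
    qed
    then show ?thesis by simp
  qed
  then show ?thesis by (auto simp: T.trivial_group_subset)
qed

text \<open>Even when \<open>B\<close> is not contained in \<open>Z\<close>, the record \<open>G\<lparr>carrier := Z\<rparr> Mod B\<close> is the image of \<open>Z\<close> in
  \<open>G Mod B\<close>.\<close>

lemma subquotient_group:
  assumes G: "comm_group G" and Z: "subgroup Z G" and B: "subgroup B G"
  shows "group (G\<lparr>carrier := Z\<rparr> Mod B)"
    and "(\<lambda>z. B #>\<^bsub>G\<^esub> z) \<in> hom (G\<lparr>carrier := Z\<rparr>) (G\<lparr>carrier := Z\<rparr> Mod B)"
    and "carrier (G\<lparr>carrier := Z\<rparr> Mod B) = (\<lambda>z. B #>\<^bsub>G\<^esub> z) ` Z"
proof -
  interpret G: comm_group G by fact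
  interpret B: normal B G by (rule G.subgroup_imp_normal[OF B])
  interpret q: group_hom G "G Mod B" "\<lambda>z. B #>\<^bsub>G\<^esub> z"
    using B.r_coset_hom_Mod B.factorgroup_is_group by (intro group_homI) auto
  have eq: "G\<lparr>carrier := Z\<rparr> Mod B = (G Mod B)\<lparr>carrier := (\<lambda>z. B #>\<^bsub>G\<^esub> z) ` Z\<rparr>"
    by (auto simp: FactGroup_def RCOSETS_def r_coset_def set_mult_def[abs_def])
  show "group (G\<lparr>carrier := Z\<rparr> Mod B)"
    unfolding eq by (rule subgroup.subgroup_is_group[OF q.subgroup_img_is_subgroup[OF Z] B.factorgroup_is_group])
  show "carrier (G\<lparr>carrier := Z\<rparr> Mod B) = (\<lambda>z. B #>\<^bsub>G\<^esub> z) ` Z"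
    unfolding eq by simp
  show "(\<lambda>z. B #>\<^bsub>G\<^esub> z) \<in> hom (G\<lparr>carrier := Z\<rparr>) (G\<lparr>carrier := Z\<rparr> Mod B)"
    unfolding eq
  proof (rule homI)
    fix x y assume "x \<in> carrier (G\<lparr>carrier := Z\<rparr>)" "y \<in> carrier (G\<lparr>carrier := Z\<rparr>)"
    then have "x \<in> carrier G" "y \<in> carrier G" using subgroup.subset[OF Z] by auto
    then show "B #>\<^bsub>G\<^esub> (x \<otimes>\<^bsub>G\<lparr>carrier := Z\<rparr>\<^esub> y)
        = (B #>\<^bsub>G\<^esub> x) \<otimes>\<^bsub>(G Mod B)\<lparr>carrier := (\<lambda>z. B #>\<^bsub>G\<^esub> z) ` Z\<rparr>\<^esub> (B #>\<^bsub>G\<^esub> y)"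
      by (simp add: B.rcos_sum del: q.hom_mult)
  qed simp
qed

lemma subquotient_torsion:
  assumes G: "comm_group G" and Z: "subgroup Z G" and B: "subgroup B G"
    and N: "\<And>z. z \<in> Z \<Longrightarrow> z [^]\<^bsub>G\<^esub> (N :: int) \<in> B" and x: "x \<in> carrier (G\<lparr>carrier := Z\<rparr> Mod B)"
  shows "x [^]\<^bsub>G\<lparr>carrier := Z\<rparr> Mod B\<^esub> N = \<one>\<^bsub>G\<lparr>carrier := Z\<rparr> Mod B\<^esub>"
proof -
  interpret G: comm_group G by fact
  obtain z where z: "z \<in> Z" "x = B #>\<^bsub>G\<^esub> z" using x unfolding subquotient_group(3)[OF assms(1-3)] by auto
  have "x [^]\<^bsub>G\<lparr>carrier := Z\<rparr> Mod B\<^esub> N = B #>\<^bsub>G\<^esub> (z [^]\<^bsub>G\<lparr>carrier := Z\<rparr>\<^esub> N)"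
    using hom_int_pow[OF subquotient_group(2)[OF assms(1-3)] _ subgroup.subgroup_is_group[OF Z G.is_group]
        subquotient_group(1)[OF assms(1-3)], of z N] z by simp
  also have "\<dots> = B #>\<^bsub>G\<^esub> (z [^]\<^bsub>G\<^esub> N)" using G.int_pow_consistent[OF Z z(1)] by simp
  also have "\<dots> = B" using N[OF z(1)] by (rule subgroup.rcos_const[OF B G.is_group])
  finally show ?thesis by (simp add: FactGroup_def)
qed

lemma trivial_derived_hook:
  assumes n: "n = 2 \<or> n = 3" and cop: "coprime (int (Suc k) * (int k + (-1) ^ n)) (int p)"
  shows "trivial_group (tensor_group (derived_functor q (schur_hook (Suc k)) integer_group n) (integer_mod_group p))"
proof -
  let ?G = "hook_group n k q" and ?Z = "cycles (hook_cx n k) q"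
  let ?B = "boundary (hook_cx n k) (Suc q) ` carrier (sob (hook_cx n k) (Suc q))"
  note sub = comm_group_hook subgroup_cycles subgroup_boundaries
  have "trivial_group (tensor_group (?G\<lparr>carrier := ?Z\<rparr> Mod ?B) (integer_mod_group p))"
  proof (rule trivial_tensor_torsion[OF subquotient_group(1)[OF sub] _ cop])
    show "x [^]\<^bsub>?G\<lparr>carrier := ?Z\<rparr> Mod ?B\<^esub> (int (Suc k) * (int k + (-1) ^ n)) = \<one>\<^bsub>?G\<lparr>carrier := ?Z\<rparr> Mod ?B\<^esub>"
      if "x \<in> carrier (?G\<lparr>carrier := ?Z\<rparr> Mod ?B)" for x
      by (rule subquotient_torsion[OF sub cycle_power_boundary[OF n] that])
  qed
  then show ?thesis by (simp add: derived_functor_def homology_def sob_hook_cx)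
qed

theorem proposition6p13:
  fixes d p :: nat
  assumes "d \<ge> 3" and "prime p"
  shows "(\<not> [d = 0] (mod p) \<longrightarrow>
            (\<forall>q. trivial_group
              (tensor_group (derived_functor q (schur_hook d) integer_group 2) (integer_mod_group p)))) \<and>
         (\<not> [d = 0] (mod p) \<and> \<not> [d = 2] (mod p) \<longrightarrow>
            (\<forall>q. trivial_group
              (tensor_group (derived_functor q (schur_hook d) integer_group 3) (integer_mod_group p))))"
proof (intro conjI impI allI)
  \<comment> \<open>With k = d - 1 the factor k + (-1)^n is d for n = 2 and d - 2 for n = 3.\<close>
  obtain k where k: "d = Suc k" using assms(1) by (cases d) auto
  have p: "prime (int p)" using assms(2) by simp
  have d0: "coprime (int d) (int p)" if "\<not> [d = 0] (mod p)"
    using that p by (metis cong_0_iff coprime_commute int_dvd_int_iff prime_imp_coprime)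
  have d2: "coprime (int d - 2) (int p)" if "\<not> [d = 2] (mod p)"
  proof -
    have "\<not> int p dvd int d - 2"
      using that by (metis cong_iff_dvd_diff cong_int_iff of_nat_numeral)
    then show ?thesis using p by (metis coprime_commute prime_imp_coprime)
  qed
  show "trivial_group (tensor_group (derived_functor q (schur_hook d) integer_group 2) (integer_mod_group p))"
    if "\<not> [d = 0] (mod p)" for q
    unfolding k by (rule trivial_derived_hook) (use d0[OF that] in \<open>simp_all add: k add.commute\<close>)
  show "trivial_group (tensor_group (derived_functor q (schur_hook d) integer_group 3) (integer_mod_group p))"
    if "\<not> [d = 0] (mod p) \<and> \<not> [d = 2] (mod p)" for q
    unfolding k by (rule trivial_derived_hook) (use d0 d2 that in \<open>simp_all add: k\<close>)
qed

end
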